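(* Fix $\varepsilon\in(0,\frac1{10})$ and suppose that $|\alpha-\frac aq|\le\frac1{qx}$, where $(a,q)=1$ and $(\log x)^{2+\varepsilon}\le q\le x/(\log x)^{3+\varepsilon}$. For any fixed $c\in(0,1)$, if $f:\mathbb{N}\to\mathbb{U}$ is a multiplicative function for which $$\Big|\sum_{n\le x} f(n)e(n\alpha)\Big|\ge \frac{cx}{\log x},$$ then there exist a positive integer $h\ll (1/c)^2\log(1/c)$ and a real number $z$ satisfying $c^2x/\log(1/c)\ll z\le x/2h$ such that $$\Big|\sum_{z<p\le 2z} f(p)e(hp\alpha)\Big|\gg \frac{c^3}{\log(1/c)}\,\frac{z}{\log z}.$$
   Context: $\mathbb{U}=\{z\in\mathbb{C}:|z|\le1\}$ and $e(t)=\exp(2\pi i t)$. Here $\alpha$ is real, $a$ and $q$ are integers, and the letter $p$ denotes primes. The number $x$ is understood to be sufficiently large in terms of the fixed quantities $\varepsilon$ and $c$.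
   Formalization: The implied constants are uniform for c in (0,c0] for each c0<1 and may depend on c0; absolute constants on all of (0,1) are impossible, since (1/c)^2 log(1/c) tends to 0 as c tends to 1 while h is at least 1. *)

theory Defs
  imports Complex_Main "HOL-Computational_Algebra.Primes"
begin

definition add_char :: "real \<Rightarrow> complex" where
  "add_char t = exp (2 * complex_of_real pi * \<i> * complex_of_real t)"

text \<open>Arithmetic functions live on the positive integers; the value at \<open>0\<close> is irrelevant.\<close>

definition multiplicative_fun :: "(nat \<Rightarrow> complex) \<Rightarrow> bool" where
  "multiplicative_fun f \<longleftrightarrow>
     f 1 = 1 \<and> (\<forall>m n. m \<ge> 1 \<longrightarrow> n \<ge> 1 \<longrightarrow> coprime m n \<longrightarrow> f (m * n) = f m * f n)"

definition unit_disc_valued :: "(nat \<Rightarrow> complex) \<Rightarrow> bool" where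
  "unit_disc_valued f \<longleftrightarrow> (\<forall>n\<ge>1. cmod (f n) \<le> 1)"

definition exp_sum :: "(nat \<Rightarrow> complex) \<Rightarrow> real \<Rightarrow> real \<Rightarrow> complex" where
  "exp_sum f \<alpha> x = (\<Sum>n | 1 \<le> n \<and> real n \<le> x. f n * add_char (real n * \<alpha>))"

definition dyadic_prime_exp_sum :: "(nat \<Rightarrow> complex) \<Rightarrow> real \<Rightarrow> real \<Rightarrow> complex" where
  "dyadic_prime_exp_sum f \<beta> z =
     (\<Sum>p | prime p \<and> z < real p \<and> real p \<le> 2 * z. f p * add_char (real p * \<beta>))"

end

theory Submission
  imports Defs "HOL-Number_Theory.Number_Theory" "HOL-Computational_Algebra.Squarefree"
    "HOL-Analysis.Analysis"
begin

text \<open>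
  Write \<open>L = ln x\<close> and sort the integers \<open>n \<le> x\<close> by their largest prime factor: \<open>n = m * p\<close>.
  If \<open>p\<close> exceeds about \<open>x / H\<close>, where \<open>H\<close> is of order \<open>(1/c)\<^sup>2 ln (1/c)\<close>, then \<open>m < H\<close>, and for each
  such \<open>m\<close> the primes \<open>p \<le> x / m\<close> fall into dyadic intervals \<open>(z, 2 z]\<close>.  There are \<open>O(H)\<close> values of \<open>m\<close>,
  so if these \<open>n\<close> carry at least half of the assumed lower bound \<open>c x / L\<close>, then one of the dyadic prime
  sums, with \<open>h = m\<close>, is as large as claimed.  It remains to bound the contribution of all other \<open>n\<close> by
  \<open>(c/2) x / L\<close>; this is \<open>large_primes_carry_exp_sum\<close>.

  Cut the range of \<open>p\<close> into short blocks \<open>(P, (1 + \<eta>) P]\<close> with \<open>\<eta> = L powr (-1 - \<epsilon>/4)\<close>.  Within a block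
  the conditions ``\<open>p\<close> is the largest prime factor'' and ``\<open>m p \<le> x\<close>'' can be replaced by conditions on
  \<open>m\<close> alone, at the cost of the few \<open>n\<close> with two primes in one block and the few near the hyperbola;
  smooth \<open>n\<close>, without a prime factor above \<open>y = exp (L powr (1 - \<epsilon>/16))\<close>, are negligible
  (\<open>exp_sum_decomposition\<close>).  What is left for each block is a bilinear sum, which Cauchy--Schwarz reduces
  to a mean square over \<open>m \<le> M = x / ((1 + \<eta>) P)\<close> of the prime sum \<open>S(m \<alpha>)\<close> over the block.

  The mean square is the heart of the matter (\<open>bilinear_block_bound\<close>).  The large sieve alone would lose a
  factor \<open>ln P\<close>.  As \<open>S\<close> is supported on primes, Montgomery's inequality bounds \<open>|S(\<theta>)|\<^sup>2\<close> by \<open>\<phi>(d)\<close> times the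
  sum of \<open>|S(\<theta> + b/d)|\<^sup>2\<close> over reduced \<open>b/d\<close>, for every squarefree \<open>d \<le> Q\<close>.  Averaging over \<open>d\<close> gains
  \<open>\<Sum> 1/\<phi>(d)\<close>, of order \<open>ln Q\<close>, provided that the points \<open>m \<alpha> + b/d\<close> do not cluster.  Let \<open>b0/r\<close> be a
  Dirichlet approximation of \<open>\<alpha>\<close>.  When \<open>d\<close> is kept coprime to a divisor \<open>g\<close> of \<open>r\<close>, two of these points
  can be close only if their values of \<open>m\<close> agree modulo \<open>g\<close> and are not too far apart.  A divisor \<open>g\<close> of size
  about \<open>Y = min M (L ^ 5)\<close> with \<open>O(ln Y)\<close> prime factors always exists (or \<open>g = r\<close>), and the coprimality then
  costs a factor \<open>O(ln Y)\<close> only.  So a block contributes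
  \<open>O((\<eta> x / ln P) * sqrt (ln Y * (1/Y + 1/R)))\<close>, up to a negligible term, where \<open>R = L powr (2 + \<epsilon>/2)\<close> comes from the hypotheses
  on \<open>q\<close>: either \<open>r = q\<close>, or \<open>\<alpha>\<close> stays away from \<open>b0/r\<close> by \<open>1 / (2 q r)\<close>.  There are \<open>O(L / \<eta>)\<close> blocks, and
  the exponent of \<open>R\<close> exceeds \<open>2\<close>, so the terms with \<open>R\<close> sum to \<open>o(x / L)\<close>.  The terms with \<open>ln M / M\<close> sum to
  \<open>O(x / L) * sqrt (ln H / H)\<close> because only blocks with \<open>M \<ge> H\<close> occur, and this is at most a small multiple
  of \<open>c x / L\<close> by the choice of \<open>H\<close>.  The hypothesis \<open>q \<le> x / L powr (3 + \<epsilon>)\<close> has one factor \<open>L\<close> more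
  than the lower bound for \<open>q\<close> because the blocks are shorter than dyadic intervals by a factor of about \<open>L\<close>.
\<close>

section \<open>The large sieve for clustered points\<close>

lemma add_char_conv_cis: "add_char t = cis (2 * pi * t)"
  by (simp add: add_char_def cis_conv_exp mult_ac)

lemma add_char_add: "add_char (s + t) = add_char s * add_char t"
  by (simp add: add_char_conv_cis cis_mult algebra_simps)

lemma norm_add_char [simp]: "cmod (add_char t) = 1"
  by (simp add: add_char_conv_cis)

lemma add_char_0 [simp]: "add_char 0 = 1"
  by (simp add: add_char_conv_cis)

lemma add_char_of_int [simp]: "add_char (of_int k) = 1"
  by (simp add: add_char_conv_cis complex_eq_iff)

lemma add_char_add_of_int: "add_char (t + of_int k) = add_char t"
  by (simp add: add_char_add)

lemma cnj_add_char: "cnj (add_char t) = add_char (- t)"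
  by (simp add: add_char_conv_cis cis_cnj)

lemma add_char_mult_of_nat: "add_char (of_nat n * t) = add_char t ^ n"
proof -
  have "2 * pi * (of_nat n * t) = of_nat n * (2 * pi * t)" by simp
  thus ?thesis unfolding add_char_conv_cis by (simp only: Complex.DeMoivre)
qed

lemma two_times_le_sin_pi:
  fixes t :: real
  assumes "0 \<le> t" "t \<le> 1 / 2"
  shows "2 * t \<le> sin (pi * t)"
proof -
  have cv: "convex_on {0..pi/2} (\<lambda>x. - sin x)"
  proof (rule f''_ge0_imp_convex[where f' = "\<lambda>x. - cos x" and f'' = "\<lambda>x. sin x"])
    show "\<And>x. x \<in> {0..pi/2} \<Longrightarrow> 0 \<le> sin x" by (intro sin_ge_zero) auto
  qed (auto intro!: derivative_eq_intros)
  have "- sin ((1 - 2*t) *\<^sub>R 0 + (2*t) *\<^sub>R (pi/2)) \<le> (1 - 2*t) * (- sin 0) + (2*t) * (- sin (pi/2))"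
    by (rule convex_onD[OF cv]) (use assms in auto)
  thus ?thesis by (simp add: mult_ac)
qed

lemma norm_one_minus_add_char: "cmod (1 - add_char t) = 2 * \<bar>sin (pi * t)\<bar>"
proof -
  have "cmod (1 - add_char t) ^ 2 = (1 - cos (2*(pi*t)))^2 + sin (2*(pi*t))^2"
    by (simp add: add_char_conv_cis cmod_def mult_ac)
  also have "\<dots> = (2 * \<bar>sin (pi * t)\<bar>)^2"
  proof -
    have "(1 - cos (2*(pi*t)))^2 + sin (2*(pi*t))^2 = 2 - 2 * cos (2*(pi*t))"
      using sin_cos_squared_add[of "2*(pi*t)"] by (simp add: power2_eq_square algebra_simps)
    also have "\<dots> = 4 * sin (pi*t)^2" by (simp add: cos_double_sin)
    finally show ?thesis by (simp add: power_mult_distrib)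
  qed
  finally show ?thesis by (simp only: power2_eq_iff_nonneg norm_ge_zero) 
qed

abbreviation twisted_sum :: "nat set \<Rightarrow> (nat \<Rightarrow> complex) \<Rightarrow> real \<Rightarrow> complex" where
  "twisted_sum A f \<beta> \<equiv> \<Sum>n\<in>A. f n * add_char (real n * \<beta>)"

definition dirichlet_kernel :: "nat \<Rightarrow> real \<Rightarrow> complex" where
  "dirichlet_kernel N t = (\<Sum>l<N. add_char (real l * t))"

lemma norm_dirichlet_kernel_le: "cmod (dirichlet_kernel N t) \<le> real N"
  unfolding dirichlet_kernel_def
  by (rule order_trans[OF norm_sum]) simp

lemma norm_dirichlet_kernel_minus: "cmod (dirichlet_kernel N (- t)) = cmod (dirichlet_kernel N t)"
proof -
  have "dirichlet_kernel N (- t) = cnj (dirichlet_kernel N t)"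
    by (simp add: dirichlet_kernel_def cnj_add_char)
  thus ?thesis by simp
qed

lemma norm_dirichlet_kernel_frac: "cmod (dirichlet_kernel N (frac t)) = cmod (dirichlet_kernel N t)"
proof -
  have "add_char (real l * frac t) = add_char (real l * t)" for l
  proof -
    have "add_char (real l * t) = add_char (real l * frac t + of_int (int l * \<lfloor>t\<rfloor>))"
      by (simp add: frac_def algebra_simps)
    thus ?thesis by (simp only: add_char_add_of_int)
  qed
  thus ?thesis by (simp add: dirichlet_kernel_def)
qed

text \<open>Sum the geometric series and use \<open>\<bar>1 - e(t)\<bar> = 2 \<bar>sin (pi t)\<bar>\<close>, which is at least four times the distance
  from \<open>t\<close> to the nearest integer.\<close>

lemma norm_dirichlet_kernel_le_inverse:
  assumes "0 < t" "t < 1"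
  shows "cmod (dirichlet_kernel N t) \<le> max (1 / t) (1 / (1 - t))"
proof -
  have s: "2 * min t (1 - t) \<le> sin (pi * t)"
  proof (cases "t \<le> 1/2")
    case True
    thus ?thesis using two_times_le_sin_pi[of t] assms by auto
  next
    case False
    have "sin (pi * (1 - t)) = sin (pi * t)" by (simp add: right_diff_distrib)
    thus ?thesis using two_times_le_sin_pi[of "1 - t"] assms False by auto
  qed
  have m: "min t (1 - t) > 0" using assms by auto
  have ne: "add_char t \<noteq> 1"
    using norm_one_minus_add_char[of t] s m by auto
  have "dirichlet_kernel N t = (1 - add_char t ^ N) / (1 - add_char t)"
    unfolding dirichlet_kernel_def add_char_mult_of_nat using ne by (simp add: sum_gp_strict)
  hence "cmod (dirichlet_kernel N t) = cmod (1 - add_char t ^ N) / cmod (1 - add_char t)"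
    by (simp add: norm_divide)
  also have "\<dots> \<le> 2 / (4 * min t (1 - t))"
  proof (rule frac_le)
    show "cmod (1 - add_char t ^ N) \<le> 2"
      by (rule order_trans[OF norm_triangle_ineq4]) (simp add: norm_power)
    show "4 * min t (1 - t) \<le> cmod (1 - add_char t)"
      using s m by (simp add: norm_one_minus_add_char)
  qed (use m in auto)
  also have "\<dots> \<le> 1 / min t (1 - t)" using m by (simp add: field_simps)
  also have "\<dots> \<le> max (1 / t) (1 / (1 - t))" by (auto simp: min_def)
  finally show ?thesis .
qed

lemma sum_inverse_squares_max_le: "(\<Sum>k<N. 1 / (max 1 (real k))^2) \<le> 3"
proof -
  have *: "(\<Sum>k<N. 1 / (max 1 (real k))^2) \<le> 3 - 1 / (real N - 1)" if "N \<ge> 2" using that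
  proof (induction N rule: nat_induct_at_least)
    case base
    have "{..<2::nat} = {0,1}" by auto
    thus ?case by simp
  next
    case (Suc n)
    have "1 / real n ^ 2 \<le> 1 / (real n - 1) - 1 / real n"
      using Suc.hyps by (simp add: field_simps power2_eq_square)
    thus ?case using Suc by (simp add: max_def)
  qed
  consider "N \<ge> 2" | "N = 0" | "N = 1" by linarith
  thus ?thesis
  proof cases
    case 1
    moreover have "1 / (real N - 1) \<ge> 0" using 1 by simp
    ultimately show ?thesis using * by linarith
  qed auto
qed

text \<open>Cut the circle into \<open>W\<close> arcs of length \<open>1/W\<close>, counted from \<open>s\<close>.  Any two points of one arc are within \<open>1/W\<close>, so
  an arc holds at most \<open>K\<close> of the points; on the arc number \<open>k\<close> the kernel is at most \<open>O(W)\<close> divided by the smaller of \<open>k\<close>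
  and \<open>W - 1 - k\<close>, and the inverse squares are summable.\<close>

lemma sum_norm_dirichlet_kernel_sq_le:
  fixes \<theta> :: "'i \<Rightarrow> real"
  assumes fin: "finite I" and W: "W > 0"
    and K: "\<And>i. i \<in> I \<Longrightarrow> card {j\<in>I. \<exists>k::int. \<bar>\<theta> j - \<theta> i - of_int k\<bar> \<le> 1 / real W} \<le> K"
  shows "(\<Sum>j\<in>I. cmod (dirichlet_kernel (2 * W) (\<theta> j - s)) ^ 2) \<le> 24 * real W ^ 2 * real K"
proof -
  define t where "t = (\<lambda>j. frac (\<theta> j - s))"
  define cell where "cell = (\<lambda>j. nat \<lfloor>t j * W\<rfloor>)"
  define g where "g = (\<lambda>k. 4 * real W ^ 2 * (1 / (max 1 (real k))^2))"
  have t: "0 \<le> t j" "t j < 1" for j by (auto simp: t_def frac_lt_1)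
  have cell: "real (cell j) \<le> t j * W" "t j * W < real (cell j) + 1" for j
    using t(1)[of j] by (auto simp: cell_def)
  have cellW: "cell j < W" for j
  proof -
    have "t j * real W < 1 * real W" using t[of j] W by (intro mult_strict_right_mono) auto
    thus ?thesis using cell(1)[of j] by auto
  qed
  have card_cell: "card {j\<in>I. cell j = k} \<le> K" for k
  proof (cases "{j\<in>I. cell j = k} = {}")
    case False
    then obtain i where i: "i \<in> I" "cell i = k" by auto
    have "{j\<in>I. cell j = k} \<subseteq> {j\<in>I. \<exists>k::int. \<bar>\<theta> j - \<theta> i - of_int k\<bar> \<le> 1 / real W}"
    proof clarify
      fix j assume j: "j \<in> I" "k = cell j"
      have "\<bar>t j * W - t i * W\<bar> \<le> 1" using cell[of j] cell[of i] i j by linarith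
      hence "\<bar>t j - t i\<bar> * W \<le> 1" using W by (simp add: abs_mult flip: left_diff_distrib)
      hence "\<bar>t j - t i\<bar> \<le> 1 / W" using W by (simp add: field_simps)
      moreover have "t j - t i = \<theta> j - \<theta> i - of_int (\<lfloor>\<theta> j - s\<rfloor> - \<lfloor>\<theta> i - s\<rfloor>)"
        by (simp add: t_def frac_def)
      ultimately show "\<exists>k::int. \<bar>\<theta> j - \<theta> i - of_int k\<bar> \<le> 1 / real W" by metis
    qed
    hence "card {j\<in>I. cell j = k} \<le> card {j\<in>I. \<exists>k::int. \<bar>\<theta> j - \<theta> i - of_int k\<bar> \<le> 1 / real W}"
      by (intro card_mono) (use fin in auto)
    thus ?thesis using K[OF i(1)] by linarith
  next
    case True
    thus ?thesis by (simp only: True card.empty)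
  qed
  have ptw: "cmod (dirichlet_kernel (2 * W) (\<theta> j - s)) ^ 2 \<le> g (cell j) + g (W - 1 - cell j)" for j
  proof -
    have eq: "cmod (dirichlet_kernel (2 * W) (\<theta> j - s)) = cmod (dirichlet_kernel (2 * W) (t j))"
      by (simp add: t_def norm_dirichlet_kernel_frac)
    have gpos: "g k \<ge> 0" for k by (simp add: g_def)
    have triv: "cmod (dirichlet_kernel (2 * W) (t j)) ^ 2 \<le> 4 * real W ^ 2"
      using power_mono[OF norm_dirichlet_kernel_le[of "2*W" "t j"], of 2] by (simp add: power_mult_distrib)
    show ?thesis
    proof (cases "cell j = 0 \<or> W - 1 - cell j = 0")
      case True
      hence "g (cell j) = 4 * real W ^ 2 \<or> g (W - 1 - cell j) = 4 * real W ^ 2"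
        unfolding g_def by auto
      thus ?thesis using triv eq gpos[of "cell j"] gpos[of "W - 1 - cell j"] by auto
    next
      case False
      hence c: "cell j \<ge> 1" "W - 1 - cell j \<ge> 1" by auto
      have t0: "t j \<ge> cell j / W" using cell(1)[of j] W by (simp add: field_simps)
      have rW: "real (W - 1 - cell j) = real W - 1 - real (cell j)" using c by auto
      have t1: "1 - t j \<ge> real (W - 1 - cell j) / W"
        using cell(2)[of j] W unfolding rW by (simp add: field_simps)
      have p0: "cell j / W > 0" "real (W - 1 - cell j) / W > 0" using c W by auto
      have tt: "0 < t j" "t j < 1" using t0 t1 p0 by linarith+
      have g0: "(1 / t j)^2 \<le> g (cell j)"
      proof -
        have "1 / t j \<le> W / cell j" using t0 p0 tt c W by (simp add: field_simps)
        hence "(1 / t j)^2 \<le> (W / cell j)^2" using tt by (intro power_mono) auto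
        also have "\<dots> \<le> g (cell j)" using c by (simp add: g_def max_def power_divide divide_right_mono)
        finally show ?thesis .
      qed
      have g1: "(1 / (1 - t j))^2 \<le> g (W - 1 - cell j)"
      proof -
        have "1 / (1 - t j) \<le> W / real (W - 1 - cell j)"
          using t1 p0 tt c W by (simp add: field_simps del: of_nat_diff)
        hence "(1 / (1 - t j))^2 \<le> (W / real (W - 1 - cell j))^2" using tt by (intro power_mono) auto
        also have "\<dots> \<le> g (W - 1 - cell j)"
          using c unfolding g_def by (simp add: max_def power_divide divide_right_mono del: of_nat_diff)
        finally show ?thesis .
      qed
      have "cmod (dirichlet_kernel (2 * W) (t j)) ^ 2 \<le> (max (1 / t j) (1 / (1 - t j)))^2"
        by (intro power_mono norm_dirichlet_kernel_le_inverse tt) auto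
      also have "\<dots> \<le> (1 / t j)^2 + (1 / (1 - t j))^2" by (auto simp: max_def)
      finally show ?thesis using g0 g1 eq by simp
    qed
  qed
  have "(\<Sum>j\<in>I. cmod (dirichlet_kernel (2 * W) (\<theta> j - s)) ^ 2) \<le> (\<Sum>j\<in>I. g (cell j) + g (W - 1 - cell j))"
    by (intro sum_mono ptw)
  also have "\<dots> = (\<Sum>k<W. \<Sum>j\<in>{j\<in>I. cell j = k}. g (cell j) + g (W - 1 - cell j))"
    by (intro sum.group[symmetric]) (use fin cellW in auto)
  also have "\<dots> = (\<Sum>k<W. real (card {j\<in>I. cell j = k}) * (g k + g (W - 1 - k)))"
    by (intro sum.cong refl) simp
  also have "\<dots> \<le> (\<Sum>k<W. real K * (g k + g (W - 1 - k)))"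
    by (intro sum_mono mult_right_mono) (use card_cell in \<open>auto simp: g_def\<close>)
  also have "\<dots> = real K * ((\<Sum>k<W. g k) + (\<Sum>k<W. g (W - 1 - k)))"
    by (simp add: sum_distrib_left[symmetric] sum.distrib)
  also have "(\<Sum>k<W. g (W - 1 - k)) = (\<Sum>k<W. g k)"
    using sum.nat_diff_reindex[of g W] by simp
  also have "(\<Sum>k<W. g k) = 4 * real W ^ 2 * (\<Sum>k<W. 1 / (max 1 (real k))^2)"
    unfolding g_def by (simp only: sum_distrib_left)
  also have "real K * (4 * real W ^ 2 * (\<Sum>k<W. 1 / (max 1 (real k))^2) + 4 * real W ^ 2 * (\<Sum>k<W. 1 / (max 1 (real k))^2))
      = 8 * real W ^ 2 * real K * (\<Sum>k<W. 1 / (max 1 (real k))^2)" by (simp add: algebra_simps)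
  also have "\<dots> \<le> 8 * real W ^ 2 * real K * 3"
    by (intro mult_left_mono sum_inverse_squares_max_le) auto
  finally show ?thesis by simp
qed

text \<open>The square of the Dirichlet kernel of length \<open>2 W\<close> serves as a smooth majorant of the interval: every
  \<open>n\<close> in it can be written as a difference \<open>l' - l\<close> with \<open>0 \<le> l, l' < 2 W\<close> in at least \<open>W\<close> ways.  Expanding the
  square after this averaging leaves only kernels evaluated at the differences of the points.\<close>

lemma large_sieve_dual:
  fixes \<theta> :: "'i \<Rightarrow> real" and b :: "'i \<Rightarrow> complex"
  assumes fin: "finite I" and W: "W > 0"
    and K: "\<And>i. i \<in> I \<Longrightarrow> card {j\<in>I. \<exists>k::int. \<bar>\<theta> j - \<theta> i - of_int k\<bar> \<le> 1 / real W} \<le> K"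
  shows "(\<Sum>n\<in>{n0..<n0 + W}. cmod (\<Sum>i\<in>I. b i * add_char (real n * \<theta> i)) ^ 2)
           \<le> 24 * real W * real K * (\<Sum>i\<in>I. cmod (b i) ^ 2)"
proof -
  define c where "c = (\<lambda>i. b i * add_char (real n0 * \<theta> i))"
  have cb: "cmod (c i) = cmod (b i)" for i by (simp add: c_def norm_mult)
  define V where "V = (\<lambda>l' l. \<Sum>i\<in>I. c i * add_char ((real l' - real l) * \<theta> i))"
  define D where "D = dirichlet_kernel (2 * W)"
  have U: "(\<Sum>i\<in>I. b i * add_char (real (n0 + n) * \<theta> i)) = V (n + l) l" for n l
    unfolding V_def c_def by (intro sum.cong refl) (simp add: add_char_add algebra_simps)
  \<comment> \<open>The map \<open>(l, n) \<mapsto> (l, n + l)\<close> embeds the averaged sum over the interval into the square.\<close>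
  have step1: "real W * (\<Sum>n\<in>{n0..<n0 + W}. cmod (\<Sum>i\<in>I. b i * add_char (real n * \<theta> i)) ^ 2)
        \<le> (\<Sum>l<2*W. \<Sum>l'<2*W. cmod (V l' l) ^ 2)"
  proof -
    have "(\<Sum>n\<in>{n0..<n0 + W}. cmod (\<Sum>i\<in>I. b i * add_char (real n * \<theta> i)) ^ 2)
        = (\<Sum>n<W. cmod (\<Sum>i\<in>I. b i * add_char (real (n0 + n) * \<theta> i)) ^ 2)"
      by (rule sum.reindex_bij_witness[of _ "\<lambda>n. n0 + n" "\<lambda>n. n - n0"]) auto
    hence "real W * (\<Sum>n\<in>{n0..<n0 + W}. cmod (\<Sum>i\<in>I. b i * add_char (real n * \<theta> i)) ^ 2)
        = (\<Sum>l<W. \<Sum>n<W. cmod (\<Sum>i\<in>I. b i * add_char (real (n0 + n) * \<theta> i)) ^ 2)"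
      by (simp only: sum_constant card_lessThan)
    also have "\<dots> = (\<Sum>l<W. \<Sum>n<W. cmod (V (n + l) l) ^ 2)"
      by (intro sum.cong refl arg_cong[where f = "\<lambda>z. cmod z ^ 2"] U)
    also have "\<dots> = (\<Sum>(l,n)\<in>{..<W}\<times>{..<W}. cmod (V (n + l) l) ^ 2)" by (simp add: sum.cartesian_product)
    also have "\<dots> = (\<Sum>(l,l')\<in>(\<lambda>(l,n). (l, n + l)) ` ({..<W}\<times>{..<W}). cmod (V l' l) ^ 2)"
      by (subst sum.reindex) (auto simp: inj_on_def case_prod_unfold)
    also have "\<dots> \<le> (\<Sum>(l,l')\<in>{..<2*W}\<times>{..<2*W}. cmod (V l' l) ^ 2)"
      by (intro sum_mono2) auto
    also have "\<dots> = (\<Sum>l<2*W. \<Sum>l'<2*W. cmod (V l' l) ^ 2)" by (simp add: sum.cartesian_product)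
    finally show ?thesis .
  qed
  have expand: "complex_of_real (cmod (V l' l) ^ 2) = (\<Sum>i\<in>I. \<Sum>j\<in>I. c i * cnj (c j) *
                   (add_char (real l' * (\<theta> i - \<theta> j)) * cnj (add_char (real l * (\<theta> i - \<theta> j)))))" for l l'
  proof -
    have e: "add_char ((real l' - real l) * \<theta> i) * cnj (add_char ((real l' - real l) * \<theta> j))
      = add_char (real l' * (\<theta> i - \<theta> j)) * cnj (add_char (real l * (\<theta> i - \<theta> j)))" for i j
      unfolding cnj_add_char add_char_add[symmetric] by (rule arg_cong[where f = add_char]) (simp add: algebra_simps)
    have "complex_of_real (cmod (V l' l) ^ 2) = V l' l * cnj (V l' l)" by (rule complex_norm_square)
    also have "\<dots> = (\<Sum>i\<in>I. \<Sum>j\<in>I. c i * cnj (c j) *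
        (add_char ((real l' - real l) * \<theta> i) * cnj (add_char ((real l' - real l) * \<theta> j))))"
      unfolding V_def cnj_sum sum_product complex_cnj_mult by (simp only: mult_ac)
    finally show ?thesis unfolding e .
  qed
  have DD: "D t * cnj (D t) = (\<Sum>l<2*W. \<Sum>l'<2*W. add_char (real l' * t) * cnj (add_char (real l * t)))" for t
    unfolding D_def dirichlet_kernel_def cnj_sum sum_product by (rule sum.swap)
  have "complex_of_real (\<Sum>l<2*W. \<Sum>l'<2*W. cmod (V l' l) ^ 2)
      = (\<Sum>l<2*W. \<Sum>l'<2*W. \<Sum>i\<in>I. \<Sum>j\<in>I. c i * cnj (c j) *
                   (add_char (real l' * (\<theta> i - \<theta> j)) * cnj (add_char (real l * (\<theta> i - \<theta> j)))))"
    unfolding of_real_sum expand ..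
  also have "\<dots> = (\<Sum>l<2*W. \<Sum>i\<in>I. \<Sum>l'<2*W. \<Sum>j\<in>I. c i * cnj (c j) *
                   (add_char (real l' * (\<theta> i - \<theta> j)) * cnj (add_char (real l * (\<theta> i - \<theta> j)))))"
    by (rule sum.cong[OF refl], rule sum.swap)
  also have "\<dots> = (\<Sum>i\<in>I. \<Sum>l<2*W. \<Sum>l'<2*W. \<Sum>j\<in>I. c i * cnj (c j) *
                   (add_char (real l' * (\<theta> i - \<theta> j)) * cnj (add_char (real l * (\<theta> i - \<theta> j)))))"
    by (rule sum.swap)
  also have "\<dots> = (\<Sum>i\<in>I. \<Sum>l<2*W. \<Sum>j\<in>I. \<Sum>l'<2*W. c i * cnj (c j) *
                   (add_char (real l' * (\<theta> i - \<theta> j)) * cnj (add_char (real l * (\<theta> i - \<theta> j)))))"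
    by (rule sum.cong[OF refl], rule sum.cong[OF refl], rule sum.swap)
  also have "\<dots> = (\<Sum>i\<in>I. \<Sum>j\<in>I. \<Sum>l<2*W. \<Sum>l'<2*W. c i * cnj (c j) *
                   (add_char (real l' * (\<theta> i - \<theta> j)) * cnj (add_char (real l * (\<theta> i - \<theta> j)))))"
    by (rule sum.cong[OF refl], rule sum.swap)
  also have "\<dots> = (\<Sum>i\<in>I. \<Sum>j\<in>I. c i * cnj (c j) * (D (\<theta> i - \<theta> j) * cnj (D (\<theta> i - \<theta> j))))"
    unfolding DD sum_distrib_left ..
  also have "\<dots> = (\<Sum>i\<in>I. \<Sum>j\<in>I. c i * cnj (c j) * of_real (cmod (D (\<theta> i - \<theta> j)) ^ 2))"
    by (simp only: complex_norm_square)
  finally have main: "complex_of_real (\<Sum>l<2*W. \<Sum>l'<2*W. cmod (V l' l) ^ 2)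
      = (\<Sum>i\<in>I. \<Sum>j\<in>I. c i * cnj (c j) * of_real (cmod (D (\<theta> i - \<theta> j)) ^ 2))" .
  define E where "E = (\<lambda>i j. cmod (D (\<theta> i - \<theta> j)) ^ 2)"
  have Esym: "E i j = E j i" for i j
    unfolding E_def D_def using norm_dirichlet_kernel_minus[of "2*W" "\<theta> i - \<theta> j"] by simp
  have Epos: "E i j \<ge> 0" for i j by (simp add: E_def)
  have "(\<Sum>l<2*W. \<Sum>l'<2*W. cmod (V l' l) ^ 2) = cmod (complex_of_real (\<Sum>l<2*W. \<Sum>l'<2*W. cmod (V l' l) ^ 2))"
    unfolding norm_of_real by (intro abs_of_nonneg[symmetric] sum_nonneg) auto
  also have "\<dots> \<le> (\<Sum>i\<in>I. \<Sum>j\<in>I. cmod (c i * cnj (c j) * of_real (cmod (D (\<theta> i - \<theta> j)) ^ 2)))"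
    unfolding main by (rule order_trans[OF norm_sum]) (intro sum_mono norm_sum)
  also have "\<dots> = (\<Sum>i\<in>I. \<Sum>j\<in>I. cmod (b i) * cmod (b j) * E i j)"
    by (simp add: norm_mult cb E_def norm_power)
  also have "\<dots> \<le> (\<Sum>i\<in>I. \<Sum>j\<in>I. (cmod (b i) ^ 2 * E i j + cmod (b j) ^ 2 * E i j) / 2)"
  proof (intro sum_mono)
    fix i j
    have "cmod (b i) * cmod (b j) \<le> (cmod (b i) ^ 2 + cmod (b j) ^ 2) / 2"
      using sum_squares_bound[of "cmod (b i)" "cmod (b j)"] by simp
    from mult_right_mono[OF this Epos[of i j]]
    show "cmod (b i) * cmod (b j) * E i j \<le> (cmod (b i) ^ 2 * E i j + cmod (b j) ^ 2 * E i j) / 2"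
      by (simp add: algebra_simps)
  qed
  also have "\<dots> = ((\<Sum>i\<in>I. \<Sum>j\<in>I. cmod (b i) ^ 2 * E i j) + (\<Sum>i\<in>I. \<Sum>j\<in>I. cmod (b j) ^ 2 * E i j)) / 2"
    by (simp add: sum.distrib flip: sum_divide_distrib)
  also have "(\<Sum>i\<in>I. \<Sum>j\<in>I. cmod (b j) ^ 2 * E i j) = (\<Sum>i\<in>I. \<Sum>j\<in>I. cmod (b i) ^ 2 * E i j)"
    by (subst sum.swap) (simp add: Esym)
  also have "((\<Sum>i\<in>I. \<Sum>j\<in>I. cmod (b i) ^ 2 * E i j) + (\<Sum>i\<in>I. \<Sum>j\<in>I. cmod (b i) ^ 2 * E i j)) / 2
      = (\<Sum>i\<in>I. cmod (b i) ^ 2 * (\<Sum>j\<in>I. E i j))"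
    unfolding sum_distrib_left by simp
  also have "\<dots> \<le> (\<Sum>i\<in>I. cmod (b i) ^ 2 * (24 * real W ^ 2 * real K))"
  proof (intro sum_mono mult_left_mono)
    fix i assume "i \<in> I"
    have "(\<Sum>j\<in>I. E i j) = (\<Sum>j\<in>I. E j i)" by (intro sum.cong refl Esym)
    also have "\<dots> \<le> 24 * real W ^ 2 * real K"
      unfolding E_def D_def by (rule sum_norm_dirichlet_kernel_sq_le[OF fin W K])
    finally show "(\<Sum>j\<in>I. E i j) \<le> 24 * real W ^ 2 * real K" .
  qed auto
  also have "\<dots> = real W * (24 * real W * real K * (\<Sum>i\<in>I. cmod (b i) ^ 2))"
    by (simp add: sum_distrib_right[symmetric] power2_eq_square)
  finally have "real W * (\<Sum>n\<in>{n0..<n0 + W}. cmod (\<Sum>i\<in>I. b i * add_char (real n * \<theta> i)) ^ 2)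
     \<le> real W * (24 * real W * real K * (\<Sum>i\<in>I. cmod (b i) ^ 2))" using step1 by linarith
  thus ?thesis using W by simp
qed

text \<open>Duality: a matrix and its transpose have the same norm.\<close>

theorem large_sieve:
  fixes \<theta> :: "'i \<Rightarrow> real" and a :: "nat \<Rightarrow> complex"
  assumes fin: "finite I" and W: "W > 0" and A: "A \<subseteq> {n0..<n0 + W}"
    and K: "\<And>i. i \<in> I \<Longrightarrow> card {j\<in>I. \<exists>k::int. \<bar>\<theta> j - \<theta> i - of_int k\<bar> \<le> 1 / real W} \<le> K"
  shows "(\<Sum>i\<in>I. cmod (twisted_sum A a (\<theta> i)) ^ 2)
           \<le> 24 * real W * real K * (\<Sum>n\<in>A. cmod (a n) ^ 2)"
proof -
  define S where "S = (\<lambda>i. \<Sum>n\<in>A. a n * add_char (real n * \<theta> i))"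
  define X where "X = (\<Sum>i\<in>I. cmod (S i) ^ 2)"
  define T where "T = (\<lambda>n. \<Sum>i\<in>I. cnj (S i) * add_char (real n * \<theta> i))"
  have Xpos: "X \<ge> 0" by (auto simp: X_def intro: sum_nonneg)
  have "complex_of_real X = (\<Sum>i\<in>I. S i * cnj (S i))"
    by (simp only: X_def of_real_sum complex_norm_square)
  also have "\<dots> = (\<Sum>i\<in>I. \<Sum>n\<in>A. a n * (cnj (S i) * add_char (real n * \<theta> i)))"
  proof (rule sum.cong[OF refl])
    fix i
    have "S i * cnj (S i) = (twisted_sum A a (\<theta> i)) * cnj (S i)" by (simp only: S_def)
    also have "\<dots> = (\<Sum>n\<in>A. a n * (cnj (S i) * add_char (real n * \<theta> i)))"
      unfolding sum_distrib_right by (intro sum.cong refl) (simp only: mult_ac)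
    finally show "S i * cnj (S i) = (\<Sum>n\<in>A. a n * (cnj (S i) * add_char (real n * \<theta> i)))" .
  qed
  also have "\<dots> = (\<Sum>n\<in>A. a n * T n)"
    by (subst sum.swap) (simp add: T_def sum_distrib_left)
  finally have "complex_of_real X = (\<Sum>n\<in>A. a n * T n)" .
  hence "X = cmod (\<Sum>n\<in>A. a n * T n)" using Xpos by (metis abs_of_nonneg norm_of_real)
  also have "\<dots> \<le> (\<Sum>n\<in>A. \<bar>cmod (a n)\<bar> * \<bar>cmod (T n)\<bar>)"
    by (rule order_trans[OF norm_sum]) (simp add: norm_mult)
  also have "\<dots> \<le> L2_set (\<lambda>n. cmod (a n)) A * L2_set (\<lambda>n. cmod (T n)) A"
    by (rule L2_set_mult_ineq)
  finally have "X ^ 2 \<le> (L2_set (\<lambda>n. cmod (a n)) A * L2_set (\<lambda>n. cmod (T n)) A) ^ 2"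
    using Xpos by (rule power_mono)
  also have "\<dots> = (\<Sum>n\<in>A. cmod (a n) ^ 2) * (\<Sum>n\<in>A. cmod (T n) ^ 2)"
    by (simp add: L2_set_def power_mult_distrib sum_nonneg)
  also have "\<dots> \<le> (\<Sum>n\<in>A. cmod (a n) ^ 2) * (\<Sum>n\<in>{n0..<n0 + W}. cmod (T n) ^ 2)"
    by (intro mult_left_mono sum_mono2 A) (auto intro: sum_nonneg)
  also have "\<dots> \<le> (\<Sum>n\<in>A. cmod (a n) ^ 2) * (24 * real W * real K * (\<Sum>i\<in>I. cmod (cnj (S i)) ^ 2))"
    unfolding T_def by (intro mult_left_mono large_sieve_dual[OF fin W K]) (auto intro: sum_nonneg)
  also have "\<dots> = (24 * real W * real K * (\<Sum>n\<in>A. cmod (a n) ^ 2)) * X" by (simp add: X_def)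
  finally have "X * X \<le> (24 * real W * real K * (\<Sum>n\<in>A. cmod (a n) ^ 2)) * X" by (simp add: power2_eq_square)
  hence "X \<le> 24 * real W * real K * (\<Sum>n\<in>A. cmod (a n) ^ 2)"
    using Xpos by (cases "X = 0") (auto intro!: mult_nonneg_nonneg sum_nonneg)
  thus ?thesis by (simp add: X_def S_def)
qed

section \<open>Ramanujan sums and the inequality of Montgomery\<close>

lemma sum_add_char_full_period:
  assumes "d > 0" "\<not> d dvd n"
  shows "(\<Sum>k\<in>{0<..d}. add_char (real n * real k / real d)) = 0"
proof -
  define z where "z = add_char (real n / real d)"
  have zk: "add_char (real n * real k / real d) = z ^ k" for k
    using add_char_mult_of_nat[of k "real n / real d"] by (simp add: z_def mult_ac)
  have zd: "z ^ d = 1"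
    using zk[of d] assms add_char_of_int[of "int n"] by simp
  have z1: "z \<noteq> 1"
  proof
    assume "z = 1"
    hence "sin (pi * (real n / real d)) = 0" using norm_one_minus_add_char[of "real n / real d"] by (simp add: z_def)
    then obtain i :: int where "pi * (real n / real d) = of_int i * pi" by (auto simp: sin_zero_iff_int2)
    hence "pi * (real n / real d) = pi * of_int i" by (simp only: mult.commute)
    hence "real n / real d = of_int i" using mult_left_cancel[OF pi_neq_zero] by blast
    hence "real n = of_int (i * int d)" using assms by (simp add: field_simps)
    hence "int n = i * int d" by (metis of_int_eq_iff of_int_of_nat_eq)
    hence "int d dvd int n" by simp
    thus False using assms by (simp add: int_dvd_int_iff)
  qed
  have "{0<..d} = Suc ` {..<d}"
    by (auto simp: image_iff) (metis Suc_pred lessThan_iff Suc_le_eq)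
  hence "(\<Sum>k\<in>{0<..d}. add_char (real n * real k / real d)) = (\<Sum>k<d. z ^ Suc k)"
    by (simp only: zk) (simp add: sum.reindex)
  also have "\<dots> = z * (\<Sum>k<d. z ^ k)" by (simp add: sum_distrib_left)
  also have "(\<Sum>k<d. z ^ k) = 0" using z1 zd by (simp add: sum_gp_strict)
  finally show ?thesis by simp
qed

definition ramanujan_sum :: "nat \<Rightarrow> nat \<Rightarrow> complex" where
  "ramanujan_sum d n = (\<Sum>b\<in>totatives d. add_char (real n * real b / real d))"

text \<open>Sort the fractions \<open>k/d\<close> by their reduced denominator.\<close>

lemma sum_ramanujan_sum_divisors:
  assumes "d > 0"
  shows "(\<Sum>e | e dvd d. ramanujan_sum e n) = (\<Sum>k\<in>{0<..d}. add_char (real n * real k / real d))"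
proof -
  have "(\<Sum>k\<in>{0<..d}. add_char (real n * real k / real d))
      = (\<Sum>e | e dvd d. \<Sum>k\<in>{k\<in>{0<..d}. gcd k d = e}. add_char (real n * real k / real d))"
    using assms by (intro sum.group[symmetric]) auto
  also have "\<dots> = (\<Sum>e | e dvd d. ramanujan_sum (d div e) n)"
  proof (intro sum.cong refl)
    fix e assume "e \<in> {e. e dvd d}"
    hence e: "e dvd d" by simp
    then obtain r where r: "d = e * r" by auto
    have pos: "e > 0" "r > 0" using r assms by auto
    have "(\<Sum>k\<in>{k\<in>{0<..d}. gcd k d = e}. add_char (real n * real k / real d))
        = (\<Sum>b\<in>totatives (d div e). add_char (real n * real (b * e) / real d))"
      using bij_betw_totatives_gcd_eq[OF e assms] by (rule sum.reindex_bij_betw[symmetric])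
    also have "\<dots> = ramanujan_sum (d div e) n"
      unfolding ramanujan_sum_def using pos by (intro sum.cong refl) (simp add: r field_simps)
    finally show "(\<Sum>k\<in>{k\<in>{0<..d}. gcd k d = e}. add_char (real n * real k / real d)) = ramanujan_sum (d div e) n" .
  qed
  also have "\<dots> = (\<Sum>e | e dvd d. ramanujan_sum e n)"
    by (rule sum.reindex_bij_witness[of _ "\<lambda>e. d div e" "\<lambda>e. d div e"]) (use assms in auto)
  finally show ?thesis ..
qed

text \<open>For \<open>n\<close> coprime to \<open>p d\<close> the Ramanujan sums over the divisors of \<open>p d\<close> add up to a full period, hence to
  \<open>0\<close>.  These divisors are the \<open>e\<close> and the \<open>p e\<close> with \<open>e\<close> dividing \<open>d\<close>, and by induction the pairs with \<open>e < d\<close> cancel.\<close>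

lemma ramanujan_sum_mult_prime:
  assumes "prime p" "coprime p d" "d > 0" "coprime n (p * d)"
  shows "ramanujan_sum (p * d) n = - ramanujan_sum d n"
  using assms
proof (induction d rule: less_induct)
  case (less d)
  have cop: "\<not> (p * d) dvd n"
  proof
    assume "p * d dvd n"
    hence "p dvd n" by (rule dvd_mult_left)
    thus False using less.prems by (metis coprime_common_divisor dvd_triv_left not_prime_unit)
  qed
  have split: "{e. e dvd p * d} = {e. e dvd d} \<union> (\<lambda>e. p * e) ` {e. e dvd d}"
  proof (intro equalityI subsetI)
    fix e assume "e \<in> {e. e dvd p * d}"
    hence e: "e dvd p * d" by simp
    show "e \<in> {e. e dvd d} \<union> (\<lambda>e. p * e) ` {e. e dvd d}"
    proof (cases "p dvd e")
      case True
      then obtain f where f: "e = p * f" by auto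
      hence "f dvd d" using e less.prems(1) prime_gt_0_nat by auto
      thus ?thesis using f by auto
    next
      case False
      hence "coprime e p" using less.prems(1) by (metis coprime_commute prime_imp_coprime)
      hence "e dvd d" using e coprime_dvd_mult_right_iff by blast
      thus ?thesis by simp
    qed
  qed auto
  have disj: "{e. e dvd d} \<inter> (\<lambda>e. p * e) ` {e. e dvd d} = {}"
  proof -
    have "\<not> p dvd d" using less.prems by (metis coprime_absorb_left not_prime_unit)
    thus ?thesis by (auto dest: dvd_mult_left)
  qed
  have fin: "finite {e. e dvd d}" using less.prems by simp
  have inj: "inj_on (\<lambda>e. p * e) {e. e dvd d}" using less.prems(1) by (auto simp: inj_on_def)
  have "0 = (\<Sum>e | e dvd p * d. ramanujan_sum e n)"
    using sum_ramanujan_sum_divisors[of "p * d" n] sum_add_char_full_period[OF _ cop] less.prems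
    by (simp add: prime_gt_0_nat)
  also have "\<dots> = (\<Sum>e | e dvd d. ramanujan_sum e n + ramanujan_sum (p * e) n)"
    unfolding split using fin disj inj by (simp add: sum.union_disjoint sum.reindex sum.distrib)
  also have "\<dots> = (ramanujan_sum d n + ramanujan_sum (p * d) n)
      + (\<Sum>e \<in> {e. e dvd d} - {d}. ramanujan_sum e n + ramanujan_sum (p * e) n)"
    using fin by (intro sum.remove) auto
  also have "(\<Sum>e \<in> {e. e dvd d} - {d}. ramanujan_sum e n + ramanujan_sum (p * e) n) = 0"
  proof (intro sum.neutral ballI)
    fix e assume "e \<in> {e. e dvd d} - {d}"
    hence e: "e dvd d" "e \<noteq> d" by auto
    have "e < d" using e less.prems(3) dvd_imp_le by fastforce
    moreover have "coprime p e" using e(1) less.prems(2) by (meson coprime_divisors dvd_refl)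
    moreover have "e > 0" using e less.prems(3) by (metis dvd_0_left_iff gr0I)
    moreover have "coprime n (p * e)" using e(1) less.prems(4) by (meson coprime_divisors dvd_refl mult_dvd_mono)
    ultimately have "ramanujan_sum (p * e) n = - ramanujan_sum e n" using less.IH less.prems(1) by blast
    thus "ramanujan_sum e n + ramanujan_sum (p * e) n = 0" by simp
  qed
  finally have "ramanujan_sum d n + ramanujan_sum (p * d) n = 0" by simp
  thus ?case by (simp add: add_eq_0_iff)
qed

text \<open>The unimodular constant \<open>s\<close> is the value of the Moebius function at \<open>d\<close>; only its absolute value matters below.\<close>

lemma ramanujan_sum_squarefree:
  fixes d :: nat
  assumes "squarefree d"
  shows "\<exists>s::complex. cmod s = 1 \<and> (\<forall>n. coprime n d \<longrightarrow> ramanujan_sum d n = s)"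
  using assms
proof (induction d rule: less_induct)
  case (less d)
  have d0: "d > 0" using less.prems by (cases d) auto
  show ?case
  proof (cases "d = 1")
    case True
    have "ramanujan_sum 1 n = 1" for n
      using add_char_of_int[of "int n"] by (simp add: ramanujan_sum_def)
    thus ?thesis using True by (intro exI[of _ 1]) simp
  next
    case False
    then obtain p where p: "prime p" "p dvd d" using prime_factor_nat by blast
    then obtain e where e: "d = p * e" by auto
    have e0: "e > 0" using e d0 by auto
    have "squarefree e" using less.prems unfolding e by (rule squarefree_mono[OF dvd_triv_right])
    moreover have "coprime p e"
    proof (rule ccontr)
      assume "\<not> coprime p e"
      hence "p dvd e" using p(1) prime_imp_coprime by blast
      hence "p ^ 2 dvd d" unfolding e power2_eq_square by simp
      thus False using squarefreeD[OF less.prems] p(1) not_prime_unit by blast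
    qed
    ultimately have cop: "coprime p e" "squarefree e" by auto
    have "e < d" using e e0 prime_gt_1_nat[OF p(1)] by simp
    from less.IH[OF this cop(2)] obtain s where s: "cmod s = 1" "\<And>n. coprime n e \<Longrightarrow> ramanujan_sum e n = s" by blast
    have "ramanujan_sum d n = - s" if "coprime n d" for n
      using ramanujan_sum_mult_prime[OF p(1) cop(1) e0, of n] that s(2)[of n] unfolding e by simp
    thus ?thesis using s(1) by (intro exI[of _ "-s"]) auto
  qed
qed

text \<open>Averaging \<open>S(t + b/d)\<close> over the reduced fractions with denominator \<open>d\<close> multiplies each term of \<open>S(t)\<close> by the same
  Ramanujan sum, of absolute value \<open>1\<close>.  Then apply Cauchy--Schwarz to the \<open>\<phi>(d)\<close> terms.\<close>

lemma montgomery_inequality: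
  fixes d :: nat
  assumes "squarefree d" "finite A" "\<And>n. n \<in> A \<Longrightarrow> coprime n d"
  shows "cmod (twisted_sum A a t) ^ 2
     \<le> real (totient d) * (\<Sum>b\<in>totatives d. cmod (twisted_sum A a (t + real b / real d)) ^ 2)"
proof -
  obtain s where s: "cmod s = 1" "\<And>n. coprime n d \<Longrightarrow> ramanujan_sum d n = s"
    using ramanujan_sum_squarefree[OF assms(1)] by blast
  define S where "S = (\<lambda>u. \<Sum>n\<in>A. a n * add_char (real n * u))"
  have "(\<Sum>b\<in>totatives d. S (t + real b / real d))
      = (\<Sum>n\<in>A. \<Sum>b\<in>totatives d. a n * add_char (real n * t) * add_char (real n * real b / real d))"
    unfolding S_def by (subst sum.swap) (simp add: distrib_left add_char_add mult.assoc)
  also have "\<dots> = (\<Sum>n\<in>A. a n * add_char (real n * t) * s)"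
    by (intro sum.cong refl) (simp add: s(2)[OF assms(3), symmetric] ramanujan_sum_def sum_distrib_left)
  also have "\<dots> = S t * s" by (simp add: S_def sum_distrib_right)
  finally have "cmod (S t) = cmod (\<Sum>b\<in>totatives d. S (t + real b / real d))" by (simp add: norm_mult s)
  also have "\<dots> \<le> (\<Sum>b\<in>totatives d. \<bar>1\<bar> * \<bar>cmod (S (t + real b / real d))\<bar>)"
    by (rule order_trans[OF norm_sum]) simp
  also have "\<dots> \<le> L2_set (\<lambda>_. 1) (totatives d) * L2_set (\<lambda>b. cmod (S (t + real b / real d))) (totatives d)"
    by (rule L2_set_mult_ineq)
  finally have "cmod (S t) ^ 2 \<le> (L2_set (\<lambda>_. 1) (totatives d) * L2_set (\<lambda>b. cmod (S (t + real b / real d))) (totatives d)) ^ 2"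
    by (rule power_mono) simp
  also have "\<dots> = real (totient d) * (\<Sum>b\<in>totatives d. cmod (S (t + real b / real d)) ^ 2)"
    by (simp add: L2_set_def power_mult_distrib sum_nonneg totient_def)
  finally show ?thesis unfolding S_def .
qed

section \<open>The large sieve for sequences supported on primes\<close>

text \<open>The largest element of a set of \<open>k\<close> positive integers is at least \<open>k\<close>, so the product is largest for
  \<open>{1..k}\<close>, where it telescopes.\<close>

lemma prod_one_plus_inverse_le:
  assumes "finite A" "\<And>a. a \<in> A \<Longrightarrow> a > (0::nat)"
  shows "(\<Prod>a\<in>A. 1 + 1 / real a) \<le> real (card A) + 1"
  using assms
proof (induction A rule: finite_linorder_max_induct)
  case (insert m A)
  have "A \<subseteq> {0<..<m}" using insert by auto
  hence "card A \<le> m - 1" using card_mono[of "{0<..<m}" A] by simp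
  hence m: "real (card A) + 1 \<le> real m" using insert.prems by fastforce
  have "(\<Prod>a\<in>insert m A. 1 + 1 / real a) = (1 + 1 / real m) * (\<Prod>a\<in>A. 1 + 1 / real a)"
    using insert by auto
  also have "\<dots> \<le> (1 + 1 / real m) * (real (card A) + 1)"
    using insert by (intro mult_left_mono) auto
  also have "\<dots> \<le> real (card A) + 1 + 1" using m insert.prems by (simp add: field_simps)
  finally show ?case using insert by (auto simp: add_ac)
qed simp

lemma squarefree_eq_prod_prime_factors:
  fixes e :: nat
  assumes "squarefree e"
  shows "\<Prod>(prime_factors e) = e"
proof -
  have e0: "e > 0" using assms by (cases e) auto
  have "multiplicity p e = 1" if "p \<in> prime_factors e" for p
    using assms that e0 squarefree_factorial_semiring'[of e] by auto
  thus ?thesis using prime_factorization_nat[OF e0] by simp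
qed

lemma sum_inverse_squarefree_divisors_le:
  fixes g :: nat
  assumes "g > 0"
  shows "(\<Sum>e | e dvd g \<and> squarefree e. 1 / real e) \<le> real (card (prime_factors g)) + 1"
proof -
  have "(\<Sum>e | e dvd g \<and> squarefree e. 1 / real e) \<le> (\<Sum>X\<in>Pow (prime_factors g). \<Prod>p\<in>X. 1 / real p)"
  proof (rule sum_le_included[where i = "\<lambda>X. \<Prod>X"])
    show "finite {e. e dvd g \<and> squarefree e}" using assms by simp
    show "\<forall>x\<in>{e. e dvd g \<and> squarefree e}. \<exists>y\<in>Pow (prime_factors g). \<Prod>y = x \<and> 1 / real x \<le> (\<Prod>p\<in>y. 1 / real p)"
    proof clarify
      fix e assume e: "e dvd g" "squarefree e"
      show "\<exists>y\<in>Pow (prime_factors g). \<Prod>y = e \<and> 1 / real e \<le> (\<Prod>p\<in>y. 1 / real p)"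
      proof (intro bexI conjI)
        show eq: "\<Prod>(prime_factors e) = e" by (rule squarefree_eq_prod_prime_factors[OF e(2)])
        show "1 / real e \<le> (\<Prod>p\<in>prime_factors e. 1 / real p)"
          by (subst (1) eq[symmetric]) (simp add: prod_dividef)
        show "prime_factors e \<in> Pow (prime_factors g)" using e assms by (simp add: dvd_prime_factors)
      qed
    qed
  qed (auto intro: prod_nonneg)
  also have "\<dots> = (\<Prod>p\<in>prime_factors g. 1 / real p + 1)"
    by (subst prod_add) auto
  also have "\<dots> = (\<Prod>p\<in>prime_factors g. 1 + 1 / real p)" by (simp only: add.commute)
  also have "\<dots> \<le> real (card (prime_factors g)) + 1"
    by (rule prod_one_plus_inverse_le) (auto intro: prime_gt_0_nat dest: in_prime_factors_imp_prime)
  finally show ?thesis .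
qed

definition sieve_moduli :: "nat \<Rightarrow> nat \<Rightarrow> nat set" where
  "sieve_moduli g Q = {d. 0 < d \<and> d \<le> Q \<and> squarefree d \<and> coprime d g}"

definition sieve_weight :: "nat \<Rightarrow> nat \<Rightarrow> real" where
  "sieve_weight g Q = (\<Sum>d\<in>sieve_moduli g Q. 1 / real (totient d))"

lemma finite_sieve_moduli [simp]: "finite (sieve_moduli g Q)"
  by (rule finite_subset[of _ "{..Q}"]) (auto simp: sieve_moduli_def)

text \<open>Every \<open>n \<le> Q\<close> is \<open>k\<^sup>2 e d\<close> with \<open>e\<close> a squarefree divisor of \<open>g\<close> and \<open>d\<close> squarefree and coprime to \<open>g\<close>, so the
  harmonic sum up to \<open>Q\<close> is at most the product of the three sums of reciprocals.  The price for \<open>g\<close> depends on the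
  number of its prime factors only.\<close>

lemma sieve_weight_ge:
  fixes g Q :: nat
  assumes g: "g > 0" and Q: "Q > 0"
  shows "ln (real Q) \<le> 3 * (real (card (prime_factors g)) + 1) * sieve_weight g Q"
proof -
  define E where "E = {e. e dvd g \<and> squarefree e}"
  have finE: "finite E" using g by (simp add: E_def)
  have "ln (real Q) \<le> harm Q" using ln_le_harm[of Q] Q by (smt (verit) ln_le_cancel_iff of_nat_0_less_iff)
  also have "harm Q = (\<Sum>n\<in>{1..Q}. 1 / real n)" by (simp add: harm_def inverse_eq_divide)
  also have "\<dots> \<le> (\<Sum>(k,e,d)\<in>{1..Q} \<times> E \<times> sieve_moduli g Q. 1 / real k ^ 2 * (1 / real e * (1 / real d)))"
  proof (rule sum_le_included[where i = "\<lambda>(k,e,d). k ^ 2 * (e * d)"])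
    show "\<forall>n\<in>{1..Q}. \<exists>y\<in>{1..Q} \<times> E \<times> sieve_moduli g Q. (case y of (k, e, d) \<Rightarrow> k\<^sup>2 * (e * d)) = n \<and>
            1 / real n \<le> (case y of (k, e, d) \<Rightarrow> 1 / real k ^ 2 * (1 / real e * (1 / real d)))"
    proof
      fix n assume n: "n \<in> {1..Q}"
      define k s where "k = square_part n" and "s = squarefree_part n"
      define e where "e = gcd s g"
      define d where "d = s div e"
      have n0: "n > 0" using n by simp
      have nks: "n = s * k ^ 2" unfolding k_def s_def by (rule squarefree_decompose)
      have s: "squarefree s" "s > 0" by (auto simp: s_def intro!: Nat.gr0I)
      have sed: "s = e * d" by (simp add: d_def e_def)
      have e_g: "e dvd g" by (simp add: e_def)
      have n_eq: "n = k * (k * (d * e))" using nks unfolding sed by (simp add: power2_eq_square mult_ac)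
      have pos: "e > 0" "d > 0" "k > 0" using n0 unfolding n_eq by simp_all
      have kd: "k dvd n" "d dvd n" unfolding n_eq by simp_all
      have le: "k \<le> n" "d \<le> n" using kd n0 by (simp_all add: dvd_imp_le)
      have "coprime d g"
      proof (rule ccontr)
        assume "\<not> coprime d g"
        hence "gcd d g \<noteq> 1" using coprime_iff_gcd_eq_1 by blast
        then obtain p where "prime p" "p dvd gcd d g" using prime_factor_nat by blast
        hence p: "prime p" "p dvd d" "p dvd g" by simp_all
        have "p dvd s" using p(2) unfolding sed by simp
        hence "p dvd e" unfolding e_def using p(3) by (rule gcd_greatest)
        hence "p ^ 2 dvd s" unfolding sed power2_eq_square by (rule mult_dvd_mono[OF _ p(2)])
        thus False using squarefreeD[OF s(1)] p(1) not_prime_unit by blast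
      qed
      moreover have "squarefree d" "squarefree e"
        using squarefree_mono[of d s] squarefree_mono[of e s] s(1) sed by simp_all
      ultimately have "(k, e, d) \<in> {1..Q} \<times> E \<times> sieve_moduli g Q"
        using pos le n e_g by (simp add: sieve_moduli_def E_def)
      moreover have "k\<^sup>2 * (e * d) = n" unfolding n_eq by (simp add: power2_eq_square mult_ac)
      moreover have "1 / real n = 1 / real k ^ 2 * (1 / real e * (1 / real d))"
        unfolding n_eq by (simp add: power2_eq_square mult_ac)
      ultimately show "\<exists>y\<in>{1..Q} \<times> E \<times> sieve_moduli g Q. (case y of (k, e, d) \<Rightarrow> k\<^sup>2 * (e * d)) = n \<and>
            1 / real n \<le> (case y of (k, e, d) \<Rightarrow> 1 / real k ^ 2 * (1 / real e * (1 / real d)))"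
        by (intro bexI[of _ "(k,e,d)"]) auto
    qed
  qed (use finE in auto)
  also have "\<dots> = (\<Sum>k\<in>{1..Q}. 1 / real k ^ 2) * ((\<Sum>e\<in>E. 1 / real e) * (\<Sum>d\<in>sieve_moduli g Q. 1 / real d))"
    unfolding sum_product sum.cartesian_product by (simp add: case_prod_unfold)
  also have "\<dots> \<le> 3 * ((real (card (prime_factors g)) + 1) * sieve_weight g Q)"
  proof (intro mult_mono)
    have "(\<Sum>k\<in>{1..Q}. 1 / real k ^ 2) = (\<Sum>k\<in>{1..Q}. 1 / (max 1 (real k))^2)"
      by (intro sum.cong refl) (simp add: max_def)
    also have "\<dots> \<le> (\<Sum>k<Suc Q. 1 / (max 1 (real k))^2)" by (intro sum_mono2) auto
    finally show "(\<Sum>k\<in>{1..Q}. 1 / real k ^ 2) \<le> 3" using sum_inverse_squares_max_le[of "Suc Q"] by linarith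
    show "(\<Sum>e\<in>E. 1 / real e) \<le> real (card (prime_factors g)) + 1"
      unfolding E_def by (rule sum_inverse_squarefree_divisors_le[OF g])
    show "(\<Sum>d\<in>sieve_moduli g Q. 1 / real d) \<le> sieve_weight g Q"
      unfolding sieve_weight_def
      by (intro sum_mono divide_left_mono) (auto simp: sieve_moduli_def totient_le)
  qed (auto intro!: sum_nonneg mult_nonneg_nonneg)
  finally show ?thesis by (simp only: mult.assoc)
qed

abbreviation point_cluster ::
    "nat set \<Rightarrow> real \<Rightarrow> nat \<Rightarrow> nat \<Rightarrow> nat \<Rightarrow> nat \<Rightarrow> nat \<Rightarrow> nat \<Rightarrow> (nat \<times> nat \<times> nat) set" where
  "point_cluster M \<alpha> g Q W m' d' b' \<equiv> {(m, d, b). m \<in> M \<and> d \<in> sieve_moduli g Q \<and> b \<in> totatives d \<and>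
     (\<exists>k::int. \<bar>(real m * \<alpha> + real b / real d) - (real m' * \<alpha> + real b' / real d') - of_int k\<bar> \<le> 1 / real W)}"

text \<open>Montgomery's inequality for all moduli \<open>d\<close> of the sieve, followed by the large sieve for the points
  \<open>m \<alpha> + b/d\<close>.\<close>

theorem sieved_large_sieve:
  fixes \<alpha> :: real and a :: "nat \<Rightarrow> complex" and A M :: "nat set"
  assumes finM: "finite M" and W: "W > 0" and A: "A \<subseteq> {n0..<n0 + W}"
    and primes: "\<And>n. n \<in> A \<Longrightarrow> prime n \<and> n > Q"
    and K: "\<And>m' d' b'. m' \<in> M \<Longrightarrow> d' \<in> sieve_moduli g Q \<Longrightarrow> b' \<in> totatives d' \<Longrightarrow>
       card (point_cluster M \<alpha> g Q W m' d' b') \<le> K"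
  shows "sieve_weight g Q * (\<Sum>m\<in>M. cmod (twisted_sum A a (real m * \<alpha>)) ^ 2)
     \<le> 24 * real W * real K * (\<Sum>n\<in>A. cmod (a n) ^ 2)"
proof -
  define D where "D = sieve_moduli g Q"
  define S where "S = (\<lambda>t. cmod (twisted_sum A a t) ^ 2)"
  define I where "I = M \<times> Sigma D totatives"
  define \<theta> where "\<theta> = (\<lambda>(m,d,b). real m * \<alpha> + real b / real d)"
  have finA: "finite A" using A finite_subset by blast
  have finI: "finite I" using finM by (auto simp: I_def D_def)
  have mont: "(1 / real (totient d)) * S (real m * \<alpha>) \<le> (\<Sum>b\<in>totatives d. S (real m * \<alpha> + real b / real d))"
    if "d \<in> D" for m d
  proof -
    have d: "d > 0" "d \<le> Q" "squarefree d" using that by (simp_all add: D_def sieve_moduli_def)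
    have cop: "coprime n d" if "n \<in> A" for n
    proof -
      have "\<not> n dvd d" using primes[OF that] d dvd_imp_le[of n d] by linarith
      thus ?thesis using primes[OF that] prime_imp_coprime by blast
    qed
    have "S (real m * \<alpha>) \<le> real (totient d) * (\<Sum>b\<in>totatives d. S (real m * \<alpha> + real b / real d))"
      unfolding S_def by (rule montgomery_inequality[OF d(3) finA cop])
    moreover have "real (totient d) > 0" using d(1) by simp
    ultimately show ?thesis by (simp add: pos_divide_le_eq mult.commute)
  qed
  have "sieve_weight g Q * (\<Sum>m\<in>M. S (real m * \<alpha>)) = (\<Sum>m\<in>M. \<Sum>d\<in>D. (1 / real (totient d)) * S (real m * \<alpha>))"
    unfolding sieve_weight_def D_def by (subst sum_product) (rule sum.swap)
  also have "\<dots> \<le> (\<Sum>m\<in>M. \<Sum>d\<in>D. \<Sum>b\<in>totatives d. S (real m * \<alpha> + real b / real d))"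
    by (intro sum_mono mont)
  also have "\<dots> = (\<Sum>i\<in>I. S (\<theta> i))"
  proof -
    have "(\<Sum>d\<in>D. \<Sum>b\<in>totatives d. S (real m * \<alpha> + real b / real d)) = (\<Sum>z\<in>Sigma D totatives. S (\<theta> (m, z)))" for m
      by (subst sum.Sigma) (auto simp: D_def \<theta>_def case_prod_unfold intro!: sum.cong)
    hence "(\<Sum>m\<in>M. \<Sum>d\<in>D. \<Sum>b\<in>totatives d. S (real m * \<alpha> + real b / real d))
       = (\<Sum>m\<in>M. \<Sum>z\<in>Sigma D totatives. S (\<theta> (m, z)))" by simp
    also have "\<dots> = (\<Sum>i\<in>I. S (\<theta> i))" unfolding I_def by (simp add: sum.cartesian_product)
    finally show ?thesis .
  qed
  also have "\<dots> \<le> 24 * real W * real K * (\<Sum>n\<in>A. cmod (a n) ^ 2)"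
    unfolding S_def
  proof (rule large_sieve[OF finI W A])
    fix i assume "i \<in> I"
    then obtain m' d' b' where i: "i = (m',d',b')" "m' \<in> M" "d' \<in> D" "b' \<in> totatives d'"
      by (auto simp: I_def)
    have "{j \<in> I. \<exists>k::int. \<bar>\<theta> j - \<theta> i - of_int k\<bar> \<le> 1 / real W} =
      (point_cluster M \<alpha> g Q W m' d' b')"
      unfolding i(1) \<theta>_def I_def D_def by auto
    thus "card {j \<in> I. \<exists>k::int. \<bar>\<theta> j - \<theta> i - of_int k\<bar> \<le> 1 / real W} \<le> K"
      using K[OF i(2) _ i(4)] i(3) by (simp add: D_def)
  qed
  finally show ?thesis by (simp add: S_def)
qed

lemma two_power_card_prime_factors_le:
  fixes n :: nat
  assumes "n > 0"
  shows "2 ^ card (prime_factors n) \<le> n"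
proof -
  have "(2::nat) ^ card (prime_factors n) = (\<Prod>p\<in>prime_factors n. 2)" by simp
  also have "\<dots> \<le> (\<Prod>p\<in>prime_factors n. p ^ multiplicity p n)"
  proof (intro prod_mono conjI)
    fix p assume p: "p \<in> prime_factors n"
    hence "multiplicity p n > 0" "p \<ge> 2" by (auto simp: prime_factors_multiplicity prime_ge_2_nat)
    thus "2 \<le> p ^ multiplicity p n" by (metis le_trans self_le_power One_nat_def Suc_leI le_numeral_extra(3) nat_le_linear not_less_eq_eq numeral_2_eq_2)
  qed auto
  also have "\<dots> = n" using prime_factorization_nat[OF assms] ..
  finally show ?thesis .
qed

text \<open>Among the divisors of \<open>r\<close> that are at least \<open>Y\<close> take the smallest one: removing a prime from it gives a number below \<open>Y\<close>,
  and a number with \<open>k\<close> prime factors is at least \<open>2 ^ k\<close>.\<close>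

lemma exists_divisor_few_prime_factors:
  fixes r :: nat and Y :: real
  assumes r: "r > 0" and Y: "Y \<ge> 1"
  obtains g where "g dvd r" "g > 0" "g = r \<or> real g \<ge> Y" "real (card (prime_factors g)) \<le> log 2 Y + 1"
proof (cases "real r < Y")
  case True
  have "2 powr real (card (prime_factors r)) = real (2 ^ card (prime_factors r))" by (simp add: powr_realpow)
  also have "\<dots> \<le> real r" using two_power_card_prime_factors_le[OF r] of_nat_le_iff by blast
  finally have "2 powr real (card (prime_factors r)) \<le> Y" using True by linarith
  hence "real (card (prime_factors r)) \<le> log 2 Y" using Y by (simp add: le_log_iff)
  thus ?thesis using that[of r] r by auto
next
  case False
  define g where "g = (LEAST g. g dvd r \<and> real g \<ge> Y)"
  have g: "g dvd r" "real g \<ge> Y" using LeastI[of "\<lambda>g. g dvd r \<and> real g \<ge> Y" r] False by (auto simp: g_def)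
  have g0: "g > 0" using g r by (auto intro: Nat.gr0I)
  have "real (card (prime_factors g)) \<le> log 2 Y + 1"
  proof (cases "g = 1")
    case True
    thus ?thesis using Y by simp
  next
    case False
    then obtain p where p: "prime p" "p dvd g" using prime_factor_nat by blast
    then obtain h where h: "g = p * h" by auto
    have h0: "h > 0" "h < g" using h g0 p(1) prime_gt_1_nat by auto
    have "h dvd r" using h g(1) dvd_mult_right by blast
    hence hY: "real h < Y" using h0(2) not_less_Least[of h "\<lambda>g. g dvd r \<and> real g \<ge> Y"] by (auto simp: g_def)
    have "prime_factors g \<subseteq> insert p (prime_factors h)"
      using h0 g0 p(1) unfolding h by (auto simp: prime_factors_dvd prime_dvd_mult_iff primes_dvd_imp_eq)
    hence "card (prime_factors g) \<le> card (insert p (prime_factors h))" by (intro card_mono) auto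
    also have "\<dots> \<le> card (prime_factors h) + 1" by (simp add: card_insert_if)
    finally have 1: "real (card (prime_factors g)) \<le> real (card (prime_factors h)) + 1" by simp
    have "2 powr real (card (prime_factors h)) = real (2 ^ card (prime_factors h))" by (simp add: powr_realpow)
  also have "\<dots> \<le> real h" using two_power_card_prime_factors_le[OF h0(1)] of_nat_le_iff by blast
  finally have "2 powr real (card (prime_factors h)) \<le> Y" using hY by linarith
  hence "real (card (prime_factors h)) \<le> log 2 Y" using Y by (simp add: le_log_iff)
    thus ?thesis using 1 by linarith
  qed
  thus ?thesis using that[of g] g g0 by auto
qed

section \<open>Clusters of the points in the sieve\<close>

lemma card_int_abs_le:
  fixes c :: real
  assumes "c \<ge> 0" 
  shows "finite {z::int. \<bar>real_of_int z\<bar> \<le> c}" "real (card {z::int. \<bar>real_of_int z\<bar> \<le> c}) \<le> 2 * c + 1"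
proof -
  have eq: "{z::int. \<bar>real_of_int z\<bar> \<le> c} = {-\<lfloor>c\<rfloor>..\<lfloor>c\<rfloor>}"
    by (auto simp: abs_le_iff le_floor_iff) linarith+
  show "finite {z::int. \<bar>real_of_int z\<bar> \<le> c}" unfolding eq by simp
  have "\<lfloor>c\<rfloor> \<ge> 0" using assms by simp
  thus "real (card {z::int. \<bar>real_of_int z\<bar> \<le> c}) \<le> 2 * c + 1" unfolding eq by simp
qed

lemma card_congruent_near_le:
  fixes D :: real
  assumes g: "g > 0" and D: "D \<ge> 0"
    and X: "\<And>m. m \<in> X \<Longrightarrow> int g dvd int m - int m' \<and> \<bar>real m - real m'\<bar> \<le> D"
  shows "finite X" "real (card X) \<le> 1 + 2 * D / real g"
proof -
  define h where "h = (\<lambda>m. (int m - int m') div int g)"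
  have gh: "int g * h m = int m - int m'" if "m \<in> X" for m
    using X[OF that] by (simp add: h_def)
  have inj: "inj_on h X"
    by (rule inj_onI) (use gh in \<open>metis diff_add_cancel of_nat_eq_iff\<close>)
  have sub: "h ` X \<subseteq> {z::int. \<bar>real_of_int z\<bar> \<le> D / real g}"
  proof clarify
    fix m assume m: "m \<in> X"
    have "real_of_int (int g * h m) = real m - real m'" unfolding gh[OF m] by simp
    hence "\<bar>real g * real_of_int (h m)\<bar> = \<bar>real m - real m'\<bar>" by simp
    hence "real g * \<bar>real_of_int (h m)\<bar> = \<bar>real m - real m'\<bar>" by (simp add: abs_mult)
    hence "real g * \<bar>real_of_int (h m)\<bar> \<le> D" using X[OF m] by simp
    thus "\<bar>real_of_int (h m)\<bar> \<le> D / real g" using g by (simp add: field_simps)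
  qed
  have pos: "D / real g \<ge> 0" using D by simp
  have "finite (h ` X)" using sub card_int_abs_le(1)[OF pos] finite_subset by blast
  thus fX: "finite X" using inj finite_imageD by blast
  have "card X = card (h ` X)" using inj by (simp add: card_image)
  also have "\<dots> \<le> card {z::int. \<bar>real_of_int z\<bar> \<le> D / real g}"
    by (rule card_mono[OF card_int_abs_le(1)[OF pos] sub])
  finally show "real (card X) \<le> 1 + 2 * D / real g" using card_int_abs_le(2)[OF pos] by simp
qed

text \<open>If two points \<open>m \<alpha> + b/d\<close> and \<open>m' \<alpha> + b'/d'\<close> are close modulo \<open>1\<close>, then replacing \<open>\<alpha>\<close> by \<open>b0/r\<close> turns
  their difference into a rational number with denominator dividing \<open>r d d'\<close> that is too close to an integer not to
  be one.  Hence \<open>r\<close> divides \<open>(m - m') d d'\<close>, and as \<open>d\<close> and \<open>d'\<close> are coprime to \<open>g\<close>, \<open>g\<close> divides \<open>m - m'\<close>; the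
  distance that remains is \<open>\<bar>m - m'\<bar> \<bar>\<beta>\<bar>\<close>, which \<open>D\<close> controls.  Moreover \<open>m\<close> determines \<open>b/d\<close>.\<close>

lemma card_cluster_le:
  fixes \<alpha> L D :: real and b0 :: int and r Q W g :: nat and M :: "nat set"
  defines "\<beta> \<equiv> \<alpha> - of_int b0 / real r"
  assumes r: "r > 0" "coprime b0 (int r)" and g: "g dvd r" and W: "W > 0"
    and L: "\<And>m m'. m \<in> M \<Longrightarrow> m' \<in> M \<Longrightarrow> \<bar>real m - real m'\<bar> \<le> L"
    and small: "real r * real Q ^ 2 * (1 / real W + L * \<bar>\<beta>\<bar>) < 1"
    and D: "D \<ge> 0" "\<And>t. 0 \<le> t \<Longrightarrow> t \<le> L \<Longrightarrow> t * \<bar>\<beta>\<bar> \<le> 1 / real W \<Longrightarrow> t \<le> D"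
    and m': "m' \<in> M" "d' \<in> sieve_moduli g Q"
  shows "real (card (point_cluster M \<alpha> g Q W m' d' b'))
         \<le> 1 + 2 * D / real g"
proof -
  define C where "C = (point_cluster M \<alpha> g Q W m' d' b')"
  have g0: "g > 0" using g r by (auto intro: Nat.gr0I)
  have d': "d' > 0" "d' \<le> Q" "coprime d' g" using m'(2) by (auto simp: sieve_moduli_def)
  have key: "int g dvd int m - int m' \<and> \<bar>real m - real m'\<bar> \<le> D \<and>
     (\<exists>k::int. (real m - real m') * of_int b0 / real r + real b / real d - real b' / real d' = of_int k)"
    if "(m, d, b) \<in> C" for m d b
  proof -
    from that have m: "m \<in> M" "d \<in> sieve_moduli g Q" "b \<in> totatives d" by (auto simp: C_def)
    have d: "d > 0" "d \<le> Q" "coprime d g" using m(2) by (auto simp: sieve_moduli_def)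
    from that have "\<exists>k::int. \<bar>(real m * \<alpha> + real b / real d) - (real m' * \<alpha> + real b' / real d') - of_int k\<bar> \<le> 1 / real W"
      unfolding C_def by simp
    then obtain k :: int where k: "\<bar>(real m * \<alpha> + real b / real d) - (real m' * \<alpha> + real b' / real d') - of_int k\<bar> \<le> 1 / real W"
      by blast
    define t where "t = int m - int m'"
    have t: "real_of_int t = real m - real m'" by (simp add: t_def)
    have tL: "\<bar>real_of_int t\<bar> \<le> L" using L[OF m(1) m'(1)] t by simp
    define X where "X = real_of_int t * of_int b0 / real r + real b / real d - real b' / real d' - of_int k"
    have X: "(real m * \<alpha> + real b / real d) - (real m' * \<alpha> + real b' / real d') - of_int k = X + real_of_int t * \<beta>"
      unfolding X_def t \<beta>_def by (simp add: algebra_simps)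
    have "\<bar>X\<bar> \<le> 1 / real W + \<bar>real_of_int t\<bar> * \<bar>\<beta>\<bar>"
      using k unfolding X abs_mult[symmetric] by linarith
    also have "\<dots> \<le> 1 / real W + L * \<bar>\<beta>\<bar>"
      using tL by (intro add_left_mono mult_right_mono) auto
    finally have X1: "\<bar>X\<bar> \<le> 1 / real W + L * \<bar>\<beta>\<bar>" .
    \<comment> \<open>The integer \<open>X * r * d * d'\<close> is smaller than \<open>1\<close> in absolute value.\<close>
    define z :: int where "z = t * b0 * int d * int d' + (int b * int d' - int b' * int d) * int r - k * int r * int d * int d'"
    have zX: "real_of_int z = X * (real r * real d * real d')"
      unfolding z_def X_def using d d' r by (simp add: field_simps)
    have "\<bar>real_of_int z\<bar> = \<bar>X\<bar> * (real r * (real d * real d'))"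
      unfolding zX by (simp add: abs_mult mult_ac)
    also have "\<dots> \<le> (1 / real W + L * \<bar>\<beta>\<bar>) * (real r * (real Q * real Q))"
      using X1 d d' by (intro mult_mono) auto
    also have "\<dots> < 1" using small by (simp add: power2_eq_square mult_ac)
    finally have z0: "z = 0" by linarith
    hence X0: "X = 0" using zX d d' r by simp
    have "int r dvd t * (int d * int d') * b0"
    proof -
      have "t * (int d * int d') * b0 = int r * (k * int d * int d' - (int b * int d' - int b' * int d))"
        using z0 unfolding z_def by (simp add: algebra_simps)
      thus ?thesis by simp
    qed
    hence "int r dvd t * (int d * int d')"
      using r(2) by (simp add: coprime_dvd_mult_left_iff coprime_commute)
    hence "int g dvd t * (int d * int d')" using g by (meson dvd_trans of_nat_dvd_iff)
    moreover have "coprime (int g) (int d * int d')"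
      using d(3) d'(3) by (simp add: coprime_commute)
    ultimately have gt: "int g dvd t" by (simp add: coprime_dvd_mult_left_iff)
    have "\<bar>real_of_int t\<bar> * \<bar>\<beta>\<bar> \<le> 1 / real W" using k unfolding X X0 by (simp add: abs_mult)
    hence "\<bar>real_of_int t\<bar> \<le> D" using tL by (intro D(2)) auto
    moreover have "(real m - real m') * of_int b0 / real r + real b / real d - real b' / real d' = of_int k"
      using X0 unfolding X_def t by simp
    ultimately show ?thesis using gt unfolding t by (auto simp: t_def)
  qed
  have inj: "inj_on fst C"
  proof (rule inj_onI)
    fix x y assume xy: "x \<in> C" "y \<in> C" "fst x = fst y"
    obtain m d b where x: "x = (m,d,b)" by (cases x) auto
    obtain e c where y: "y = (m,e,c)" using xy x by (cases y) auto
    have d: "d > 0" "b \<in> totatives d" and e: "e > 0" "c \<in> totatives e"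
      using xy by (auto simp: x y C_def sieve_moduli_def)
    have bt: "0 < b" "b \<le> d" "coprime b d" "0 < c" "c \<le> e" "coprime c e"
      using d e by (auto simp: in_totatives_iff)
    obtain k where k: "(real m - real m') * of_int b0 / real r + real b / real d - real b' / real d' = of_int k"
      using key xy x by blast
    obtain l where l: "(real m - real m') * of_int b0 / real r + real c / real e - real b' / real d' = of_int l"
      using key xy y by blast
    have "0 < real b / real d" "real b / real d \<le> 1" "0 < real c / real e" "real c / real e \<le> 1"
      using bt d e by auto
    moreover have kl: "real b / real d - real c / real e = of_int (k - l)" using k l by simp
    ultimately have "\<bar>real_of_int (k - l)\<bar> < 1" by linarith
    hence "k - l = 0" by linarith
    hence "real b / real d = real c / real e" using kl by simp
    hence "real (b * e) = real (c * d)" using d e by (simp add: field_simps)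
    hence eq: "b * e = c * d" using of_nat_eq_iff by blast
    have "d dvd b * e" unfolding eq by simp
    moreover have "e dvd c * d" unfolding eq[symmetric] by simp
    ultimately have "d dvd e" "e dvd d" using bt by (auto simp: coprime_dvd_mult_right_iff coprime_commute)
    hence "d = e" by (rule dvd_antisym)
    thus "x = y" using eq d x y by simp
  qed
  have X: "\<And>m. m \<in> fst ` C \<Longrightarrow> int g dvd int m - int m' \<and> \<bar>real m - real m'\<bar> \<le> D" using key by auto
  have "card C = card (fst ` C)" using inj by (simp add: card_image)
  thus ?thesis using card_congruent_near_le(2)[where X = "fst ` C" and m' = m', OF g0 D(1) X] unfolding C_def by simp
qed

text \<open>In a window of \<open>r\<close> consecutive integers \<open>m\<close> the numbers \<open>m b0\<close> are distinct modulo \<open>r\<close>, and \<open>m \<alpha>\<close> differs from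
  \<open>m b0 / r\<close> by a shift that varies by at most \<open>1/r\<close>.\<close>

lemma card_near_multiples_le:
  fixes \<alpha> :: real and b0 :: int and r W M :: nat
  assumes r: "r > 0" "coprime b0 (int r)" and W: "W > 0"
    and beta: "real r * \<bar>\<alpha> - of_int b0 / real r\<bar> \<le> 1 / real r"
  shows "real (card {m\<in>{1..M}. \<exists>k::int. \<bar>real m * \<alpha> - s - of_int k\<bar> \<le> 1 / real W})
     \<le> (real M / real r + 1) * (4 * real r / real W + 3)"
proof -
  define \<beta> where "\<beta> = \<alpha> - of_int b0 / real r"
  define C where "C = {m\<in>{1..M}. \<exists>k::int. \<bar>real m * \<alpha> - s - of_int k\<bar> \<le> 1 / real W}"
  have blk: "real (card {m\<in>C. m div r = q}) \<le> 4 * real r / real W + 3" for q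
  proof (cases "{m\<in>C. m div r = q} = {}")
    case True
    show ?thesis unfolding True by simp
  next
    case False
    then obtain m1 where m1: "m1 \<in> C" "m1 div r = q" by auto
    have "\<forall>m\<in>C. \<exists>k::int. \<bar>real m * \<alpha> - s - of_int k\<bar> \<le> 1 / real W" by (auto simp: C_def)
    then obtain k :: "nat \<Rightarrow> int" where k: "\<And>m. m \<in> C \<Longrightarrow> \<bar>real m * \<alpha> - s - of_int (k m)\<bar> \<le> 1 / real W" by metis
    define z where "z = (\<lambda>m. (int m - int m1) * b0 - int r * (k m - k m1))"
    define c where "c = 2 * real r / real W + 1"
    have c0: "c \<ge> 0" by (simp add: c_def)
    have sub: "z ` {m\<in>C. m div r = q} \<subseteq> {z::int. \<bar>real_of_int z\<bar> \<le> c}"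
    proof clarify
      fix m assume m: "m \<in> C" "q = m div r"
      have lt: "\<bar>real m - real m1\<bar> \<le> real r"
      proof -
        have "m = q * r + m mod r" "m1 = q * r + m1 mod r" using m m1 by (metis div_mult_mod_eq)+
        moreover have "m mod r < r" "m1 mod r < r" using r by auto
        ultimately have "\<bar>int m - int m1\<bar> \<le> int r" by linarith
        thus ?thesis by linarith
      qed
      have zr: "real_of_int (z m) = real r * ((real m * \<alpha> - s - of_int (k m)) - (real m1 * \<alpha> - s - of_int (k m1)) - (real m - real m1) * \<beta>)"
        unfolding z_def \<beta>_def using r by (simp add: field_simps)
      have "\<bar>(real m - real m1) * \<beta>\<bar> \<le> real r * \<bar>\<beta>\<bar>" unfolding abs_mult using lt by (intro mult_right_mono) auto
      hence "\<bar>(real m - real m1) * \<beta>\<bar> \<le> 1 / real r" using beta unfolding \<beta>_def by linarith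
      hence "\<bar>(real m * \<alpha> - s - of_int (k m)) - (real m1 * \<alpha> - s - of_int (k m1)) - (real m - real m1) * \<beta>\<bar> \<le> 2 / real W + 1 / real r"
        using k[OF m(1)] k[OF m1(1)] by (simp add: abs_le_iff)
      hence "\<bar>real_of_int (z m)\<bar> \<le> real r * (2 / real W + 1 / real r)"
        unfolding zr abs_mult by (simp add: mult_left_mono)
      also have "\<dots> = c" using r by (simp add: c_def field_simps)
      finally show "\<bar>real_of_int (z m)\<bar> \<le> c" .
    qed
    have inj: "inj_on z {m\<in>C. m div r = q}"
    proof (rule inj_onI, clarify)
      fix m m2 assume m: "m \<in> C" "m2 \<in> C" "m2 div r = m div r" "z m = z m2" "q = m div r"
      have "(int m - int m2) * b0 = int r * (k m - k m2)" using m(4) unfolding z_def by (simp add: algebra_simps)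
      hence "int r dvd (int m - int m2) * b0" by simp
      hence "int r dvd int m - int m2" using r(2) by (simp add: coprime_dvd_mult_left_iff coprime_commute)
      hence "int m mod int r = int m2 mod int r" by (simp add: mod_eq_dvd_iff)
      hence "m mod r = m2 mod r" by (metis of_nat_eq_iff of_nat_mod)
      thus "m = m2" using m(3) by (metis div_mult_mod_eq)
    qed
    have "card {m\<in>C. m div r = q} = card (z ` {m\<in>C. m div r = q})" using inj by (simp add: card_image)
    also have "\<dots> \<le> card {z::int. \<bar>real_of_int z\<bar> \<le> c}" by (rule card_mono[OF card_int_abs_le(1)[OF c0] sub])
    finally show ?thesis using card_int_abs_le(2)[OF c0] unfolding c_def by simp
  qed
  have finC: "finite C" by (simp add: C_def)
  have "real (card C) = (\<Sum>m\<in>C. 1)" by simp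
  also have "\<dots> = (\<Sum>q\<in>{..M div r}. \<Sum>m\<in>{m\<in>C. m div r = q}. 1)"
    by (intro sum.group[symmetric]) (use finC in \<open>auto simp: C_def div_le_mono\<close>)
  also have "\<dots> = (\<Sum>q\<in>{..M div r}. real (card {m\<in>C. m div r = q}))" by simp
  also have "\<dots> \<le> (\<Sum>q\<in>{..M div r}. 4 * real r / real W + 3)" by (intro sum_mono blk)
  also have "\<dots> = real (M div r + 1) * (4 * real r / real W + 3)" by simp
  also have "\<dots> \<le> (real M / real r + 1) * (4 * real r / real W + 3)"
  proof (intro mult_right_mono)
    have "real (r * (M div r)) \<le> real M" using times_div_less_eq_dividend of_nat_le_iff by blast
    thus "real (M div r + 1) \<le> real M / real r + 1" using r by (simp add: field_simps)
  qed auto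
  finally show ?thesis unfolding C_def .
qed

section \<open>Mean squares of prime sums over a short block\<close>

lemma sieve_weight_1_1: "sieve_weight 1 1 = 1"
proof -
  have "sieve_moduli 1 1 = {1}" by (auto simp: sieve_moduli_def)
  thus ?thesis by (simp add: sieve_weight_def)
qed

text \<open>The Brun--Titchmarsh inequality, from the sieved large sieve at the single point \<open>0\<close>: two distinct fractions with
  denominators up to \<open>Q\<close> differ by at least \<open>1 / Q\<^sup>2\<close>.\<close>

lemma card_primes_in_interval_le:
  fixes Q W :: nat
  assumes A: "A \<subseteq> {n0..<n0 + W}" and primes: "\<And>n. n \<in> A \<Longrightarrow> prime n \<and> n > Q"
    and Q: "Q \<ge> 2" and QW: "Q ^ 2 < W"
  shows "real (card A) \<le> 72 * real W / ln (real Q)"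
proof -
  have W: "W > 0" using QW by simp
  have K: "card (point_cluster {0} 0 1 Q W m' d' b') \<le> 1"
    if "m' \<in> {0}" "d' \<in> sieve_moduli 1 Q" for m' d' b'
  proof -
    have "real (card (point_cluster {0} 0 1 Q W m' d' b'))
         \<le> 1 + 2 * 0 / real 1"
    proof (rule card_cluster_le[where r = 1 and ?b0.0 = 0 and L = 0])
      have "real (Q ^ 2) < real W" using QW of_nat_less_iff by blast
      thus "real 1 * (real Q)\<^sup>2 * (1 / real W + 0 * \<bar>0 - real_of_int 0 / real 1\<bar>) < 1" using W by simp
    qed (use that W in auto)
    thus ?thesis by simp
  qed
  have "sieve_weight 1 Q * (\<Sum>m\<in>{0::nat}. cmod (\<Sum>n\<in>A. 1 * add_char (real n * (real m * 0))) ^ 2)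
     \<le> 24 * real W * real 1 * (\<Sum>n\<in>A. cmod 1 ^ 2)"
    by (rule sieved_large_sieve[OF _ W A primes K]) auto
  hence 1: "sieve_weight 1 Q * real (card A) ^ 2 \<le> 24 * real W * real (card A)" by simp
  have lnQ: "ln (real Q) > 0" using Q by simp
  have "ln (real Q) \<le> 3 * sieve_weight 1 Q" using sieve_weight_ge[of 1 Q] Q by simp
  hence "ln (real Q) * real (card A) ^ 2 \<le> 3 * sieve_weight 1 Q * real (card A) ^ 2" by (rule mult_right_mono) simp
  also have "\<dots> \<le> 72 * real W * real (card A)" using 1 by simp
  finally have "(ln (real Q) * real (card A)) * real (card A) \<le> (72 * real W) * real (card A)"
    by (simp add: power2_eq_square mult_ac)
  hence "ln (real Q) * real (card A) \<le> 72 * real W"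
    by (cases "card A = 0") auto
  thus ?thesis using lnQ by (simp add: field_simps)
qed

text \<open>Let \<open>b0/r\<close> be a Dirichlet approximation of \<open>\<alpha>\<close> with \<open>r \<le> 4 M Q\<^sup>2\<close>.  If \<open>r\<close> is small compared with \<open>W\<close>, the points
  \<open>m \<alpha> + b/d\<close> are well distributed and the sieve gains \<open>ln Q\<close>.  Otherwise \<open>M\<close> and \<open>r\<close> are both so large that the large sieve
  for the points \<open>m \<alpha>\<close> alone already saves a power of \<open>W\<close>, namely \<open>Q ^ 4 / W\<close>.  The quantity \<open>R\<close> measures
  how far \<open>\<alpha>\<close> is from fractions with small denominators, where distances are weighed on the scale \<open>1 / (W M)\<close>.\<close>

lemma bilinear_block_bound:
  fixes \<alpha> Y R :: real and M Q W :: nat and a :: "nat \<Rightarrow> complex"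
  assumes M: "M \<ge> 1" and Q: "Q \<ge> 2" and W: "W > 0" and A: "A \<subseteq> {n0..<n0 + W}"
    and primes: "\<And>n. n \<in> A \<Longrightarrow> prime n \<and> n > Q" and a: "\<And>n. n \<in> A \<Longrightarrow> cmod (a n) \<le> 1"
    and Y: "1 \<le> Y" "Y \<le> real M" and R: "R > 0"
    and approx: "\<And>(b0::int) (r::nat). r > 0 \<Longrightarrow> coprime b0 (int r) \<Longrightarrow> r \<le> 4 * M * Q^2 \<Longrightarrow>
        \<bar>\<alpha> - of_int b0 / real r\<bar> \<le> 1 / (real r * real (4 * M * Q^2)) \<Longrightarrow>
        R \<le> real r \<or> R \<le> real r * (real W * real M * \<bar>\<alpha> - of_int b0 / real r\<bar>)"
  shows "(\<Sum>m\<in>{1..M}. cmod (twisted_sum A a (real m * \<alpha>)) ^ 2)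
     \<le> 4000 * real M * real W * real (card A) *
        ((log 2 Y + 2) / ln (real Q) * (1 / Y + 1 / R) + real Q ^ 4 / real W)"
proof -
  define N where "N = 4 * M * Q^2"
  define S where "S = (\<Sum>m\<in>{1..M}. cmod (twisted_sum A a (real m * \<alpha>)) ^ 2)"
  have S0: "S \<ge> 0" by (auto simp: S_def intro: sum_nonneg)
  have a2: "(\<Sum>n\<in>A. cmod (a n) ^ 2) \<le> real (card A)"
  proof -
    have "(\<Sum>n\<in>A. cmod (a n) ^ 2) \<le> (\<Sum>n\<in>A. 1)"
      by (intro sum_mono) (use a in \<open>auto simp: power_le_one\<close>)
    thus ?thesis by simp
  qed
  have N0: "N > 0" using M Q by (simp add: N_def)
  have lnQ: "ln (real Q) > 0" using Q by simp
  have logY: "log 2 Y \<ge> 0" using Y by simp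
  obtain b0 :: int and k :: int where bk: "coprime b0 k" "0 < k" "k \<le> int N" "\<bar>of_int k * \<alpha> - of_int b0\<bar> < 1 / real N"
    using Dirichlet_approx_coprime[OF N0, of \<alpha>] by blast
  define r where "r = nat k"
  have r: "r > 0" "coprime b0 (int r)" "r \<le> N" using bk by (auto simp: r_def)
  define \<beta> where "\<beta> = \<alpha> - of_int b0 / real r"
  have kr: "real_of_int k = real r" using bk by (simp add: r_def)
  have rb: "real r * \<bar>\<beta>\<bar> < 1 / real N"
  proof -
    have "real r * \<bar>\<beta>\<bar> = \<bar>real r * \<beta>\<bar>" by (simp add: abs_mult)
    also have "real r * \<beta> = of_int k * \<alpha> - of_int b0" using r(1) by (simp add: \<beta>_def kr right_diff_distrib)
    finally show ?thesis using bk(4) by simp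
  qed
  have small: "\<bar>\<beta>\<bar> \<le> 1 / (real r * real N)" using rb r N0 by (simp add: field_simps)
  have RR: "R \<le> real r \<or> R \<le> real r * (real W * real M * \<bar>\<beta>\<bar>)"
    using approx[OF r(1,2)] r(3) small unfolding N_def \<beta>_def by blast
  have Qpos: "real Q \<ge> 2" using Q by simp
  define E where "E = (log 2 Y + 2) / ln (real Q) * (1 / Y + 1 / R)"
  have E0: "E \<ge> 0" using logY lnQ Y R by (simp add: E_def)
  define U where "U = real M * real W * real (card A)"
  have U0: "U \<ge> 0" by (simp add: U_def)
  show ?thesis
  proof (cases "real r * 8 * real Q ^ 2 \<le> real W")
    case True
    obtain g where g: "g dvd r" "g > 0" "g = r \<or> real g \<ge> Y" "real (card (prime_factors g)) \<le> log 2 Y + 1"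
      using exists_divisor_few_prime_factors[OF r(1) Y(1)] by blast
    \<comment> \<open>Within distance \<open>1/W\<close> the shift \<open>\<bar>m - m'\<bar> \<bar>\<beta>\<bar>\<close> is at most \<open>1/W\<close>; for \<open>\<beta> = 0\<close> only \<open>M\<close> bounds \<open>m - m'\<close>.\<close>
    define D where "D = (if \<beta> = 0 then real M else min (real M) (1 / (real W * \<bar>\<beta>\<bar>)))"
    have D0: "D \<ge> 0" by (simp add: D_def)
    have DM: "D \<le> real M" by (simp add: D_def)
    have Dt: "t \<le> D" if "0 \<le> t" "t \<le> real M" "t * \<bar>\<beta>\<bar> \<le> 1 / real W" for t
      using that W by (auto simp: D_def field_simps)
    have Dg: "1 + 2 * D / real g \<le> real M * (3 / Y + 2 / R)"
    proof -
      have MY: "1 \<le> real M / Y" using Y by simp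
      have MR: "0 \<le> real M / R" using R by simp
      from g(3) RR consider "real g \<ge> Y" | "g = r" "R \<le> real r" | "g = r" "R \<le> real r * (real W * real M * \<bar>\<beta>\<bar>)" by blast
      hence "2 * D / real g \<le> 2 * real M / Y \<or> 2 * D / real g \<le> 2 * real M / R"
      proof cases
        case 1
        have "2 * D / real g \<le> 2 * real M / Y" using 1 DM D0 Y by (intro frac_le) auto
        thus ?thesis by simp
      next
        case 2
        have "2 * D / real g \<le> 2 * real M / R" using 2 DM D0 R by (intro frac_le) auto
        thus ?thesis by simp
      next
        case 3
        have b0: "\<beta> \<noteq> 0" using 3 R by auto
        have pos: "real W * \<bar>\<beta>\<bar> > 0" using b0 W by simp
        have "D \<le> 1 / (real W * \<bar>\<beta>\<bar>)" using b0 by (simp add: D_def)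
        hence "2 * D \<le> 2 * (1 / (real W * \<bar>\<beta>\<bar>))" by simp
        hence "2 * D / real g \<le> 2 * (1 / (real W * \<bar>\<beta>\<bar>)) / real r"
          unfolding \<open>g = r\<close> by (rule divide_right_mono) simp
        also have "\<dots> = 2 / (real r * real W * \<bar>\<beta>\<bar>)" by simp
        also have "\<dots> \<le> 2 * real M / R"
        proof -
          have "real r * real W * \<bar>\<beta>\<bar> > 0" using mult_pos_pos[OF _ pos, of "real r"] r(1) by (simp only: mult.assoc of_nat_0_less_iff)
          moreover have "2 * R \<le> 2 * real M * (real r * real W * \<bar>\<beta>\<bar>)" using 3 by (simp add: mult_ac)
          ultimately show ?thesis using R by (metis divide_le_eq le_divide_eq mult.commute times_divide_eq_left)
        qed
        finally show ?thesis by simp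
      qed
      moreover have "2 * real M / Y = 2 * (real M / Y)" "2 * real M / R = 2 * (real M / R)"
        "real M * (3 / Y + 2 / R) = 3 * (real M / Y) + 2 * (real M / R)" by (simp_all add: algebra_simps)
      ultimately show ?thesis using MY MR by linarith
    qed
    define K where "K = nat \<lfloor>1 + 2 * D / real g\<rfloor>"
    have KD: "real K \<le> 1 + 2 * D / real g" using D0 by (simp add: K_def)
    have cond: "real r * real Q ^ 2 * (1 / real W + real M * \<bar>\<alpha> - of_int b0 / real r\<bar>) < 1"
    proof -
      have "real r * real Q ^ 2 * (1 / real W) \<le> 1 / 8" using True W by (simp add: field_simps)
      moreover have "real r * real Q ^ 2 * (real M * \<bar>\<beta>\<bar>) \<le> 1 / 4"
      proof -
        have "real r * real Q ^ 2 * (real M * \<bar>\<beta>\<bar>) = (real r * \<bar>\<beta>\<bar>) * (real M * real Q ^ 2)" by simp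
        also have "\<dots> \<le> (1 / real N) * (real M * real Q ^ 2)" using rb by (intro mult_right_mono) auto
        also have "\<dots> = 1 / 4" using M Q by (simp add: N_def)
        finally show ?thesis .
      qed
      ultimately show ?thesis unfolding \<beta>_def[symmetric] distrib_left by linarith
    qed
    have Kc: "card (point_cluster {1..M} \<alpha> g Q W m' d' b') \<le> K"
      if "m' \<in> {1..M}" "d' \<in> sieve_moduli g Q" for m' d' b'
    proof -
      have L: "\<bar>real m - real m'\<bar> \<le> real M" if "m \<in> {1..M}" "m' \<in> {1..M}" for m m' using that by auto
      have "real (card (point_cluster {1..M} \<alpha> g Q W m' d' b'))
          \<le> 1 + 2 * D / real g"
        by (rule card_cluster_le[OF r(1,2) g(1) W L cond D0 Dt[unfolded \<beta>_def] that])
      thus ?thesis unfolding K_def by linarith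
    qed
    have "sieve_weight g Q * S \<le> 24 * real W * real K * (\<Sum>n\<in>A. cmod (a n) ^ 2)"
      unfolding S_def by (rule sieved_large_sieve[OF _ W A primes Kc]) auto
    also have "\<dots> \<le> 24 * real W * (real M * (3 / Y + 2 / R)) * real (card A)"
      using KD Dg a2 by (intro mult_mono mult_left_mono) (auto intro: sum_nonneg)
    also have "\<dots> \<le> 72 * U * (1 / Y + 1 / R)"
    proof -
      have "3 / Y + 2 / R \<le> 3 * (1 / Y + 1 / R)" using R by (simp add: field_simps)
      from mult_left_mono[OF this, of "24 * U"] U0 show ?thesis by (simp add: U_def mult_ac)
    qed
    finally have swS: "sieve_weight g Q * S \<le> 72 * U * (1 / Y + 1 / R)" .
    have "ln (real Q) \<le> 3 * (real (card (prime_factors g)) + 1) * sieve_weight g Q"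
      by (rule sieve_weight_ge) (use g Q in auto)
    also have "\<dots> \<le> 3 * (log 2 Y + 2) * sieve_weight g Q"
      using g(4) by (intro mult_right_mono) (auto simp: sieve_weight_def intro: sum_nonneg)
    finally have "ln (real Q) * S \<le> 3 * (log 2 Y + 2) * sieve_weight g Q * S" using S0 by (rule mult_right_mono)
    also have "\<dots> = 3 * (log 2 Y + 2) * (sieve_weight g Q * S)" by simp
    also have "\<dots> \<le> 3 * (log 2 Y + 2) * (72 * U * (1 / Y + 1 / R))"
      using swS logY by (intro mult_left_mono) auto
    also have "\<dots> = ln (real Q) * (216 * U * E)"
    proof -
      have E: "E * ln (real Q) = (log 2 Y + 2) * (1 / Y + 1 / R)" using lnQ by (simp add: E_def)
      have "3 * u * (72 * U * v) = 216 * U * (u * v)" for u v :: real by simp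
      hence "3 * (log 2 Y + 2) * (72 * U * (1 / Y + 1 / R)) = 216 * U * (E * ln (real Q))" unfolding E .
      thus ?thesis by (simp only: mult_ac)
    qed
    finally have "S \<le> 216 * U * E" using lnQ by (simp only: mult_le_cancel_left_pos)
    also have "\<dots> \<le> 4000 * U * (E + real Q ^ 4 / real W)"
      using U0 E0 by (intro mult_mono) auto
    finally show ?thesis unfolding S_def U_def E_def by (simp add: mult_ac)
  next
    case False
    hence rW: "real W < 8 * real r * real Q ^ 2" by simp
    have rN: "real r \<le> 4 * real M * real Q ^ 2"
    proof -
      have "real r \<le> real N" using r by simp
      thus ?thesis by (simp add: N_def)
    qed
    \<comment> \<open>Here \<open>W / (8 Q\<^sup>2) < r \<le> 4 M Q\<^sup>2\<close>, which makes all parts of \<open>K0\<close>, including the constant ones, \<open>O(Z)\<close>.\<close>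
    define Z where "Z = real M * real Q ^ 4 / real W"
    define K0 where "K0 = (real M / real r + 1) * (4 * real r / real W + 3)"
    have K0: "K0 \<le> 160 * Z"
    proof -
      have Q1: "1 \<le> real Q ^ 2" using Qpos by simp
      have Q4: "real Q ^ 4 = real Q ^ 2 * real Q ^ 2" by (simp flip: power_add)
      have Q24: "real Q ^ 2 \<le> real Q ^ 4" unfolding Q4 using mult_left_mono[OF Q1, of "real Q ^ 2"] by simp
      have Wp: "real W > 0" using W by simp
      have e: "K0 = 4 * real M / real W + 3 * real M / real r + 4 * real r / real W + 3"
      proof -
        have "real M / real r * (4 * real r / real W) = 4 * real M / real W" using r(1) by simp
        moreover have "(u + 1) * (v + 3) = u * v + v + 3 * u + 3" for u v :: real by (simp add: algebra_simps)
        ultimately show ?thesis unfolding K0_def by simp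
      qed
      have 1: "4 * real M / real W \<le> 4 * Z"
        unfolding Z_def using Q24 Q1 Wp mult_left_mono[of 1 "real Q ^ 4" "real M"] by (simp add: divide_right_mono)
      have 2: "3 * real M / real r \<le> 24 * Z"
      proof -
        have "1 / real r \<le> 8 * real Q ^ 2 / real W" using rW r(1) Wp by (simp add: field_simps)
        also have "\<dots> \<le> 8 * real Q ^ 4 / real W" using Q24 Wp by (intro divide_right_mono) auto
        finally have "3 * real M * (1 / real r) \<le> 3 * real M * (8 * real Q ^ 4 / real W)" by (intro mult_left_mono) auto
        thus ?thesis by (simp add: Z_def)
      qed
      have 3: "4 * real r / real W \<le> 16 * Z"
      proof -
        have "4 * real r \<le> 16 * (real M * real Q ^ 2)" using rN by simp
        also have "\<dots> \<le> 16 * (real M * real Q ^ 4)" using Q24 by (intro mult_left_mono) auto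
        finally have "4 * real r / real W \<le> 16 * (real M * real Q ^ 4) / real W" using Wp by (intro divide_right_mono) auto
        thus ?thesis by (simp add: Z_def)
      qed
      have 4: "3 \<le> 96 * Z"
      proof -
        have "real W \<le> 8 * real r * real Q ^ 2" using rW by simp
        also have "\<dots> \<le> 8 * (4 * real M * real Q ^ 2) * real Q ^ 2" using rN by (intro mult_right_mono mult_left_mono) auto
        also have "8 * (4 * real M * q) * q = 32 * (real M * (q * q))" for q :: real by simp
        finally have "real W \<le> 32 * (real M * real Q ^ 4)" by (simp only: Q4)
        thus ?thesis using Wp by (simp add: Z_def field_simps)
      qed
      have "Z \<ge> 0" by (simp add: Z_def)
      thus ?thesis using 1 2 3 4 e by linarith
    qed
    define K where "K = nat \<lfloor>K0\<rfloor>"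
    have K0pos: "K0 \<ge> 0" by (simp add: K0_def)
    have beta: "real r * \<bar>\<alpha> - of_int b0 / real r\<bar> \<le> 1 / real r"
    proof -
      have "1 / real N \<le> 1 / real r" using r by (intro divide_left_mono) auto
      thus ?thesis using rb unfolding \<beta>_def by linarith
    qed
    have Kc: "card (point_cluster {1..M} \<alpha> 1 1 W m' d' b') \<le> K"
      if "b' \<in> totatives d'" "d' \<in> sieve_moduli 1 1" for m' d' b'
    proof -
      define C where "C = (point_cluster {1..M} \<alpha> 1 1 W m' d' b')"
      have one: "d = 1 \<and> b = 1" if "b \<in> totatives d" "d \<in> sieve_moduli 1 1" for b d
        using that by (auto simp: sieve_moduli_def le_Suc_eq)
      have "C \<subseteq> (\<lambda>m. (m, 1, 1)) ` {m\<in>{1..M}. \<exists>k::int. \<bar>real m * \<alpha> - real m' * \<alpha> - of_int k\<bar> \<le> 1 / real W}"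
      proof
        fix z assume z: "z \<in> C"
        obtain m d b where mdb: "z = (m, d, b)" by (cases z) auto
        have mem: "m \<in> {1..M}" "d \<in> sieve_moduli 1 1" "b \<in> totatives d"
          and near: "\<exists>k::int. \<bar>(real m * \<alpha> + real b / real d) - (real m' * \<alpha> + real b' / real d') - of_int k\<bar> \<le> 1 / real W"
          using z unfolding mdb C_def by simp_all
        have "d = 1" "b = 1" "d' = 1" "b' = 1" using one[OF mem(3,2)] one[OF that] by simp_all
        thus "z \<in> (\<lambda>m. (m, 1, 1)) ` {m\<in>{1..M}. \<exists>k::int. \<bar>real m * \<alpha> - real m' * \<alpha> - of_int k\<bar> \<le> 1 / real W}"
          using mem(1) near unfolding mdb by simp
      qed
      hence "card C \<le> card {m\<in>{1..M}. \<exists>k::int. \<bar>real m * \<alpha> - real m' * \<alpha> - of_int k\<bar> \<le> 1 / real W}"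
        by (rule surj_card_le[rotated]) simp
      also have "real \<dots> \<le> K0" unfolding K0_def by (rule card_near_multiples_le[OF r(1,2) W beta])
      finally have "real (card C) \<le> K0" by simp
      thus ?thesis unfolding C_def K_def by linarith
    qed
    have "sieve_weight 1 1 * S \<le> 24 * real W * real K * (\<Sum>n\<in>A. cmod (a n) ^ 2)"
      unfolding S_def
    proof (rule sieved_large_sieve[OF _ W A _ Kc])
      fix n assume "n \<in> A"
      thus "prime n \<and> 1 < n" using primes prime_gt_1_nat by blast
    qed auto
    hence "S \<le> 24 * real W * real K * (\<Sum>n\<in>A. cmod (a n) ^ 2)" using sieve_weight_1_1 by simp
    also have "\<dots> \<le> 24 * real W * (160 * Z) * real (card A)"
    proof -
      have "real K \<le> 160 * Z" using K0 K0pos unfolding K_def by linarith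
      thus ?thesis using a2 by (intro mult_mono mult_left_mono) (auto intro: sum_nonneg simp: Z_def)
    qed
    also have "\<dots> = 3840 * U * (real Q ^ 4 / real W)" by (simp add: Z_def U_def)
    also have "\<dots> \<le> 4000 * U * (E + real Q ^ 4 / real W)"
      using U0 E0 by (intro mult_mono) auto
    finally show ?thesis unfolding S_def U_def E_def by (simp add: mult_ac)
  qed
qed

section \<open>Integers without large prime factors\<close>

lemma card_multiples_le:
  fixes d N :: nat
  assumes "d > 0"
  shows "card {n\<in>{1..N}. d dvd n} = N div d"
proof -
  have "{n\<in>{1..N}. d dvd n} = (\<lambda>k. d * k) ` {1..N div d}"
  proof (intro equalityI subsetI)
    fix n assume n: "n \<in> {n\<in>{1..N}. d dvd n}"
    then obtain k where k: "n = d * k" by auto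
    have "k \<le> N div d" using n k assms by (auto simp: less_eq_div_iff_mult_less_eq mult.commute)
    moreover have "k \<ge> 1" using n k by (cases k) auto
    ultimately show "n \<in> (\<lambda>k. d * k) ` {1..N div d}" using k by auto
  next
    fix n assume "n \<in> (\<lambda>k. d * k) ` {1..N div d}"
    then obtain k where "n = d * k" "k \<in> {1..N div d}" by blast
    hence k: "n = d * k" "1 \<le> k" "k \<le> N div d" by simp_all
    have "d * k \<le> d * (N div d)" using k by simp
    also have "\<dots> \<le> N" by simp
    finally show "n \<in> {n\<in>{1..N}. d dvd n}" using k assms by auto
  qed
  thus ?thesis using assms by (simp add: card_image inj_on_def)
qed

lemma real_card_multiples_le:
  fixes d N :: nat
  assumes "d > 0" "real N \<le> x"
  shows "real (card {n\<in>{1..N}. d dvd n}) \<le> x / real d"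
proof -
  have "real (d * (N div d)) \<le> real N" using times_div_less_eq_dividend of_nat_le_iff by blast
  hence "real (N div d) * real d \<le> x" using assms by (simp add: mult.commute)
  thus ?thesis using assms by (simp only: card_multiples_le pos_le_divide_eq of_nat_0_less_iff)
qed

lemma sum_if_one_zero:
  "finite A \<Longrightarrow> (\<Sum>d\<in>A. if P d then 1 else 0 :: real) = real (card {d\<in>A. P d})"
proof -
  assume "finite A"
  hence "(\<Sum>d\<in>A. if P d then 1 else 0 :: real) = (\<Sum>d\<in>{d\<in>A. P d}. 1)" by (rule sum.inter_filter[symmetric])
  thus ?thesis by simp
qed

lemma harm_le_ln_plus_one: "N > 0 \<Longrightarrow> harm N \<le> ln (real N) + (1::real)"
proof (induction N rule: nat_induct_non_zero)
  case (Suc n)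
  have "ln (real n / real (Suc n)) \<le> real n / real (Suc n) - 1"
    using Suc by (intro ln_le_minus_one) auto
  also have "real n / real (Suc n) - 1 = - inverse (real (Suc n))" by (simp add: field_simps)
  finally have "inverse (real (Suc n)) \<le> ln (real (Suc n)) - ln (real n)"
    using Suc by (simp add: ln_div)
  thus ?case using Suc by (simp add: harm_Suc)
qed (simp add: harm_def)

text \<open>Distinct sets of prime factors have distinct products.\<close>

lemma two_power_card_prime_factors_le_card_divisors:
  fixes n :: nat
  assumes "n > 0"
  shows "2 ^ card (prime_factors n) \<le> card {d. d dvd n}"
proof -
  have "inj_on (\<lambda>X. \<Prod>X) (Pow (prime_factors n))"
  proof (rule inj_onI)
    fix X Y assume XY: "X \<in> Pow (prime_factors n)" "Y \<in> Pow (prime_factors n)" "\<Prod>X = \<Prod>Y"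
    have *: "Z = {p. prime p \<and> p dvd \<Prod>Z}" if "Z \<in> Pow (prime_factors n)" for Z :: "nat set"
    proof -
      have fin: "finite Z" using that finite_subset by auto
      have pr: "prime p" if "p \<in> Z" for p using that \<open>Z \<in> _\<close> by auto
      show ?thesis
      proof (intro equalityI subsetI)
        fix p assume "p \<in> Z"
        thus "p \<in> {p. prime p \<and> p dvd \<Prod>Z}" using pr fin by auto
      next
        fix p assume p: "p \<in> {p. prime p \<and> p dvd \<Prod>Z}"
        then obtain q where "q \<in> Z" "p dvd q" using fin prime_dvd_prod_iff[of Z p "\<lambda>x. x"] by auto
        thus "p \<in> Z" using p pr primes_dvd_imp_eq by blast
      qed
    qed
    show "X = Y" using *[OF XY(1)] *[OF XY(2)] XY(3) by simp
  qed
  hence "card ((\<lambda>X. \<Prod>X) ` Pow (prime_factors n)) = 2 ^ card (prime_factors n)"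
    by (simp add: card_image card_Pow)
  moreover have "(\<lambda>X. \<Prod>X) ` Pow (prime_factors n) \<subseteq> {d. d dvd n}"
  proof clarify
    fix X assume "X \<subseteq> prime_factors n"
    hence "\<Prod>X dvd \<Prod>(prime_factors n)" by (intro prod_dvd_prod_subset) auto
    also have "\<Prod>(prime_factors n) dvd (\<Prod>p\<in>prime_factors n. p ^ multiplicity p n)"
      by (intro prod_dvd_prod) (auto intro!: dvd_power simp: prime_factors_multiplicity)
    also have "\<dots> = n" using prime_factorization_nat[OF assms] ..
    finally show "\<Prod>X dvd n" .
  qed
  moreover have "finite {d. d dvd n}" using assms by simp
  ultimately show ?thesis by (metis card_mono)
qed

text \<open>A number with at least \<open>V\<close> prime factors has at least \<open>2 ^ V\<close> divisors, while the average number of divisors is logarithmic.\<close>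

lemma card_many_prime_factors_le:
  fixes N V :: nat
  assumes "N > 0"
  shows "2 ^ V * real (card {n\<in>{1..N}. V \<le> card (prime_factors n)}) \<le> real N * (ln (real N) + 1)"
proof -
  define C where "C = {n\<in>{1..N}. V \<le> card (prime_factors n)}"
  have "2 ^ V * real (card C) = (\<Sum>n\<in>C. 2 ^ V)" by simp
  also have "\<dots> \<le> (\<Sum>n\<in>C. real (card {d. d dvd n}))"
  proof (intro sum_mono)
    fix n assume n: "n \<in> C"
    have "(2::nat) ^ V \<le> 2 ^ card (prime_factors n)" using n by (intro power_increasing) (auto simp: C_def)
    also have "\<dots> \<le> card {d. d dvd n}" using n by (intro two_power_card_prime_factors_le_card_divisors) (auto simp: C_def)
    finally have "real (2 ^ V) \<le> real (card {d. d dvd n})" using of_nat_le_iff by blast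
    thus "2 ^ V \<le> real (card {d. d dvd n})" by simp
  qed
  also have "\<dots> \<le> (\<Sum>n\<in>{1..N}. real (card {d. d dvd n}))" by (intro sum_mono2) (auto simp: C_def)
  also have "\<dots> = (\<Sum>n\<in>{1..N}. \<Sum>d\<in>{1..N}. if d dvd n then 1 else 0)"
  proof (intro sum.cong refl)
    fix n assume n: "n \<in> {1..N}"
    have "{d. d dvd n} = {d\<in>{1..N}. d dvd n}" using n by (auto dest: dvd_imp_le intro: Nat.gr0I simp: Suc_le_eq)
    thus "real (card {d. d dvd n}) = (\<Sum>d\<in>{1..N}. if d dvd n then 1 else 0)"
      by (simp only: sum_if_one_zero finite_atLeastAtMost)
  qed
  also have "\<dots> = (\<Sum>d\<in>{1..N}. \<Sum>n\<in>{1..N}. if d dvd n then 1 else 0)" by (rule sum.swap)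
  also have "\<dots> = (\<Sum>d\<in>{1..N}. real (card {n\<in>{1..N}. d dvd n}))"
    by (simp only: sum_if_one_zero finite_atLeastAtMost)
  also have "\<dots> \<le> (\<Sum>d\<in>{1..N}. real N / real d)"
    by (intro sum_mono real_card_multiples_le) auto
  also have "\<dots> = real N * harm N" by (simp add: harm_def sum_distrib_left divide_inverse)
  also have "\<dots> \<le> real N * (ln (real N) + 1)" using assms by (intro mult_left_mono harm_le_ln_plus_one) auto
  finally show ?thesis unfolding C_def .
qed

text \<open>A \<open>y\<close>-smooth number above \<open>X \<ge> B ^ V\<close> with fewer than \<open>V\<close> prime factors is divisible by a prime power \<open>p ^ e \<ge> B\<close>
  with \<open>p \<le> y\<close>; for each \<open>p\<close> the least such power has at most \<open>x / B\<close> multiples.  This elementary bound suffices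
  because \<open>ln y\<close> will be smaller than \<open>ln x\<close> by more than a power of \<open>ln (ln x)\<close>.\<close>

lemma card_smooth_le:
  fixes x y X B :: real and V N :: nat
  assumes N: "N > 0" "real N \<le> x" and B: "B \<ge> 1" "B ^ V \<le> X" and y: "y \<ge> 0"
  shows "real (card {n\<in>{1..N}. \<forall>p. prime p \<longrightarrow> p dvd n \<longrightarrow> real p \<le> y})
     \<le> X + x * (ln x + 1) / 2 ^ V + y * x / B"
proof -
  define S where "S = {n\<in>{1..N}. \<forall>p. prime p \<longrightarrow> p dvd n \<longrightarrow> real p \<le> y}"
  define A1 where "A1 = {n\<in>{1..N}. real n \<le> X}"
  define A2 where "A2 = {n\<in>{1..N}. V \<le> card (prime_factors n)}"
  define ex where "ex = (\<lambda>p. LEAST e. B \<le> real p ^ e)"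
  define pr where "pr = {p. prime p \<and> real p \<le> y}"
  define A3 where "A3 = (\<Union>p\<in>pr. {n\<in>{1..N}. p ^ ex p dvd n})"
  have exB: "B \<le> real p ^ ex p" if "prime p" for p
  proof -
    have "real p > 1" using that prime_gt_1_nat by simp
    then obtain e where "B \<le> real p ^ e" using real_arch_pow less_imp_le by metis
    thus ?thesis unfolding ex_def by (rule LeastI)
  qed
  have finpr: "finite pr" by (rule finite_subset[of _ "{..nat \<lfloor>y\<rfloor>}"]) (auto simp: pr_def le_nat_floor)
  have cardpr: "real (card pr) \<le> y"
  proof -
    have "pr \<subseteq> {1..nat \<lfloor>y\<rfloor>}" using prime_gt_0_nat by (auto simp: pr_def le_nat_floor Suc_le_eq)
    hence "card pr \<le> card {1..nat \<lfloor>y\<rfloor>}" by (intro card_mono) auto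
    thus ?thesis using y by simp linarith
  qed
  have sub: "S \<subseteq> A1 \<union> A2 \<union> A3"
  proof
    fix n assume n: "n \<in> S"
    show "n \<in> A1 \<union> A2 \<union> A3"
    proof (cases "\<exists>p\<in>prime_factors n. B \<le> real p ^ multiplicity p n")
      case True
      then obtain p where p: "p \<in> prime_factors n" "B \<le> real p ^ multiplicity p n" by blast
      have pp: "prime p" "p dvd n" using p(1) by auto
      have "ex p \<le> multiplicity p n" unfolding ex_def using p(2) by (rule Least_le)
      hence "p ^ ex p dvd p ^ multiplicity p n" by (rule le_imp_power_dvd)
      also have "\<dots> dvd n" by (rule multiplicity_dvd)
      finally have "n \<in> A3" using n pp unfolding A3_def S_def pr_def by auto
      thus ?thesis by simp
    next
      case False
      have n0: "n > 0" using n by (auto simp: S_def)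
      have "real n = (\<Prod>p\<in>prime_factors n. real p ^ multiplicity p n)"
        by (subst prime_factorization_nat[OF n0]) simp
      also have "\<dots> \<le> (\<Prod>p\<in>prime_factors n. B)"
        using False by (intro prod_mono) (auto simp: not_le intro: less_imp_le)
      also have "\<dots> = B ^ card (prime_factors n)" by simp
      finally have nB: "real n \<le> B ^ card (prime_factors n)" .
      show ?thesis
      proof (cases "V \<le> card (prime_factors n)")
        case True
        thus ?thesis using n by (simp add: A2_def S_def)
      next
        case False
        hence "B ^ card (prime_factors n) \<le> B ^ V" using B by (intro power_increasing) auto
        hence "real n \<le> X" using nB B by linarith
        thus ?thesis using n by (simp add: A1_def S_def)
      qed
    qed
  qed
  have x0: "x > 0" using N by linarith
  have X0: "X \<ge> 0" using B by (meson order_trans zero_le_one zero_le_power)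
  have c1: "real (card A1) \<le> X"
  proof -
    have "A1 \<subseteq> {1..nat \<lfloor>X\<rfloor>}" by (auto simp: A1_def le_nat_floor)
    hence "card A1 \<le> card {1..nat \<lfloor>X\<rfloor>}" by (intro card_mono) auto
    thus ?thesis using X0 by simp linarith
  qed
  have c2: "real (card A2) \<le> x * (ln x + 1) / 2 ^ V"
  proof -
    have "2 ^ V * real (card A2) \<le> real N * (ln (real N) + 1)" unfolding A2_def by (rule card_many_prime_factors_le[OF N(1)])
    also have "\<dots> \<le> x * (ln x + 1)" using N by (intro mult_mono add_right_mono) auto
    finally show ?thesis by (simp add: field_simps)
  qed
  have c3: "real (card A3) \<le> y * x / B"
  proof -
    have "card A3 \<le> (\<Sum>p\<in>pr. card {n\<in>{1..N}. p ^ ex p dvd n})" unfolding A3_def by (rule card_UN_le[OF finpr])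
    hence "real (card A3) \<le> (\<Sum>p\<in>pr. real (card {n\<in>{1..N}. p ^ ex p dvd n}))" by (metis of_nat_le_iff of_nat_sum)
    also have "\<dots> \<le> (\<Sum>p\<in>pr. x / B)"
    proof (intro sum_mono)
      fix p assume p: "p \<in> pr"
      hence pp: "prime p" by (simp add: pr_def)
      have p0: "p ^ ex p > 0" using prime_gt_0_nat[OF pp] by simp
      have "real (card {n\<in>{1..N}. p ^ ex p dvd n}) \<le> x / real (p ^ ex p)"
        by (rule real_card_multiples_le[OF p0 N(2)])
      also have "\<dots> \<le> x / B" using exB[OF pp] B x0 by (intro frac_le) auto
      finally show "real (card {n\<in>{1..N}. p ^ ex p dvd n}) \<le> x / B" .
    qed
    also have "\<dots> = real (card pr) * (x / B)" by simp
    also have "\<dots> \<le> y * (x / B)" using cardpr x0 B by (intro mult_right_mono) auto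
    finally show ?thesis by simp
  qed
  have fins: "finite (A1 \<union> A2 \<union> A3)" using finpr by (auto simp: A1_def A2_def A3_def)
  have "card S \<le> card (A1 \<union> A2 \<union> A3)" by (rule card_mono[OF fins sub])
  also have "\<dots> \<le> card A1 + card A2 + card A3" using card_Un_le[of A1 A2] card_Un_le[of "A1 \<union> A2" A3] by linarith
  finally have "real (card S) \<le> real (card A1) + real (card A2) + real (card A3)" by (simp flip: of_nat_add)
  thus ?thesis using c1 c2 c3 unfolding S_def by linarith
qed

section \<open>Sorting integers by their largest prime factor\<close>

definition prime_block :: "(nat \<Rightarrow> real) \<Rightarrow> nat \<Rightarrow> nat set" where
  "prime_block P j = {p. prime p \<and> P j < real p \<and> real p \<le> P (Suc j)}"

lemma finite_prime_block [simp]: "finite (prime_block P j)"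
proof (rule finite_subset)
  show "prime_block P j \<subseteq> {..nat \<lfloor>P (Suc j)\<rfloor>}" by (auto simp: prime_block_def le_nat_floor)
qed simp

lemma prime_factorization_by_largest_inj:
  fixes m p m' p' :: nat
  assumes "m * p = m' * p'" "prime p" "prime p'" "m \<ge> 1"
    and lt: "\<And>q. prime q \<Longrightarrow> q dvd m \<Longrightarrow> q < p" "\<And>q. prime q \<Longrightarrow> q dvd m' \<Longrightarrow> q < p'"
  shows "m = m' \<and> p = p'"
proof -
  have "p dvd m' * p'" using assms(1) by (metis dvd_triv_right)
  hence "p dvd m' \<or> p dvd p'" using assms(2) prime_dvd_mult_iff by blast
  hence 1: "p < p' \<or> p = p'" using lt(2) assms(2,3) primes_dvd_imp_eq by blast
  have "p' dvd m * p" using assms(1) by (metis dvd_triv_right)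
  hence "p' dvd m \<or> p' dvd p" using assms(3) prime_dvd_mult_iff by blast
  hence "p' < p \<or> p = p'" using lt(1) assms(2,3) primes_dvd_imp_eq by blast
  hence pp: "p = p'" using 1 by auto
  thus ?thesis using assms(1,2) prime_gt_0_nat by auto
qed

text \<open>Let \<open>p\<close> be the largest prime factor of \<open>n = m p\<close>.  The terms with \<open>k m * p > x\<close> form the first sum; they have \<open>m < H\<close>
  and \<open>p > H\<close>.  For the others let \<open>j\<close> be the block of \<open>p\<close>.  If all prime factors of \<open>m\<close> are at most \<open>P j\<close> and
  \<open>k m * P (Suc j) \<le> x\<close>, then \<open>(m, p)\<close> may vary independently over a product set, which gives the second sum.
  The three counts collect the exceptions: \<open>n\<close> smooth, \<open>m\<close> with a prime factor in the block of \<open>p\<close>, and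
  \<open>k m\<close> between \<open>x / P (Suc j)\<close> and \<open>x / P j\<close>.  The function \<open>k\<close> sets the boundary between the two main sums; it is left
  open so that it can be chosen to make the first sum split into complete dyadic intervals.\<close>

lemma exp_sum_decomposition:
  fixes f :: "nat \<Rightarrow> complex" and x \<alpha> :: real and P :: "nat \<Rightarrow> real" and k :: "nat \<Rightarrow> nat" and H J :: nat
  assumes f: "multiplicative_fun f" "unit_disc_valued f"
    and P: "incseq P" "P 0 \<ge> 1" "x \<le> P J"
    and H: "H \<ge> 1" "2 * real H ^ 2 \<le> x"
    and k: "\<And>m. m \<ge> 1 \<Longrightarrow> H \<le> k m" "\<And>m. m \<le> k m" "\<And>m. m \<ge> H \<Longrightarrow> k m = m" "\<And>m. 1 \<le> m \<Longrightarrow> m < H \<Longrightarrow> k m < 2 * H"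
  defines "N \<equiv> nat \<lfloor>x\<rfloor>"
  defines "N0 \<equiv> {n\<in>{1..N}. \<forall>p. prime p \<longrightarrow> p dvd n \<longrightarrow> real p \<le> P 0}"
  defines "N1 \<equiv> {n\<in>{1..N}. \<exists>j<J. \<exists>p\<in>prime_block P j. \<exists>p'\<in>prime_block P j. p * p' dvd n}"
  defines "N2 \<equiv> {n\<in>{1..N}. \<exists>j<J. \<exists>p\<in>prime_block P j. \<exists>m\<ge>1. n = m * p \<and> real (k m) * P j < x \<and> x < real (k m) * P (Suc j)}"
  shows "cmod (exp_sum f \<alpha> x) \<le>
     (\<Sum>m\<in>{1..<H}. cmod (twisted_sum {p. prime p \<and> x < real (k m) * real p \<and> real m * real p \<le> x} f (real m * \<alpha>)))
   + (\<Sum>j | j < J \<and> real H * P (Suc j) \<le> x. \<Sum>m\<in>{1..nat \<lfloor>x / P (Suc j)\<rfloor>}.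
        cmod (twisted_sum (prime_block P j) f (real m * \<alpha>)))
   + real (card N0) + real (card N1) + real (card N2)"
proof -
  have Pge: "P j \<ge> 1" for j using P(1,2) incseqD[OF P(1), of 0 j] by linarith
  have Ppos: "P j > 0" for j using Pge[of j] by linarith
  have x1: "x \<ge> 2"
  proof -
    have "1 \<le> real H ^ 2" using H(1) by simp
    thus ?thesis using H(2) by linarith
  qed
  have Nx: "n \<in> {1..N} \<longleftrightarrow> 1 \<le> n \<and> real n \<le> x" for n
    using x1 by (auto simp: N_def le_nat_floor) linarith
  define F where "F = (\<lambda>n. f n * add_char (real n * \<alpha>))"
  have f1: "cmod (f n) \<le> 1" if "n \<ge> 1" for n using f(2) that by (auto simp: unit_disc_valued_def)
  have fm: "f (m * p) = f m * f p" if "m \<ge> 1" "p \<ge> 1" "coprime m p" for m p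
    using f(1) that by (auto simp: multiplicative_fun_def)
  have SF: "exp_sum f \<alpha> x = (\<Sum>n\<in>{1..N}. F n)"
  proof -
    have "{n. 1 \<le> n \<and> real n \<le> x} = {1..N}" using Nx by blast
    thus ?thesis by (simp only: exp_sum_def F_def)
  qed
  define Pr where "Pr = (\<lambda>m. {p. prime p \<and> x < real (k m) * real p \<and> real m * real p \<le> x})"
  define G where "G = (\<lambda>j. {m. m \<ge> 1 \<and> (\<forall>q. prime q \<longrightarrow> q dvd m \<longrightarrow> real q \<le> P j) \<and> real (k m) * P (Suc j) \<le> x})"
  define T1 where "T1 = Sigma {1..<H} Pr"
  define T2 where "T2 = (\<Union>j\<in>{..<J}. G j \<times> prime_block P j)"
  define \<mu> where "\<mu> = (\<lambda>(m::nat, p::nat). m * p)"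
  have finPr: "finite (Pr m)" if "m \<ge> 1" for m
  proof (rule finite_subset)
    show "Pr m \<subseteq> {1..N}"
    proof
      fix p assume p: "p \<in> Pr m"
      have "1 * real p \<le> real m * real p" using that by (intro mult_right_mono) auto
      hence "real p \<le> x" using p by (simp add: Pr_def)
      moreover have "p \<ge> 1" using p prime_gt_0_nat[of p] by (simp add: Pr_def)
      ultimately show "p \<in> {1..N}" unfolding Nx by simp
    qed
  qed simp
  have finT1: "finite T1" unfolding T1_def using finPr by (intro finite_SigmaI) auto
  have Gsub: "G j \<subseteq> {1..nat \<lfloor>x / P (Suc j)\<rfloor>}" for j
  proof
    fix m assume m: "m \<in> G j"
    have "real m * P (Suc j) \<le> real (k m) * P (Suc j)" using k(2)[of m] Ppos[of "Suc j"] by (intro mult_right_mono) auto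
    also have "\<dots> \<le> x" using m by (simp add: G_def)
    finally have "real m \<le> x / P (Suc j)" using Ppos[of "Suc j"] by (simp add: pos_le_divide_eq)
    thus "m \<in> {1..nat \<lfloor>x / P (Suc j)\<rfloor>}" using m by (simp add: G_def le_nat_floor)
  qed
  have finG: "finite (G j)" for j using Gsub finite_subset by blast
  have Gempty: "G j = {}" if "\<not> real H * P (Suc j) \<le> x" for j
  proof (rule ccontr)
    assume "G j \<noteq> {}"
    then obtain m where m: "m \<in> G j" by auto
    have "real H * P (Suc j) \<le> real (k m) * P (Suc j)"
      using k(1)[of m] m Ppos[of "Suc j"] by (intro mult_right_mono) (auto simp: G_def)
    thus False using m that by (simp add: G_def)
  qed
  have finT2: "finite T2" unfolding T2_def using finG by auto
  have T1D: "1 \<le> m \<and> m < H \<and> prime p \<and> x < real (k m) * real p \<and> real m * real p \<le> x \<and> (\<forall>q. prime q \<longrightarrow> q dvd m \<longrightarrow> q < p)"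
    if "(m, p) \<in> T1" for m p
  proof -
    have mp: "1 \<le> m" "m < H" "prime p" "x < real (k m) * real p" "real m * real p \<le> x"
      using that by (auto simp: T1_def Pr_def)
    have "2 * real H ^ 2 < real (k m) * real p" using mp H by linarith
    also have "\<dots> \<le> 2 * real H * real p" using k(4)[OF mp(1,2)] by (intro mult_right_mono) auto
    finally have "real H * real H < real H * real p" by (simp add: power2_eq_square)
    hence Hp: "H < p" using H by simp
    have "q < p" if "q dvd m" for q using dvd_imp_le[OF that] mp Hp by linarith
    thus ?thesis using mp by blast
  qed
  have T2D: "1 \<le> m \<and> prime p \<and> real (k m) * real p \<le> x \<and> real m * real p \<le> x \<and> (\<forall>q. prime q \<longrightarrow> q dvd m \<longrightarrow> q < p)"
    if mp: "(m, p) \<in> T2" for m p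
  proof -
    from mp obtain j where j: "j < J" "m \<in> G j" "p \<in> prime_block P j" by (auto simp: T2_def)
    have "real (k m) * real p \<le> real (k m) * P (Suc j)" using j by (intro mult_left_mono) (auto simp: prime_block_def)
    also have "\<dots> \<le> x" using j by (simp add: G_def)
    finally have 1: "real (k m) * real p \<le> x" .
    have "real m * real p \<le> real (k m) * real p" using k(2)[of m] by (intro mult_right_mono) auto
    hence 2: "real m * real p \<le> x" using 1 by linarith
    have 3: "q < p" if "prime q" "q dvd m" for q
    proof -
      have "real q \<le> P j" using j(2) that by (simp add: G_def)
      also have "\<dots> < real p" using j(3) by (simp add: prime_block_def)
      finally show ?thesis by simp
    qed
    show ?thesis using j 1 2 3 by (auto simp: G_def prime_block_def)
  qed
  have disj: "T1 \<inter> T2 = {}"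
  proof -
    have False if "(m, p) \<in> T1" "(m, p) \<in> T2" for m p using T1D[OF that(1)] T2D[OF that(2)] by linarith
    thus ?thesis by auto
  qed
  have TD: "1 \<le> m \<and> prime p \<and> real m * real p \<le> x \<and> (\<forall>q. prime q \<longrightarrow> q dvd m \<longrightarrow> q < p)" if "(m, p) \<in> T1 \<union> T2" for m p
    using that T1D T2D by blast
  have inj: "inj_on \<mu> (T1 \<union> T2)"
  proof (rule inj_onI)
    fix u v assume uv: "u \<in> T1 \<union> T2" "v \<in> T1 \<union> T2" "\<mu> u = \<mu> v"
    obtain m p where u: "u = (m, p)" by (cases u) auto
    obtain m' p' where v: "v = (m', p')" by (cases v) auto
    have "m = m' \<and> p = p'"
      by (rule prime_factorization_by_largest_inj) (use uv TD[of m p] TD[of m' p'] in \<open>auto simp: u v \<mu>_def\<close>)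
    thus "u = v" using u v by simp
  qed
  have Fmp: "F (\<mu> (m, p)) = f m * (f p * add_char (real p * (real m * \<alpha>)))" if "(m, p) \<in> T1 \<union> T2" for m p
  proof -
    have mp: "1 \<le> m" "prime p" "\<And>q. prime q \<Longrightarrow> q dvd m \<Longrightarrow> q < p" using TD[OF that] by auto
    have "\<not> p dvd m" using mp(2,3) by blast
    hence "coprime m p" using mp(2) prime_imp_coprime coprime_commute by blast
    hence "f (m * p) = f m * f p" using mp prime_gt_0_nat by (intro fm) (auto simp: Suc_le_eq)
    thus ?thesis by (simp add: F_def \<mu>_def mult_ac)
  qed
  have musub: "\<mu> ` (T1 \<union> T2) \<subseteq> {1..N}"
  proof clarify
    fix m p assume "(m, p) \<in> T1 \<union> T2"
    from TD[OF this] have mp: "1 \<le> m" "prime p" "real m * real p \<le> x" by auto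
    have "m * p \<ge> 1" using mp(1) prime_gt_0_nat[OF mp(2)] by (simp add: Suc_le_eq)
    thus "\<mu> (m, p) \<in> {1..N}" unfolding Nx \<mu>_def using mp(3) by simp
  qed
  have cover: "{1..N} - \<mu> ` (T1 \<union> T2) \<subseteq> N0 \<union> N1 \<union> N2"
  proof
    fix n assume "n \<in> {1..N} - \<mu> ` (T1 \<union> T2)"
    hence n: "n \<in> {1..N}" "n \<notin> \<mu> ` (T1 \<union> T2)" by auto
    show "n \<in> N0 \<union> N1 \<union> N2"
    proof (cases "n \<in> N0")
      case False
      then obtain q where q: "prime q" "q dvd n" "real q > P 0" using n by (auto simp: N0_def not_le)
      have n0: "n > 0" "real n \<le> x" using n(1) Nx by auto
      \<comment> \<open>The largest prime factor decides into which of the five sets \<open>n\<close> falls.\<close>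
      define p where "p = Max (prime_factors n)"
      have qin: "q \<in> prime_factors n" using q n0 by (simp add: prime_factors_dvd)
      have "p \<in> prime_factors n" unfolding p_def using qin by (intro Max_in) auto
      hence p: "prime p" "p dvd n" by auto
      have pmax: "r \<le> p" if "prime r" "r dvd n" for r
        unfolding p_def using that n0 by (intro Max_ge) (auto simp: prime_factors_dvd)
      have pP0: "real p > P 0" using pmax[OF q(1,2)] q(3) by linarith
      have "p \<le> n" using p n0 dvd_imp_le by blast
      hence px: "real p \<le> P J" using n0 P(3) by linarith
      define i where "i = (LEAST i. real p \<le> P i)"
      have i1: "real p \<le> P i" unfolding i_def by (rule LeastI[of "\<lambda>i. real p \<le> P i", OF px])
      have i2: "i \<le> J" unfolding i_def by (rule Least_le) (rule px)
      have "i \<noteq> 0" using i1 pP0 by (metis not_le)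
      then obtain j where j: "i = Suc j" using not0_implies_Suc by blast
      have "\<not> real p \<le> P j" using not_less_Least[of j "\<lambda>i. real p \<le> P i"] j unfolding i_def by auto
      hence pj: "p \<in> prime_block P j" "j < J" using p i1 i2 j by (auto simp: prime_block_def)
      obtain m where m: "n = m * p" using p(2) by (metis dvd_def mult.commute)
      have m1: "m \<ge> 1" using n0 m by (cases m) auto
      show ?thesis
      proof (cases "\<exists>r. prime r \<and> r dvd m \<and> real r > P j")
        case True
        then obtain r where r: "prime r" "r dvd m" "real r > P j" by auto
        have "r \<le> p" using pmax[of r] r m by auto
        hence "r \<in> prime_block P j" using r pj by (auto simp: prime_block_def)
        moreover have "r * p dvd n" unfolding m using r(2) by (rule mult_dvd_mono) simp
        ultimately have "n \<in> N1" using n(1) pj unfolding N1_def by blast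
        thus ?thesis by simp
      next
        case False
        hence sm: "\<forall>q. prime q \<longrightarrow> q dvd m \<longrightarrow> real q \<le> P j" by (auto simp: not_less)
        have mpx: "real m * real p \<le> x" using n0 m by simp
        have kp: "real (k m) * real p \<le> x"
        proof (rule ccontr)
          assume a: "\<not> real (k m) * real p \<le> x"
          hence "m < H" using k(3)[of m] mpx by (metis not_le)
          hence "(m, p) \<in> T1" using a m1 p mpx by (auto simp: T1_def Pr_def)
          hence "\<mu> (m, p) \<in> \<mu> ` (T1 \<union> T2)" by blast
          thus False using n(2) m by (simp add: \<mu>_def)
        qed
        have "\<not> real (k m) * P (Suc j) \<le> x"
        proof
          assume a: "real (k m) * P (Suc j) \<le> x"
          hence "(m, p) \<in> T2" using m1 sm pj by (auto simp: T2_def G_def)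
          hence "\<mu> (m, p) \<in> \<mu> ` (T1 \<union> T2)" by blast
          thus False using n(2) m by (simp add: \<mu>_def)
        qed
        moreover have "real (k m) * P j < x"
        proof -
          have "real (k m) > 0" using k(2)[of m] m1 by simp
          hence "real (k m) * P j < real (k m) * real p" using pj by (intro mult_strict_left_mono) (auto simp: prime_block_def)
          thus ?thesis using kp by linarith
        qed
        ultimately have "n \<in> N2" using n(1) pj m m1 unfolding N2_def by (auto simp: not_le)
        thus ?thesis by simp
      qed
    qed simp
  qed
  have F1: "cmod (F n) \<le> 1" if "n \<ge> 1" for n using f1[OF that] by (simp add: F_def norm_mult)
  have fin3: "finite N0" "finite N1" "finite N2" by (auto simp: N0_def N1_def N2_def)
  have rest: "cmod (\<Sum>n\<in>{1..N} - \<mu> ` (T1 \<union> T2). F n) \<le> real (card N0) + real (card N1) + real (card N2)"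
  proof -
    have "cmod (\<Sum>n\<in>{1..N} - \<mu> ` (T1 \<union> T2). F n) \<le> (\<Sum>n\<in>{1..N} - \<mu> ` (T1 \<union> T2). 1)"
      by (rule order_trans[OF norm_sum]) (intro sum_mono F1, auto)
    also have "\<dots> = real (card ({1..N} - \<mu> ` (T1 \<union> T2)))" by simp
    also have "\<dots> \<le> real (card (N0 \<union> N1 \<union> N2))"
      using cover fin3 by (intro of_nat_mono card_mono) auto
    also have "card (N0 \<union> N1 \<union> N2) \<le> card N0 + card N1 + card N2"
      using card_Un_le[of N0 N1] card_Un_le[of "N0 \<union> N1" N2] by linarith
    finally show ?thesis by simp
  qed
  have S1: "cmod (\<Sum>t\<in>T1. F (\<mu> t)) \<le> (\<Sum>m\<in>{1..<H}. cmod (twisted_sum (Pr m) f (real m * \<alpha>)))"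
  proof -
    have "(\<Sum>t\<in>T1. F (\<mu> t)) = (\<Sum>m\<in>{1..<H}. \<Sum>p\<in>Pr m. F (\<mu> (m, p)))"
      unfolding T1_def using finPr by (subst sum.Sigma) auto
    also have "\<dots> = (\<Sum>m\<in>{1..<H}. f m * (twisted_sum (Pr m) f (real m * \<alpha>)))"
      unfolding sum_distrib_left by (intro sum.cong refl Fmp) (auto simp: T1_def)
    also have "cmod \<dots> \<le> (\<Sum>m\<in>{1..<H}. cmod (f m * (twisted_sum (Pr m) f (real m * \<alpha>))))"
      by (rule norm_sum)
    also have "\<dots> \<le> (\<Sum>m\<in>{1..<H}. cmod (twisted_sum (Pr m) f (real m * \<alpha>)))"
      using f1 by (intro sum_mono) (auto simp: norm_mult intro: mult_left_le_one_le)
    finally show ?thesis .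
  qed
  have S2: "cmod (\<Sum>t\<in>T2. F (\<mu> t)) \<le> (\<Sum>j | j < J \<and> real H * P (Suc j) \<le> x. \<Sum>m\<in>{1..nat \<lfloor>x / P (Suc j)\<rfloor>}.
        cmod (twisted_sum (prime_block P j) f (real m * \<alpha>)))"
  proof -
    have dj: "prime_block P i \<inter> prime_block P j = {}" if "i < j" for i j
      using incseqD[OF P(1), of "Suc i" j] that by (auto simp: prime_block_def)
    have dj': "prime_block P i \<inter> prime_block P j = {}" if "i \<noteq> j" for i j
      using dj[of i j] dj[of j i] that by (cases "i < j") auto
    have "(\<Sum>t\<in>T2. F (\<mu> t)) = (\<Sum>j\<in>{..<J}. \<Sum>t\<in>G j \<times> prime_block P j. F (\<mu> t))"
      unfolding T2_def
    proof (rule sum.UNION_disjoint)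
      show "\<forall>i\<in>{..<J}. \<forall>j\<in>{..<J}. i \<noteq> j \<longrightarrow> G i \<times> prime_block P i \<inter> G j \<times> prime_block P j = {}"
      proof (intro ballI impI)
        fix i j :: nat assume "i \<noteq> j"
        from dj'[OF this] show "G i \<times> prime_block P i \<inter> G j \<times> prime_block P j = {}" by blast
      qed
    qed (use finG in auto)
    also have "\<dots> = (\<Sum>j\<in>{..<J}. \<Sum>m\<in>G j. f m * (twisted_sum (prime_block P j) f (real m * \<alpha>)))"
    proof (rule sum.cong[OF refl])
      fix j assume j: "j \<in> {..<J}"
      have "(\<Sum>t\<in>G j \<times> prime_block P j. F (\<mu> t)) = (\<Sum>m\<in>G j. \<Sum>p\<in>prime_block P j. F (\<mu> (m, p)))"
        by (simp add: sum.cartesian_product)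
      also have "\<dots> = (\<Sum>m\<in>G j. f m * (twisted_sum (prime_block P j) f (real m * \<alpha>)))"
        unfolding sum_distrib_left by (intro sum.cong refl Fmp) (use j in \<open>auto simp: T2_def\<close>)
      finally show "(\<Sum>t\<in>G j \<times> prime_block P j. F (\<mu> t)) = (\<Sum>m\<in>G j. f m * (twisted_sum (prime_block P j) f (real m * \<alpha>)))" .
    qed
    also have "cmod \<dots> \<le> (\<Sum>j\<in>{..<J}. \<Sum>m\<in>G j. cmod (f m * (twisted_sum (prime_block P j) f (real m * \<alpha>))))"
      by (rule order_trans[OF norm_sum]) (intro sum_mono norm_sum)
    also have "\<dots> \<le> (\<Sum>j\<in>{..<J}. \<Sum>m\<in>G j. cmod (twisted_sum (prime_block P j) f (real m * \<alpha>)))"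
      using f1 by (intro sum_mono) (auto simp: norm_mult G_def intro: mult_left_le_one_le)
    also have "\<dots> = (\<Sum>j | j < J \<and> real H * P (Suc j) \<le> x. \<Sum>m\<in>G j. cmod (twisted_sum (prime_block P j) f (real m * \<alpha>)))"
      using Gempty by (intro sum.mono_neutral_right) auto
    also have "\<dots> \<le> (\<Sum>j | j < J \<and> real H * P (Suc j) \<le> x. \<Sum>m\<in>{1..nat \<lfloor>x / P (Suc j)\<rfloor>}.
        cmod (twisted_sum (prime_block P j) f (real m * \<alpha>)))"
      using Gsub by (intro sum_mono sum_mono2) auto
    finally show ?thesis .
  qed
  have "exp_sum f \<alpha> x = (\<Sum>n\<in>{1..N} - \<mu> ` (T1 \<union> T2). F n) + (\<Sum>n\<in>\<mu> ` (T1 \<union> T2). F n)"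
    unfolding SF by (rule sum.subset_diff[OF musub]) simp
  also have "(\<Sum>n\<in>\<mu> ` (T1 \<union> T2). F n) = (\<Sum>t\<in>T1 \<union> T2. F (\<mu> t))"
    by (subst sum.reindex[OF inj]) simp
  also have "\<dots> = (\<Sum>t\<in>T1. F (\<mu> t)) + (\<Sum>t\<in>T2. F (\<mu> t))"
    by (rule sum.union_disjoint[OF finT1 finT2 disj])
  finally have "cmod (exp_sum f \<alpha> x) \<le> cmod (\<Sum>n\<in>{1..N} - \<mu> ` (T1 \<union> T2). F n) + (cmod (\<Sum>t\<in>T1. F (\<mu> t)) + cmod (\<Sum>t\<in>T2. F (\<mu> t)))"
    by (metis norm_triangle_mono norm_triangle_ineq order_refl)
  thus ?thesis using rest S1 S2 unfolding Pr_def by linarith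
qed

section \<open>Dyadic scales and the parameters of a block\<close>

definition dyadic_exponent :: "nat \<Rightarrow> nat \<Rightarrow> nat" where
  "dyadic_exponent H m = (LEAST i. H \<le> m * 2 ^ i)"

text \<open>The boundary \<open>p = x / dyadic_scale H m\<close> is \<open>x / m\<close> divided by a power of \<open>2\<close>, and within a factor \<open>2\<close> of
  \<open>x / H\<close> for \<open>m < H\<close>.  A boundary at \<open>x / H\<close> itself would leave incomplete dyadic intervals.\<close>

definition dyadic_scale :: "nat \<Rightarrow> nat \<Rightarrow> nat" where
  "dyadic_scale H m = m * 2 ^ dyadic_exponent H m"

lemma le_dyadic_scale: "m \<ge> 1 \<Longrightarrow> H \<le> dyadic_scale H m"
proof -
  assume m: "m \<ge> 1"
  have "H \<le> m * 2 ^ H" using m less_exp[of H] by (metis dual_order.trans less_imp_le mult.commute mult_le_mono2 nat_mult_1_right)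
  thus ?thesis unfolding dyadic_scale_def dyadic_exponent_def by (rule LeastI)
qed

lemma self_le_dyadic_scale: "m \<le> dyadic_scale H m"
  by (simp add: dyadic_scale_def)

lemma dyadic_exponent_eq_0: "H \<le> m \<Longrightarrow> dyadic_exponent H m = 0"
  unfolding dyadic_exponent_def by (intro Least_equality) auto

lemma dyadic_scale_eq_self: "H \<le> m \<Longrightarrow> dyadic_scale H m = m"
  by (simp add: dyadic_scale_def dyadic_exponent_eq_0)

lemma dyadic_scale_less:
  assumes "1 \<le> m" "m < H"
  shows "dyadic_scale H m < 2 * H"
proof -
  have "dyadic_exponent H m \<noteq> 0"
    using le_dyadic_scale[OF assms(1), of H] assms(2) by (auto simp: dyadic_scale_def intro!: Nat.gr0I)
  then obtain i where i: "dyadic_exponent H m = Suc i" using not0_implies_Suc by blast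
  have "\<not> H \<le> m * 2 ^ i" using not_less_Least[of i "\<lambda>i. H \<le> m * 2 ^ i"] i unfolding dyadic_exponent_def by auto
  thus ?thesis by (simp add: dyadic_scale_def i)
qed

lemma dyadic_exponent_le: "m \<ge> 1 \<Longrightarrow> dyadic_exponent (2 ^ I) m \<le> I"
  unfolding dyadic_exponent_def by (intro Least_le) simp

lemma card_nat_open_interval_le:
  fixes u v :: real
  assumes "0 \<le> u" "u \<le> v"
  shows "finite {m::nat. u < real m \<and> real m < v}" "real (card {m::nat. u < real m \<and> real m < v}) \<le> v - u + 1"
proof -
  have sub: "{m::nat. u < real m \<and> real m < v} \<subseteq> {nat \<lfloor>u\<rfloor><..nat \<lfloor>v\<rfloor>}"
    using assms by (auto simp: le_nat_floor) linarith
  thus "finite {m::nat. u < real m \<and> real m < v}" using finite_subset by blast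
  have "card {m::nat. u < real m \<and> real m < v} \<le> nat \<lfloor>v\<rfloor> - nat \<lfloor>u\<rfloor>"
    using card_mono[OF _ sub] by simp
  thus "real (card {m::nat. u < real m \<and> real m < v}) \<le> v - u + 1" using assms by linarith
qed

text \<open>For each exponent \<open>i \<le> I\<close> the numbers \<open>m\<close> in question lie in the interval between \<open>u / 2 ^ i\<close> and \<open>v / 2 ^ i\<close>.\<close>

lemma card_dyadic_scale_interval_le:
  fixes u v :: real and I :: nat
  assumes uv: "0 \<le> u" "u \<le> v"
  defines "E \<equiv> {m. m \<ge> 1 \<and> u < real (dyadic_scale (2 ^ I) m) \<and> real (dyadic_scale (2 ^ I) m) < v}"
  shows "finite E" "real (card E) \<le> 2 * (v - u) + real I + 1"
proof -
  define X where "X = (\<lambda>i. {m::nat. u / 2 ^ i < real m \<and> real m < v / 2 ^ i})"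
  have finX: "finite (X i)" and cardX: "real (card (X i)) \<le> (v - u) / 2 ^ i + 1" for i
  proof -
    have "0 \<le> u / 2 ^ i" "u / 2 ^ i \<le> v / 2 ^ i" using uv by (auto intro: divide_right_mono)
    from card_nat_open_interval_le[OF this] show "finite (X i)" "real (card (X i)) \<le> (v - u) / 2 ^ i + 1"
      by (auto simp: X_def diff_divide_distrib)
  qed
  have sub: "E \<subseteq> (\<Union>i\<in>{..I}. X i)"
  proof
    fix m assume m: "m \<in> E"
    define i where "i = dyadic_exponent (2 ^ I) m"
    have "i \<le> I" using m dyadic_exponent_le by (simp add: E_def i_def)
    moreover have "m \<in> X i"
      using m by (simp add: E_def X_def dyadic_scale_def i_def[symmetric] pos_divide_less_eq pos_less_divide_eq)
    ultimately show "m \<in> (\<Union>i\<in>{..I}. X i)" by blast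
  qed
  thus "finite E" using finX by (meson finite_UN_I finite_atMost finite_subset)
  have "card E \<le> card (\<Union>i\<in>{..I}. X i)" using sub finX by (intro card_mono) auto
  also have "\<dots> \<le> (\<Sum>i\<in>{..I}. card (X i))" by (rule card_UN_le) simp
  finally have "real (card E) \<le> (\<Sum>i\<in>{..I}. real (card (X i)))" by (metis of_nat_le_iff of_nat_sum)
  also have "\<dots> \<le> (\<Sum>i\<in>{..I}. (v - u) * (1 / 2) ^ i + 1)"
  proof (intro sum_mono)
    fix i
    have "(v - u) * (1 / 2) ^ i = (v - u) / 2 ^ i" by (simp add: power_one_over)
    thus "real (card (X i)) \<le> (v - u) * (1 / 2) ^ i + 1" using cardX[of i] by linarith
  qed
  also have "\<dots> = (v - u) * (\<Sum>i\<in>{..I}. (1 / 2) ^ i) + (real I + 1)"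
    by (simp add: sum.distrib sum_distrib_left)
  also have "\<dots> \<le> (v - u) * 2 + (real I + 1)"
  proof (intro add_right_mono mult_left_mono)
    have "(\<Sum>i\<in>{..I}. (1 / 2 :: real) ^ i) = 2 - (1/2) ^ I" by (induction I) auto
    thus "(\<Sum>i\<in>{..I}. (1 / 2 :: real) ^ i) \<le> 2" by simp
  qed (use uv in auto)
  finally show "real (card E) \<le> 2 * (v - u) + real I + 1" by simp
qed

text \<open>With \<open>p = s ^ 40\<close> all the sizes are integral powers of \<open>s\<close>: the level \<open>Q\<close> of the sieve is about \<open>s ^ 2\<close>, and the length \<open>W\<close>
  of the block is at least \<open>s ^ 20\<close>, which leaves ample room for \<open>Q ^ 4\<close> in the error term.\<close>

lemma block_parameters:
  fixes s p \<eta> p2 :: real and W Q n0 :: nat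
  assumes s: "s \<ge> 2" and p: "p = s ^ 40" and \<eta>: "0 < \<eta>" "1 \<le> \<eta> * s ^ 20" and p2: "p2 = (1 + \<eta>) * p"
  defines "W \<equiv> nat \<lceil>\<eta> * p\<rceil>" and "Q \<equiv> nat \<lfloor>s ^ 2\<rfloor>" and "n0 \<equiv> nat \<lfloor>p\<rfloor> + 1"
  shows "Q \<ge> 2" "ln p \<le> 40 * ln (real Q)" "real Q \<le> s ^ 2" "\<eta> * p \<le> real W" "real W \<le> 2 * (\<eta> * p)"
    "s ^ 20 \<le> real W" "Q ^ 2 < W"
    "{n. prime n \<and> p < real n \<and> real n \<le> p2} \<subseteq> {n0..<n0 + W}"
    "\<And>n. p < real n \<Longrightarrow> n > Q" "real Q ^ 4 * ln (real Q) / real W \<le> 1 / s ^ 10"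
proof -
  have s2: "s ^ 2 \<ge> s + 2"
  proof -
    have "s * s \<ge> 2 * s" using s by (intro mult_right_mono) auto
    thus ?thesis using s unfolding power2_eq_square by linarith
  qed
  have Qs: "real Q \<ge> s" using s2 s unfolding Q_def by linarith
  thus Q2: "Q \<ge> 2" using s by linarith
  have "ln s \<le> ln (real Q)" using Qs s by simp
  thus "ln p \<le> 40 * ln (real Q)" using s by (simp add: p ln_realpow)
  show Qle: "real Q \<le> s ^ 2" using s unfolding Q_def by simp
  have eps: "\<eta> * p \<ge> s ^ 20"
  proof -
    have "s ^ 20 * 1 \<le> s ^ 20 * (\<eta> * s ^ 20)" using \<eta> s by (intro mult_left_mono) auto
    also have "\<dots> = \<eta> * p" unfolding p by (simp flip: power_add)
    finally show ?thesis by simp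
  qed
  have s20: "s ^ 20 \<ge> 1" using s by simp
  show W1: "\<eta> * p \<le> real W" unfolding W_def by linarith
  show "real W \<le> 2 * (\<eta> * p)" using eps s20 unfolding W_def by linarith
  show W20: "s ^ 20 \<le> real W" using eps W1 by linarith
  have "real (Q ^ 2) \<le> (s ^ 2) ^ 2" unfolding of_nat_power using Qle by (intro power_mono) auto
  also have "\<dots> = s ^ 4" by (simp flip: power_mult)
  also have "\<dots> < s ^ 20" using s by (intro power_strict_increasing) auto
  finally show "Q ^ 2 < W" using W20 by linarith
  show "{n. prime n \<and> p < real n \<and> real n \<le> p2} \<subseteq> {n0..<n0 + W}"
  proof clarify
    fix n assume n: "p < real n" "real n \<le> p2"
    have p0: "p \<ge> 0" using s by (simp add: p)
    have "n0 \<le> n" using n(1) p0 unfolding n0_def by linarith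
    moreover have "real n \<le> p + \<eta> * p" using n(2) by (simp add: p2 algebra_simps)
    hence "real n < real (n0 + W)" using p0 W1 unfolding n0_def by simp linarith
    ultimately show "n \<in> {n0..<n0 + W}" by simp
  qed
  show "n > Q" if "p < real n" for n
  proof -
    have "s ^ 2 \<le> s ^ 40" using s by (intro power_increasing) auto
    thus ?thesis using that Qle p by linarith
  qed
  show "real Q ^ 4 * ln (real Q) / real W \<le> 1 / s ^ 10"
  proof -
    have "ln (real Q) \<le> real Q - 1" using Q2 by (intro ln_le_minus_one) auto
    hence "ln (real Q) \<le> s ^ 2" using Qle by linarith
    moreover have "real Q ^ 4 \<le> (s ^ 2) ^ 4" using Qle by (intro power_mono) auto
    ultimately have "real Q ^ 4 * ln (real Q) \<le> (s ^ 2) ^ 4 * s ^ 2" using Q2 by (intro mult_mono) auto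
    also have "\<dots> = s ^ 10" by (simp flip: power_mult power_add)
    finally have "real Q ^ 4 * ln (real Q) / real W \<le> s ^ 10 / s ^ 20"
      using W20 s by (intro frac_le) auto
    also have "\<dots> = 1 / s ^ 10" using s by (simp add: field_simps flip: power_add)
    finally show ?thesis .
  qed
qed

text \<open>Distinct fractions \<open>a/q\<close> and \<open>b0/r\<close> differ by at least \<open>1 / (q r)\<close>, and \<open>\<alpha>\<close> is much closer to the first.\<close>

lemma other_approximation:
  fixes \<alpha> x :: real and a b0 q :: int and r :: nat
  assumes aq: "coprime a q" "q > 0" "\<bar>\<alpha> - real_of_int a / real_of_int q\<bar> \<le> 1 / (real_of_int q * x)"
    and r: "coprime b0 (int r)" "r > 0" "2 * real r \<le> x"
  shows "int r = q \<or> 1 / (2 * real_of_int q * real r) \<le> \<bar>\<alpha> - real_of_int b0 / real r\<bar>"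
proof (cases "a * int r = b0 * q")
  case True
  have "int r dvd b0 * q" using True by (metis dvd_triv_right)
  hence 1: "int r dvd q" using r(1) by (simp add: coprime_dvd_mult_right_iff coprime_commute)
  have "q dvd a * int r" using True by simp
  hence 2: "q dvd int r" using aq(1) by (simp add: coprime_dvd_mult_right_iff coprime_commute)
  show ?thesis using zdvd_antisym_nonneg[OF _ _ 1 2] aq(2) by simp
next
  case False
  have q0: "real_of_int q > 0" "real r > 0" using aq(2) r(2) by auto
  have "real_of_int a / real_of_int q - real_of_int b0 / real r = real_of_int (a * int r - b0 * q) / (real_of_int q * real r)"
    using q0 by (simp add: field_simps)
  hence "\<bar>real_of_int a / real_of_int q - real_of_int b0 / real r\<bar> = \<bar>real_of_int (a * int r - b0 * q)\<bar> / (real_of_int q * real r)"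
    using q0 by (simp add: abs_mult)
  moreover have "\<bar>real_of_int (a * int r - b0 * q)\<bar> \<ge> 1" using False by linarith
  ultimately have 1: "1 / (real_of_int q * real r) \<le> \<bar>real_of_int a / real_of_int q - real_of_int b0 / real r\<bar>"
    using q0 by (simp add: divide_right_mono)
  have "1 / (real_of_int q * x) \<le> 1 / (real_of_int q * (2 * real r))"
    using q0 r(3) by (intro divide_left_mono mult_left_mono mult_pos_pos) auto
  also have "\<dots> = 1 / (real_of_int q * real r) / 2" by simp
  finally have "\<bar>\<alpha> - real_of_int a / real_of_int q\<bar> \<le> 1 / (real_of_int q * real r) / 2" using aq(3) by linarith
  moreover have "t / 2 \<le> \<bar>\<alpha> - v\<bar>" if "\<bar>\<alpha> - u\<bar> \<le> t / 2" "t \<le> \<bar>u - v\<bar>" for t u v :: real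
    using that by linarith
  ultimately have "1 / (real_of_int q * real r) / 2 \<le> \<bar>\<alpha> - real_of_int b0 / real r\<bar>" using 1 by blast
  thus ?thesis by (simp add: mult_ac)
qed

section \<open>The bilinear sum over one block\<close>

lemma card_prime_block_le:
  fixes p \<eta> s :: real
  assumes s: "s \<ge> 2" and p: "p = s ^ 40" and \<eta>: "0 < \<eta>" "1 \<le> \<eta> * s ^ 20"
  shows "real (card {n. prime n \<and> p < real n \<and> real n \<le> (1 + \<eta>) * p}) \<le> 5760 * (\<eta> * p) / ln p"
proof -
  define W Q n0 where "W = nat \<lceil>\<eta> * p\<rceil>" and "Q = nat \<lfloor>s ^ 2\<rfloor>" and "n0 = nat \<lfloor>p\<rfloor> + 1"
  note bp = block_parameters[OF s p \<eta> refl, folded W_def Q_def n0_def]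
  have lnQ: "ln (real Q) > 0" using bp(1) by simp
  have lnp: "ln p > 0" using s by (simp add: p)
  have ep: "\<eta> * p \<ge> 0" using \<eta> s by (simp add: p)
  have "real (card {n. prime n \<and> p < real n \<and> real n \<le> (1 + \<eta>) * p}) \<le> 72 * real W / ln (real Q)"
    by (rule card_primes_in_interval_le[OF bp(8) _ bp(1) bp(7)]) (use bp(9) in auto)
  also have "\<dots> \<le> 72 * (2 * (\<eta> * p)) / (ln p / 40)"
    using bp(2,5) lnQ lnp ep by (intro frac_le) auto
  also have "\<dots> = 5760 * (\<eta> * p) / ln p" by simp
  finally show ?thesis .
qed

lemma square_sum_le_card_mult_sum_squares:
  fixes g :: "nat \<Rightarrow> real"
  shows "(\<Sum>m\<in>A. g m) ^ 2 \<le> real (card A) * (\<Sum>m\<in>A. g m ^ 2)"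
  using Cauchy_Schwarz_ineq_sum[of "\<lambda>_. 1" g A] by simp

text \<open>Write \<open>ln v = ln u + ln (v/u)\<close> and use \<open>ln (v/u) \<le> v/u - 1 \<le> (v/u - 1) ln u\<close>.\<close>

lemma ln_div_self_antimono:
  fixes u v :: real
  assumes "exp 1 \<le> u" "u \<le> v"
  shows "ln v / v \<le> ln u / u"
proof -
  have u0: "u > 0" using assms(1) exp_gt_zero[of "1::real"] by linarith
  have l1: "ln u \<ge> 1" using assms(1) u0 by (simp add: ln_ge_iff)
  have "ln v = ln u + ln (v / u)" using u0 assms by (simp add: ln_div)
  also have "ln (v / u) \<le> v / u - 1" using u0 assms by (intro ln_le_minus_one) auto
  also have "v / u - 1 \<le> ln u * (v / u - 1)"
    using l1 u0 assms mult_right_mono[of 1 "ln u" "v / u - 1"] by simp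
  finally have "ln v \<le> ln u * (v / u)" by (simp add: algebra_simps)
  thus ?thesis using u0 assms by (simp add: field_simps)
qed

text \<open>The quotient \<open>ln M / sqrt M\<close> decreases for \<open>M \<ge> exp 2\<close>; what is left is a power of \<open>H / M\<close> that makes the sum over the
  blocks converge.\<close>

lemma sqrt_ln_div_self_le:
  fixes H M :: real
  assumes H: "8 \<le> H" "H \<le> M"
  shows "sqrt (ln M / M) \<le> sqrt (ln H / H) * (H / M) powr (1/4)"
proof -
  have e: "exp 1 \<le> sqrt H"
  proof -
    have "exp (1::real) ^ 2 \<le> 8"
    proof -
      have "exp (1::real) \<le> 2.72" using e_less_272 by simp
      hence "exp (1::real) ^ 2 \<le> 2.72 ^ 2" by (intro power_mono) auto
      also have "(2.72::real) ^ 2 \<le> 8" by (simp add: power2_eq_square)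
      finally show ?thesis .
    qed
    thus ?thesis using H by (intro real_le_rsqrt) linarith
  qed
  have pos: "H > 0" "M > 0" using H by auto
  have "ln (sqrt M) / sqrt M \<le> ln (sqrt H) / sqrt H"
    using e H by (intro ln_div_self_antimono) auto
  hence 1: "ln M / sqrt M \<le> ln H / sqrt H" using pos by (simp add: ln_sqrt)
  have hm: "(H / M) powr (1/2) = sqrt H / sqrt M" using pos by (simp add: powr_half_sqrt real_sqrt_divide)
  have "ln M / M = (ln M / sqrt M) / sqrt M" using pos by simp
  also have "\<dots> \<le> (ln H / sqrt H) / sqrt M" using 1 pos by (intro divide_right_mono) auto
  also have "\<dots> = ln H / H * (H / M) powr (1/2)" unfolding hm using pos by (simp add: field_simps)
  finally have "sqrt (ln M / M) \<le> sqrt (ln H / H * (H / M) powr (1/2))" by simp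
  also have "\<dots> = sqrt (ln H / H) * (H / M) powr (1/4)"
  proof -
    have "sqrt ((H / M) powr (1/2)) = ((H / M) powr (1/2)) powr (1/2)" using pos by (subst powr_half_sqrt) auto
    also have "\<dots> = (H / M) powr (1/4)" by (simp add: powr_powr)
    finally show ?thesis by (simp only: real_sqrt_mult)
  qed
  finally show ?thesis .
qed

text \<open>Cauchy--Schwarz in \<open>m\<close> and the mean square bound with \<open>Y = min M (L ^ 5)\<close> and \<open>R = L powr (2 + \<epsilon>/2)\<close>.
  The value of \<open>R\<close> is admissible: an approximation \<open>b0/r\<close> other than \<open>a/q\<close> satisfies
  \<open>r W M \<bar>\<alpha> - b0/r\<bar> \<ge> \<eta> x / (8 q) \<ge> L powr (2 + 3 \<epsilon> / 4) / 8\<close>.\<close>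

lemma bilinear_block_sum_le:
  fixes x \<alpha> L \<epsilon> \<eta> p s :: real and a q :: int and f :: "nat \<Rightarrow> complex" and H :: nat
  assumes s: "s \<ge> 2" and p: "p = s ^ 40" and \<eta>: "0 < \<eta>" "\<eta> \<le> 1" "1 \<le> \<eta> * s ^ 20"
    and L: "L \<ge> 8" "L = ln x" and \<eta>_eq: "\<eta> = L powr (-1 - \<epsilon> / 4)" and \<epsilon>: "\<epsilon> > 0"
    and H: "8 \<le> H" "real H * ((1 + \<eta>) * p) \<le> x"
    and aq: "coprime a q" "L powr (2 + \<epsilon>) \<le> real_of_int q" "real_of_int q \<le> x / L powr (3 + \<epsilon>)"
       "\<bar>\<alpha> - real_of_int a / real_of_int q\<bar> \<le> 1 / (real_of_int q * x)"
    and f: "unit_disc_valued f"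
    and R_le: "L powr (2 + \<epsilon> / 2) \<le> L powr (2 + 3 * \<epsilon> / 4) / 8"
    and error_le: "15 * ln L / L ^ 5 + 15 * ln L / L powr (2 + \<epsilon> / 2) + 1 / s ^ 10 \<le> (L powr (-1 - 3 * \<epsilon> / 16))\<^sup>2"
  defines "M \<equiv> nat \<lfloor>x / ((1 + \<eta>) * p)\<rfloor>"
  shows "(\<Sum>m\<in>{1..M}. cmod (twisted_sum {n. prime n \<and> p < real n \<and> real n \<le> (1 + \<eta>) * p} f (real m * \<alpha>)))
     \<le> 100000 * (\<eta> * x / ln p) * (sqrt (ln (real M) / real M) + L powr (-1 - 3 * \<epsilon> / 16))"
proof -
  define W Q n0 where "W = nat \<lceil>\<eta> * p\<rceil>" and "Q = nat \<lfloor>s ^ 2\<rfloor>" and "n0 = nat \<lfloor>p\<rfloor> + 1"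
  note bp = block_parameters[OF s p \<eta>(1,3) refl, folded W_def Q_def n0_def]
  define A where "A = {n. prime n \<and> p < real n \<and> real n \<le> (1 + \<eta>) * p}"
  define S where "S = (\<lambda>m::nat. cmod (twisted_sum A f (real m * \<alpha>)))"
  have lnQ: "ln (real Q) > 0" using bp(1) by simp
  have lnp: "ln p > 0" using s by (simp add: p)
  have p0: "p > 0" using s by (simp add: p)
  have W0: "real W > 0"
  proof -
    have "s ^ 20 > 0" using s by simp
    thus ?thesis using bp(6) by linarith
  qed
  define P2 where "P2 = (1 + \<eta>) * p"
  have P2: "P2 > 0" "P2 \<le> 2 * p" "p \<le> P2" using \<eta> p0 by (auto simp: P2_def)
  have xP: "real H \<le> x / P2" using H(2) P2 by (simp add: P2_def pos_le_divide_eq)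
  have MH: "H \<le> M" using xP unfolding M_def P2_def by (simp add: le_nat_floor)
  have M8: "real M \<ge> 8" using MH H(1) by simp
  have Mle: "real M \<le> x / P2" using xP unfolding M_def P2_def[symmetric] by simp
  have Mge: "real M \<ge> x / P2 / 2"
  proof -
    have "real M \<ge> x / P2 - 1" using xP unfolding M_def P2_def[symmetric] by linarith
    moreover have "z / 2 \<le> m" if "z - 1 \<le> m" "8 \<le> m" for z m :: real using that by linarith
    ultimately show ?thesis using M8 by blast
  qed
  have x0: "x > 0"
  proof -
    have "0 < real H * P2" using H(1) P2 by simp
    thus ?thesis using H(2) unfolding P2_def by linarith
  qed
  define Y where "Y = min (real M) (L ^ 5)"
  have L5: "L ^ 5 \<ge> 8"
  proof -
    have "L ^ 1 \<le> L ^ 5" using L by (intro power_increasing) auto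
    thus ?thesis using L by simp
  qed
  have Y: "8 \<le> Y" "Y \<le> real M" using M8 L5 by (auto simp: Y_def)
  define R where "R = L powr (2 + \<epsilon> / 2)"
  have R0: "R > 0" using L by (simp add: R_def)
  have q0: "real_of_int q > 0"
  proof -
    have "L powr (2 + \<epsilon>) > 0" using L by simp
    thus ?thesis using aq(2) by linarith
  qed
  have q0': "q > 0" using q0 by simp
  have MWle: "real M * real W \<le> 2 * (\<eta> * x)"
  proof -
    have "real M * real W \<le> (x / P2) * (2 * (\<eta> * p))" using Mle bp(5) x0 P2 by (intro mult_mono) auto
    also have "\<dots> \<le> (x / p) * (2 * (\<eta> * p))" using P2 p0 x0 \<eta> by (intro mult_right_mono divide_left_mono) auto
    also have "\<dots> = 2 * (\<eta> * x)" using p0 by simp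
    finally show ?thesis .
  qed
  have MWge: "\<eta> * x / 4 \<le> real W * real M"
  proof -
    have "\<eta> * x / 4 = (\<eta> * p) * (x / (2 * p) / 2)" using p0 by simp
    also have "\<dots> \<le> (\<eta> * p) * (x / P2 / 2)"
      using P2 p0 x0 \<eta> by (intro mult_left_mono divide_right_mono divide_left_mono) auto
    also have "\<dots> \<le> real W * real M" using Mge bp(4) x0 P2 by (intro mult_mono) auto
    finally show ?thesis .
  qed
  have approx: "R \<le> real r \<or> R \<le> real r * (real W * real M * \<bar>\<alpha> - of_int b0 / real r\<bar>)"
    if r: "r > 0" "coprime b0 (int r)" "r \<le> 4 * M * Q^2" for b0 :: int and r :: nat
  proof -
    have "2 * real r \<le> x"
    proof -
      have "real r \<le> real (4 * M * Q ^ 2)" using r(3) of_nat_le_iff by blast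
      also have "\<dots> = 4 * real M * real Q ^ 2" by simp
      also have "\<dots> \<le> 4 * (x / p) * (s ^ 2) ^ 2"
      proof -
        have "x / P2 \<le> x / p" using P2 x0 p0 by (intro divide_left_mono) auto
        hence "real M \<le> x / p" using Mle by linarith
        thus ?thesis using bp(3) x0 p0 by (intro mult_mono power_mono) auto
      qed
      also have "\<dots> = 4 * x * (s ^ 4 / s ^ 40)" by (simp add: p flip: power_mult)
      also have "s ^ 4 / s ^ 40 = 1 / s ^ 36" using s by (simp add: field_simps flip: power_add)
      also have "4 * x * (1 / s ^ 36) \<le> 4 * x * (1 / 8)"
      proof -
        have "(2::real) ^ 3 \<le> s ^ 3" using s by (intro power_mono) auto
        also have "s ^ 3 \<le> s ^ 36" using s by (intro power_increasing) auto
        finally have "8 \<le> s ^ 36" by simp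
        thus ?thesis using x0 by (intro mult_left_mono divide_left_mono) auto
      qed
      finally show ?thesis by simp
    qed
    from other_approximation[OF aq(1) q0' aq(4) r(2,1) this]
    show ?thesis
    proof
      assume "int r = q"
      hence "L powr (2 + \<epsilon>) \<le> real r" using aq(2) by (metis of_int_of_nat_eq)
      moreover have "R \<le> L powr (2 + \<epsilon>)" unfolding R_def using L \<epsilon> by (intro powr_mono) auto
      ultimately show ?thesis by linarith
    next
      assume b: "1 / (2 * real_of_int q * real r) \<le> \<bar>\<alpha> - real_of_int b0 / real r\<bar>"
      have "R \<le> L powr (2 + 3 * \<epsilon> / 4) / 8" unfolding R_def by (rule R_le)
      also have "\<dots> = \<eta> * L powr (3 + \<epsilon>) / 8" by (simp add: \<eta>_eq flip: powr_add)
      also have "\<dots> \<le> \<eta> * (x / real_of_int q) / 8"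
      proof -
        have "L powr (3 + \<epsilon>) \<le> x / real_of_int q"
          using aq(3) q0 L by (simp add: field_simps)
        thus ?thesis using \<eta> by (intro divide_right_mono mult_left_mono) auto
      qed
      also have "\<dots> = real r * ((\<eta> * x / 4) * (1 / (2 * real_of_int q * real r)))"
        using r(1) q0 by simp
      also have "\<dots> \<le> real r * (real W * real M * \<bar>\<alpha> - of_int b0 / real r\<bar>)"
        using MWge b q0 by (intro mult_left_mono mult_mono) auto
      finally show ?thesis by simp
    qed
  qed
  have f1: "cmod (f n) \<le> 1" if "n \<in> A" for n
    using f that prime_gt_0_nat[of n] by (auto simp: A_def unit_disc_valued_def Suc_le_eq)
  define E where "E = (log 2 Y + 2) / ln (real Q) * (1 / Y + 1 / R) + real Q ^ 4 / real W"
  define s1 where "s1 = ln (real M) / real M"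
  define t1 where "t1 = L powr (-1 - 3 * \<epsilon> / 16)"
  define u where "u = \<eta> * x / ln p"
  have u0: "u \<ge> 0" using \<eta> x0 lnp by (simp add: u_def)
  have s10: "s1 \<ge> 0" using M8 by (simp add: s1_def)
  have t10: "t1 \<ge> 0" by (simp add: t1_def)
  have key: "(\<Sum>m\<in>{1..M}. S m ^ 2) \<le> 4000 * real M * real W * real (card A) * E"
    unfolding S_def E_def
  proof (rule bilinear_block_bound)
    show "A \<subseteq> {n0..<n0 + W}" using bp(8) by (simp add: A_def)
    show "\<And>n. n \<in> A \<Longrightarrow> prime n \<and> Q < n" using bp(9) by (auto simp: A_def)
  qed (use approx f1 R0 Y MH H bp(1) W0 in auto)
  have cA: "real (card A) \<le> 72 * real W / ln (real Q)"
    unfolding A_def by (rule card_primes_in_interval_le[OF bp(8) _ bp(1) bp(7)]) (use bp(9) in auto)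
  \<comment> \<open>Splitting off \<open>ln M / M\<close> from \<open>ln Y / Y\<close> leaves \<open>ln (L ^ 5) / L ^ 5\<close>, which is of lower order than \<open>1/R\<close>.\<close>
  have El: "E * ln (real Q) \<le> 3 * s1 + t1 ^ 2"
  proof -
    have Ef: "E * ln (real Q) = (log 2 Y + 2) * (1 / Y + 1 / R) + real Q ^ 4 * ln (real Q) / real W"
    proof -
      have "(u / l * v + w / W') * l = u * v + w * l / W'" if "l > 0" for u v w l W' :: real
        using that by (simp add: distrib_right)
      from this[OF lnQ] show ?thesis unfolding E_def .
    qed
    have lnY: "ln Y \<ge> 2"
    proof -
      have "exp (1::real) ^ 2 \<le> 2.72 ^ 2" using e_less_272 by (intro power_mono) auto
      also have "(2.72::real) ^ 2 \<le> 8" by (simp add: power2_eq_square)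
      finally have "exp (1::real) ^ 2 \<le> 8" .
      moreover have "exp (2::real) = exp 1 ^ 2" by (simp add: power2_eq_square flip: exp_add)
      ultimately have "exp 2 \<le> Y" using Y by linarith
      thus ?thesis using Y by (simp add: ln_ge_iff)
    qed
    have "log 2 Y \<le> 2 * ln Y"
    proof -
      have "ln (2::real) \<ge> 1/2" using ln_le_minus_one[of "1/2::real"] by (simp add: ln_div)
      hence "ln Y * 1 \<le> ln Y * (2 * ln 2)" using lnY by (intro mult_left_mono) auto
      thus ?thesis using ln_gt_zero[of "2::real"] by (simp add: log_def field_simps)
    qed
    hence l: "log 2 Y + 2 \<le> 3 * ln Y" using lnY by linarith
    have 1: "(log 2 Y + 2) * (1 / Y + 1 / R) \<le> 3 * ln Y * (1 / Y + 1 / R)"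
      using l Y R0 by (intro mult_right_mono) auto
    have "Y \<le> L ^ 5" by (simp add: Y_def)
    hence "ln Y \<le> ln (L ^ 5)" using Y L by (subst ln_le_cancel_iff) auto
    hence lnYL: "ln Y \<le> 5 * ln L" using L by (simp add: ln_realpow)
    have "ln Y / Y \<le> s1 + 5 * ln L / L ^ 5"
    proof (cases "real M \<le> L ^ 5")
      case True
      have "ln L \<ge> 0" using L by simp
      thus ?thesis using True L by (simp add: Y_def s1_def)
    next
      case False
      thus ?thesis using L s10 by (simp add: Y_def ln_realpow)
    qed
    moreover have "ln Y / R \<le> 5 * ln L / R" using lnYL R0 by (intro divide_right_mono) auto
    ultimately have 2: "3 * ln Y * (1 / Y + 1 / R) \<le> 3 * s1 + 15 * ln L / L ^ 5 + 15 * ln L / R"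
      by (simp add: distrib_left)
    show ?thesis using Ef 1 2 bp(10) error_le unfolding R_def t1_def by linarith
  qed
  have E0: "E \<ge> 0" using lnQ Y R0 by (simp add: E_def)
  have "(\<Sum>m\<in>{1..M}. S m) ^ 2 \<le> real M * (\<Sum>m\<in>{1..M}. S m ^ 2)"
    using square_sum_le_card_mult_sum_squares[of S "{1..M}"] by simp
  also have "\<dots> \<le> real M * (4000 * real M * real W * real (card A) * E)" using key by (intro mult_left_mono) auto
  also have "\<dots> = 4000 * real M ^ 2 * real W * E * real (card A)" by (simp add: power2_eq_square)
  also have "\<dots> \<le> 4000 * real M ^ 2 * real W * E * (72 * real W / ln (real Q))" using cA E0 by (intro mult_left_mono) auto
  also have "\<dots> = 288000 * (real M * real W / ln (real Q)) ^ 2 * (E * ln (real Q))"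
    using lnQ by (simp add: power2_eq_square)
  also have "\<dots> \<le> 288000 * (80 * u) ^ 2 * (3 * s1 + t1 ^ 2)"
  proof (intro mult_mono mult_left_mono power_mono)
    have "real M * real W / ln (real Q) \<le> (2 * (\<eta> * x)) / (ln p / 40)"
      using MWle bp(2) lnp lnQ \<eta> x0 by (intro frac_le) auto
    also have "\<dots> = 80 * u" by (simp add: u_def)
    finally show "real M * real W / ln (real Q) \<le> 80 * u" .
  qed (use El E0 lnQ in auto)
  also have "\<dots> \<le> (100000 * u * (sqrt s1 + t1)) ^ 2"
  proof -
    have "288000 * (80 * u) ^ 2 * (3 * s1 + t1 ^ 2) = u ^ 2 * (1843200000 * (3 * s1 + t1 ^ 2))" by (simp add: power_mult_distrib)
    also have "\<dots> \<le> u ^ 2 * (10000000000 * (sqrt s1 + t1) ^ 2)"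
    proof (intro mult_left_mono)
      have "(sqrt s1 + t1) ^ 2 = s1 + 2 * sqrt s1 * t1 + t1 ^ 2" using s10 by (simp add: power2_sum)
      moreover have "sqrt s1 * t1 \<ge> 0" using s10 t10 by simp
      ultimately show "1843200000 * (3 * s1 + t1 ^ 2) \<le> 10000000000 * (sqrt s1 + t1) ^ 2" using s10 by simp
    qed auto
    finally show ?thesis by (simp add: power_mult_distrib)
  qed
  finally have "(\<Sum>m\<in>{1..M}. S m) \<le> 100000 * u * (sqrt s1 + t1)"
    by (rule power2_le_imp_le) (use u0 s10 t10 in auto)
  thus ?thesis unfolding S_def A_def u_def s1_def t1_def by simp
qed

section \<open>Summation over the blocks\<close>

text \<open>The terms without the factor \<open>\<eta>\<close> form a geometric progression with ratio \<open>\<rho> = (1 + \<eta>) powr (1/8) \<ge> 1 + \<eta>/16\<close>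
  whose last term is at most \<open>1\<close>.\<close>

lemma sum_geometric_blocks_le:
  fixes \<eta> y X :: real and J :: nat
  assumes \<eta>: "0 < \<eta>" "\<eta> \<le> 1" and y: "y > 0" and X: "X > 0"
  shows "(\<Sum>j | j < J \<and> y * (1 + \<eta>) ^ j \<le> X. \<eta> * (y * (1 + \<eta>) ^ j / X) powr (1/8)) \<le> 20"
proof -
  define \<rho> where "\<rho> = (1 + \<eta>) powr (1/8)"
  define w where "w = (\<lambda>j. (y * (1 + \<eta>) ^ j / X) powr (1/8))"
  have w0: "w j \<ge> 0" for j by (simp add: w_def)
  have wS: "w (Suc j) = \<rho> * w j" for j
  proof -
    have "y * (1 + \<eta>) ^ Suc j / X = (1 + \<eta>) * (y * (1 + \<eta>) ^ j / X)" by simp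
    hence "w (Suc j) = ((1 + \<eta>) * (y * (1 + \<eta>) ^ j / X)) powr (1/8)" by (simp only: w_def)
    also have "\<dots> = \<rho> * w j" unfolding w_def \<rho>_def by (rule powr_mult)
    finally show ?thesis .
  qed
  have rho1: "\<eta> \<le> 16 * (\<rho> - 1)"
  proof -
    have "(1 + \<eta> / 16) ^ 8 \<le> exp (\<eta> / 16) ^ 8" using \<eta> by (intro power_mono exp_ge_add_one_self) auto
    also have "\<dots> = exp (\<eta> / 2)" by (simp flip: exp_of_nat_mult)
    also have "\<dots> \<le> 1 + \<eta> / 2 + (\<eta> / 2) ^ 2" using \<eta> by (intro exp_bound) auto
    also have "\<dots> \<le> 1 + \<eta>"
    proof -
      have "\<eta> * \<eta> \<le> \<eta> * 1" using \<eta> by (intro mult_left_mono) auto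
      moreover have "(\<eta> / 2) ^ 2 = \<eta> * \<eta> / 4" by (simp add: power2_eq_square)
      ultimately show ?thesis using \<eta> by linarith
    qed
    finally have "((1 + \<eta> / 16) ^ 8) powr (1/8) \<le> \<rho>" unfolding \<rho>_def using \<eta> by (intro powr_mono2) auto
    moreover have "((1 + \<eta> / 16) ^ 8) powr (1/8) = 1 + \<eta> / 16"
    proof -
      have "(1 + \<eta> / 16) ^ 8 = (1 + \<eta> / 16) powr 8" using \<eta> by (simp add: powr_numeral)
      thus ?thesis using \<eta> by (simp only: powr_powr) simp
    qed
    ultimately show ?thesis by simp
  qed
  have rho2: "\<rho> \<le> 9/8"
  proof -
    have "1 + \<eta> \<le> (9/8) ^ 8" using \<eta> by (simp add: power_divide)
    hence "\<rho> \<le> ((9/8) ^ 8) powr (1/8)" unfolding \<rho>_def using \<eta> by (intro powr_mono2) auto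
    also have "((9/8::real) ^ 8) = (9/8) powr 8" by (subst powr_numeral) auto
    also have "((9/8::real) powr 8) powr (1/8) = 9/8" by (simp only: powr_powr) simp
    finally show ?thesis .
  qed
  have tel: "(\<Sum>j<n. \<eta> * w j) \<le> 16 * w n" for n
  proof (induction n)
    case (Suc n)
    have "\<eta> * w n \<le> 16 * (\<rho> - 1) * w n" using rho1 w0 by (rule mult_right_mono)
    thus ?case using Suc by (simp add: wS algebra_simps)
  qed (simp add: w0)
  define S where "S = {j. j < J \<and> y * (1 + \<eta>) ^ j \<le> X}"
  have finS: "finite S" by (simp add: S_def)
  have "(\<Sum>j\<in>S. \<eta> * w j) \<le> 20"
  proof (cases "S = {}")
    case False
    define n where "n = Max S"
    have n: "n \<in> S" unfolding n_def using finS False by (rule Max_in)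
    have "S \<subseteq> {..<Suc n}" unfolding n_def using finS by (auto simp: less_Suc_eq_le)
    hence "(\<Sum>j\<in>S. \<eta> * w j) \<le> (\<Sum>j<Suc n. \<eta> * w j)" using \<eta> w0 by (intro sum_mono2) auto
    also have "\<dots> \<le> 16 * w (Suc n)" by (rule tel)
    also have "\<dots> = 16 * (\<rho> * w n)" by (simp add: wS)
    also have "\<dots> \<le> 16 * (9/8 * 1)"
    proof -
      have "w n \<le> 1"
      proof -
        have "y * (1 + \<eta>) ^ n / X \<le> 1" using n X by (simp add: S_def)
        hence "w n \<le> 1 powr (1/8)" unfolding w_def using y \<eta> X by (intro powr_mono2) auto
        thus ?thesis by simp
      qed
      thus ?thesis using rho2 w0[of n] by (intro mult_left_mono mult_mono) auto
    qed
    finally show ?thesis by simp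
  qed simp
  thus ?thesis by (simp add: S_def w_def)
qed

text \<open>For \<open>p \<ge> sqrt x\<close> the logarithm of \<open>p\<close> is at least half of \<open>ln x\<close>.  For smaller \<open>p\<close> the numerator is a negative power of
  \<open>x\<close>.  This replaces the varying \<open>ln p\<close> by \<open>ln x\<close> at the cost of a small power of \<open>H p / x\<close>.\<close>

lemma powr_div_ln_le:
  fixes p x H :: real
  assumes x: "x > 1" and p: "ln p \<ge> 1" "p > 0" and H: "H > 0" "H * p \<le> x"
    and small: "(H / sqrt x) powr (1/8) \<le> 2 / ln x"
  shows "(p / (x / H)) powr (1/8) / ln p \<le> 2 / ln x"
proof (cases "p \<ge> sqrt x")
  case True
  have L: "ln x > 0" using x by simp
  have "ln (sqrt x) \<le> ln p" using True x p by simp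
  hence lp: "ln x / 2 \<le> ln p" using x by (simp add: ln_sqrt)
  have "p / (x / H) \<le> 1" using H x p by (simp add: mult.commute)
  hence "(p / (x / H)) powr (1/8) \<le> 1 powr (1/8)" using p H x by (intro powr_mono2) auto
  hence "(p / (x / H)) powr (1/8) / ln p \<le> 1 / (ln x / 2)" using lp L by (intro frac_le) auto
  thus ?thesis by simp
next
  case False
  have sx: "sqrt x > 0" "sqrt x * sqrt x = x" using x by auto
  have "p / (x / H) = H * p / x" by simp
  also have "\<dots> \<le> H * sqrt x / x" using False H x by (intro divide_right_mono mult_left_mono) auto
  also have "\<dots> = H / sqrt x" using sx x by (simp add: field_simps)
  finally have "(p / (x / H)) powr (1/8) \<le> (H / sqrt x) powr (1/8)" using p H x by (intro powr_mono2) auto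
  hence "(p / (x / H)) powr (1/8) \<le> 2 / ln x" using small by linarith
  moreover have "(p / (x / H)) powr (1/8) / ln p \<le> (p / (x / H)) powr (1/8)"
  proof -
    have "(p / (x / H)) powr (1/8) / ln p \<le> (p / (x / H)) powr (1/8) / 1" using p by (intro frac_le) auto
    thus ?thesis by simp
  qed
  ultimately show ?thesis by linarith
qed

text \<open>The standing assumptions say that \<open>x\<close> is large enough in terms of \<open>\<epsilon>\<close> and \<open>H\<close>.\<close>

locale dissection =
  fixes x \<epsilon> \<eta> y L :: real and H I :: nat
  assumes L: "L \<ge> 8" "L = ln x" and \<epsilon>: "\<epsilon> > 0"
    and \<eta>_eq: "\<eta> = L powr (-1 - \<epsilon> / 4)"
    and y: "2 ^ 40 \<le> y" "y \<le> x" "1 \<le> \<eta> * y powr (1/2)"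
    and H: "H = 2 ^ I" "8 \<le> H" "2 * real H ^ 2 \<le> x" "(real H / sqrt x) powr (1/8) \<le> 2 / ln x"
    and error_le: "15 * ln L / L ^ 5 + 15 * ln L / L powr (2 + \<epsilon> / 2) + y powr (-1/4) \<le> (L powr (-1 - 3 * \<epsilon> / 16))\<^sup>2"
    and R_le: "L powr (2 + \<epsilon> / 2) \<le> L powr (2 + 3 * \<epsilon> / 4) / 8"
begin

definition P :: "nat \<Rightarrow> real" where "P j = y * (1 + \<eta>) ^ j"
definition J :: nat where "J = nat \<lceil>ln (x / y) / ln (1 + \<eta>)\<rceil>"

lemma \<eta>: "0 < \<eta>" "\<eta> \<le> 1/8"
proof -
  show "0 < \<eta>" unfolding \<eta>_eq using L by simp
  have "\<eta> \<le> L powr (-1)" unfolding \<eta>_eq using L \<epsilon> by (intro powr_mono) auto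
  also have "\<dots> = 1 / L" using L by (simp add: powr_minus_divide)
  also have "\<dots> \<le> 1 / 8" using L by (intro divide_left_mono) auto
  finally show "\<eta> \<le> 1/8" .
qed

lemma x_gt_1: "x > 1" using y by simp

lemma P_Suc: "P (Suc j) = (1 + \<eta>) * P j" by (simp add: P_def)

lemma P_ge: "y \<le> P j"
proof -
  have "1 \<le> (1 + \<eta>) ^ j" using \<eta> by simp
  thus ?thesis unfolding P_def using y by (simp add: mult_le_cancel_left1)
qed

lemma y_pos: "y > 0"
proof -
  have "(0::real) < 2 ^ 40" by simp
  thus ?thesis using y(1) by linarith
qed

lemma P_pos: "P j > 0" using P_ge[of j] y_pos by linarith

lemma incseq_P: "incseq P"
proof (rule incseq_SucI)
  fix j
  have "\<eta> * P j \<ge> 0" using \<eta> P_pos[of j] by simp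
  thus "P j \<le> P (Suc j)" unfolding P_Suc distrib_right by simp
qed

lemma ln_P_ge: "ln y \<le> ln (P j)"
  using P_ge[of j] y by (subst ln_le_cancel_iff) (auto intro: P_pos)

lemma ln_y_ge: "ln y \<ge> 1"
proof -
  have "exp (1::real) \<le> 3" by (rule exp_le)
  thus ?thesis using y by (subst ln_ge_iff) auto
qed

lemma x_le_P_J: "x \<le> P J"
proof -
  have l: "ln (1 + \<eta>) > 0" using \<eta> by simp
  have "ln (x / y) / ln (1 + \<eta>) \<le> real J" unfolding J_def by linarith
  hence "ln (x / y) \<le> real J * ln (1 + \<eta>)" using l by (simp add: divide_le_eq)
  also have "\<dots> = ln ((1 + \<eta>) ^ J)" using \<eta> by (simp add: ln_realpow)
  finally have "x / y \<le> (1 + \<eta>) ^ J" using y \<eta> x_gt_1 by (subst (asm) ln_le_cancel_iff) auto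
  thus ?thesis unfolding P_def using y by (simp add: field_simps)
qed

lemma J_le: "real J * \<eta> \<le> 3 * L"
proof -
  have "\<eta> - \<eta> ^ 2 \<le> ln (1 + \<eta>)" using \<eta> by (intro ln_one_plus_pos_lower_bound) auto
  moreover have "\<eta> ^ 2 \<le> \<eta> / 2" using \<eta> mult_left_mono[of \<eta> "1/2" \<eta>] by (simp add: power2_eq_square)
  ultimately have l: "\<eta> / 2 \<le> ln (1 + \<eta>)" by linarith
  have xy: "0 \<le> ln (x / y)" "ln (x / y) \<le> L"
    using y L x_gt_1 by (auto simp: ln_div)
  have "ln (x / y) / ln (1 + \<eta>) \<ge> 0" using xy \<eta> by (intro divide_nonneg_nonneg) auto
  hence "real J \<le> ln (x / y) / ln (1 + \<eta>) + 1" unfolding J_def by linarith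
  also have "ln (x / y) / ln (1 + \<eta>) \<le> L / (\<eta> / 2)" using xy l \<eta> L by (intro frac_le) auto
  finally have "real J * \<eta> \<le> (L / (\<eta> / 2) + 1) * \<eta>" using \<eta> by (intro mult_right_mono) auto
  also have "\<dots> = 2 * L + \<eta>" using \<eta> by (simp add: field_simps)
  finally show ?thesis using \<eta> L by linarith
qed

definition root40 :: "nat \<Rightarrow> real" where "root40 j = P j powr (1/40)"

lemma root40: "root40 j \<ge> 2" "P j = root40 j ^ 40" "1 \<le> \<eta> * root40 j ^ 20" "1 / root40 j ^ 10 \<le> y powr (-1/4)"
proof -
  have pw: "root40 j ^ n = P j powr (real n / 40)" for n
    using P_pos[of j] by (simp add: root40_def powr_realpow[symmetric] powr_powr)
  show "P j = root40 j ^ 40" using pw[of 40] P_pos[of j] by simp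
  have "(2::real) = ((2::real) powr 40) powr (1/40)" by (subst powr_powr) simp
  also have "(2::real) powr 40 = 2 ^ 40" by (subst powr_numeral) auto
  also have "(2 ^ 40 :: real) powr (1/40) \<le> P j powr (1/40)" using y P_ge[of j] by (intro powr_mono2) auto
  finally show "root40 j \<ge> 2" by (simp add: root40_def)
  have "y powr (1/2) \<le> P j powr (1/2)" using y P_ge[of j] by (intro powr_mono2) auto
  hence "\<eta> * y powr (1/2) \<le> \<eta> * root40 j ^ 20" using \<eta> pw[of 20] by simp
  thus "1 \<le> \<eta> * root40 j ^ 20" using y by linarith
  have "1 / root40 j ^ 10 = P j powr (-1/4)" using pw[of 10] by (simp add: powr_minus_divide)
  also have "\<dots> \<le> y powr (-1/4)" using y P_ge[of j] by (intro powr_mono2') auto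
  finally show "1 / root40 j ^ 10 \<le> y powr (-1/4)" .
qed

lemma card_block_le: "real (card (prime_block P j)) \<le> 5760 * (\<eta> * P j) / ln (P j)"
  unfolding prime_block_def P_Suc by (rule card_prime_block_le[OF root40(1,2) \<eta>(1) root40(3)])

lemma card_block_le': "real (card (prime_block P j)) \<le> 5760 * (\<eta> * P j) / ln y"
proof -
  have "5760 * (\<eta> * P j) / ln (P j) \<le> 5760 * (\<eta> * P j) / ln y"
  proof (rule frac_le)
    show "0 \<le> 5760 * (\<eta> * P j)" using \<eta> P_pos[of j] by simp
    show "0 < ln y" using ln_y_ge by linarith
  qed (use ln_P_ge in auto)
  thus ?thesis using card_block_le[of j] by linarith
qed

lemma absorb_log:
  assumes "real H * P j \<le> x"
  shows "(P j / (x / real H)) powr (1/8) / ln (P j) \<le> 2 / L"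
  unfolding L(2)
  by (rule powr_div_ln_le) (use x_gt_1 ln_y_ge ln_P_ge[of j] P_pos[of j] H assms in auto)

lemma sum_blocks_le: "(\<Sum>j | j < J \<and> P j \<le> x / real H. \<eta> * (P j / (x / real H)) powr (1/8)) \<le> 20"
  unfolding P_def by (rule sum_geometric_blocks_le) (use \<eta> y x_gt_1 H in auto)

lemma H_P_iff: "real H * P j \<le> x \<longleftrightarrow> P j \<le> x / real H"
  using H by (simp add: le_divide_eq mult.commute)

text \<open>The factor \<open>sqrt (ln M / M)\<close> of the block at \<open>P j\<close> is bounded by \<open>sqrt (ln H / H)\<close> times \<open>2 u j * u j\<close>, where \<open>u j\<close> is a
  power of \<open>H P j / x\<close>; one \<open>u j\<close> turns \<open>1 / ln (P j)\<close> into \<open>2 / L\<close>, and the other one makes the sum over \<open>j\<close> geometric.\<close>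

lemma bilinear_total_le:
  fixes \<alpha> :: real and a q :: int and f :: "nat \<Rightarrow> complex"
  assumes aq: "coprime a q" "L powr (2 + \<epsilon>) \<le> real_of_int q" "real_of_int q \<le> x / L powr (3 + \<epsilon>)"
       "\<bar>\<alpha> - real_of_int a / real_of_int q\<bar> \<le> 1 / (real_of_int q * x)"
    and f: "unit_disc_valued f"
  shows "(\<Sum>j | j < J \<and> real H * P (Suc j) \<le> x. \<Sum>m\<in>{1..nat \<lfloor>x / P (Suc j)\<rfloor>}.
        cmod (twisted_sum (prime_block P j) f (real m * \<alpha>)))
     \<le> 8000000 * (x / L) * sqrt (ln (real H) / real H) + 300000 * (L * x * L powr (-1 - 3 * \<epsilon> / 16) / ln y)"
proof -
  define B where "B = (\<lambda>j. \<Sum>m\<in>{1..nat \<lfloor>x / P (Suc j)\<rfloor>}.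
        cmod (twisted_sum (prime_block P j) f (real m * \<alpha>)))"
  define t where "t = L powr (-1 - 3 * \<epsilon> / 16)"
  define h where "h = sqrt (ln (real H) / real H)"
  define u where "u = (\<lambda>j. (P j / (x / real H)) powr (1/8))"
  have t0: "t \<ge> 0" by (simp add: t_def)
  have h0: "h \<ge> 0" using H by (simp add: h_def)
  have x0: "x > 0" using x_gt_1 by simp
  have u0: "u j \<ge> 0" for j by (simp add: u_def)
  have lny: "ln y > 0" using ln_y_ge by linarith
  have L0: "L > 0" using L by linarith
  have blk: "B j \<le> 400000 * (x * h / L) * (\<eta> * u j) + 100000 * (\<eta> * x * t / ln y)"
    if j: "real H * P (Suc j) \<le> x" for j
  proof -
    define M where "M = nat \<lfloor>x / P (Suc j)\<rfloor>"
    have HPj: "real H * P j \<le> x"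
    proof -
      have "real H * P j \<le> real H * P (Suc j)" using incseqD[OF incseq_P, of j "Suc j"] by (intro mult_left_mono) auto
      thus ?thesis using j by linarith
    qed
    have xP: "real H \<le> x / P (Suc j)" using j P_pos[of "Suc j"] by (simp add: pos_le_divide_eq)
    have "H \<le> M" unfolding M_def using xP by (rule le_nat_floor)
    hence MH: "real H \<le> real M" by simp
    have H8: "8 \<le> real H" using H(2) by simp
    have M0: "real M > 0" using MH H8 by linarith
    have Mge: "x / P j / 4 \<le> real M"
    proof -
      have "real M \<ge> x / P (Suc j) - 1" using xP unfolding M_def by linarith
      moreover have "z / 2 \<le> m" if "z - 1 \<le> m" "8 \<le> m" for z m :: real using that by linarith
      ultimately have "x / P (Suc j) / 2 \<le> real M" using MH H8 by force
      moreover have "x / P j / 2 \<le> x / P (Suc j)"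
      proof -
        have "P (Suc j) \<le> 2 * P j" unfolding P_Suc using \<eta> P_pos[of j] by (intro mult_right_mono) auto
        hence "x / (2 * P j) \<le> x / P (Suc j)" using P_pos x0 by (intro divide_left_mono) auto
        thus ?thesis by (simp add: mult.commute)
      qed
      moreover have "a / 4 \<le> m" if "b / 2 \<le> m" "a / 2 \<le> b" for a b m :: real using that by linarith
      ultimately show ?thesis by blast
    qed
    have "B j \<le> 100000 * (\<eta> * x / ln (P j)) * (sqrt (ln (real M) / real M) + t)"
      unfolding B_def t_def M_def prime_block_def P_Suc
    proof (rule bilinear_block_sum_le)
      show "15 * ln L / L ^ 5 + 15 * ln L / L powr (2 + \<epsilon> / 2) + 1 / root40 j ^ 10 \<le> (L powr (-1 - 3 * \<epsilon> / 16))\<^sup>2"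
        using error_le root40(4)[of j] by linarith
      show "real H * ((1 + \<eta>) * P j) \<le> x" using j by (simp add: P_Suc)
    qed (use root40 \<eta> L \<eta>_eq \<epsilon> H aq f R_le in auto)
    also have "\<dots> \<le> 100000 * (\<eta> * x / ln (P j)) * (h * (2 * (u j * u j)) + t)"
    proof (intro mult_left_mono add_right_mono)
      have "sqrt (ln (real M) / real M) \<le> h * (real H / real M) powr (1/4)"
        unfolding h_def by (rule sqrt_ln_div_self_le[OF H8 MH])
      also have "\<dots> \<le> h * (2 * (u j * u j))"
      proof (intro mult_left_mono)
        have "real H / real M \<le> real H / (x / P j / 4)"
          using Mge M0 x0 P_pos[of j] by (intro divide_left_mono) auto
        also have "\<dots> = 4 * (P j / (x / real H))" by simp
        finally have "(real H / real M) powr (1/4) \<le> (4 * (P j / (x / real H))) powr (1/4)"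
          by (intro powr_mono2) auto
        also have "\<dots> = 4 powr (1/4) * (P j / (x / real H)) powr (1/4)" by (rule powr_mult)
        also have "\<dots> \<le> 2 * (P j / (x / real H)) powr (1/4)"
        proof (intro mult_right_mono)
          have "(4::real) powr (1/4) \<le> 4 powr (1/2)" by (intro powr_mono) auto
          thus "(4::real) powr (1/4) \<le> 2" by (simp add: powr_half_sqrt)
        qed auto
        also have "(P j / (x / real H)) powr (1/4) = u j * u j" by (simp add: u_def flip: powr_add)
        finally show "(real H / real M) powr (1/4) \<le> 2 * (u j * u j)" .
      qed (rule h0)
      finally show "sqrt (ln (real M) / real M) \<le> h * (2 * (u j * u j))" .
    qed (use \<eta> x0 ln_P_ge[of j] ln_y_ge in auto)
    also have "\<dots> = 200000 * (\<eta> * x * h * u j) * (u j / ln (P j)) + 100000 * (\<eta> * x * t / ln (P j))"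
      by (simp add: distrib_left)
    also have "\<dots> \<le> 200000 * (\<eta> * x * h * u j) * (2 / L) + 100000 * (\<eta> * x * t / ln y)"
    proof (intro add_mono mult_left_mono)
      show "u j / ln (P j) \<le> 2 / L" unfolding u_def by (rule absorb_log[OF HPj])
      show "\<eta> * x * t / ln (P j) \<le> \<eta> * x * t / ln y"
        using ln_P_ge[of j] lny \<eta> x0 t0 by (intro frac_le) auto
    qed (use \<eta> x0 h0 u0 in auto)
    finally show ?thesis by (simp add: mult_ac)
  qed
  define S where "S = {j. j < J \<and> real H * P (Suc j) \<le> x}"
  have cardS: "real (card S) \<le> real J"
    using card_mono[of "{..<J}" S] by (auto simp: S_def)
  have "(\<Sum>j\<in>S. B j) \<le> (\<Sum>j\<in>S. 400000 * (x * h / L) * (\<eta> * u j) + 100000 * (\<eta> * x * t / ln y))"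
    by (intro sum_mono blk) (simp add: S_def)
  also have "\<dots> = 400000 * (x * h / L) * (\<Sum>j\<in>S. \<eta> * u j) + real (card S) * (100000 * (\<eta> * x * t / ln y))"
    by (simp add: sum.distrib sum_distrib_left)
  also have "\<dots> \<le> 400000 * (x * h / L) * 20 + real J * (100000 * (\<eta> * x * t / ln y))"
  proof (intro add_mono mult_left_mono mult_right_mono)
    have "(\<Sum>j\<in>S. \<eta> * u j) \<le> (\<Sum>j | j < J \<and> P j \<le> x / real H. \<eta> * u j)"
    proof (rule sum_mono2)
      show "S \<subseteq> {j. j < J \<and> P j \<le> x / real H}"
      proof
        fix j assume j: "j \<in> S"
        have "real H * P j \<le> real H * P (Suc j)" using incseqD[OF incseq_P, of j "Suc j"] by (intro mult_left_mono) auto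
        thus "j \<in> {j. j < J \<and> P j \<le> x / real H}" using j unfolding S_def H_P_iff[symmetric] by auto
      qed
    qed (use \<eta> u0 in auto)
    thus "(\<Sum>j\<in>S. \<eta> * u j) \<le> 20" using sum_blocks_le unfolding u_def by linarith
  qed (use cardS x0 h0 L0 \<eta> t0 lny in auto)
  also have "real J * (100000 * (\<eta> * x * t / ln y)) = 100000 * (real J * \<eta>) * (x * t / ln y)" by simp
  also have "\<dots> \<le> 100000 * (3 * L) * (x * t / ln y)"
    using J_le x0 t0 lny by (intro mult_right_mono mult_left_mono) auto
  finally have "(\<Sum>j\<in>S. B j) \<le> 400000 * (x * h / L) * 20 + 100000 * (3 * L) * (x * t / ln y)" by simp
  thus ?thesis unfolding S_def B_def h_def t_def by (simp add: mult_ac)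
qed

end

lemma real_card_UN_le:
  assumes "finite I"
  shows "real (card (\<Union>i\<in>I. A i)) \<le> (\<Sum>i\<in>I. real (card (A i)))"
proof -
  have "real (card (\<Union>i\<in>I. A i)) \<le> real (\<Sum>i\<in>I. card (A i))"
    using card_UN_le[OF assms] of_nat_le_iff by blast
  thus ?thesis by simp
qed

context dissection
begin

abbreviation "N \<equiv> nat \<lfloor>x\<rfloor>"

lemma N: "N > 0" "real N \<le> x"
  using x_gt_1 by linarith+

text \<open>By the Brun--Titchmarsh bound each block contains at most \<open>Z * P j\<close> primes, so it accounts for at most
  \<open>x * Z\<^sup>2\<close> integers, and there are at most \<open>3 L / \<eta>\<close> blocks.  The extra factor \<open>\<eta>\<close> makes this negligible.\<close>

lemma card_two_primes_in_block_le:
  "real (card {n\<in>{1..N}. \<exists>j<J. \<exists>p\<in>prime_block P j. \<exists>p'\<in>prime_block P j. p * p' dvd n})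
     \<le> 3 * 5760 ^ 2 * (L * \<eta> * x / ln y ^ 2)"
proof -
  have x0: "x > 0" using x_gt_1 by simp
  have lny: "ln y > 0" using ln_y_ge by linarith
  define B where "B = prime_block P"
  define Z where "Z = 5760 * \<eta> / ln y"
  have sub: "{n\<in>{1..N}. \<exists>j<J. \<exists>p\<in>B j. \<exists>p'\<in>B j. p * p' dvd n}
     = (\<Union>j\<in>{..<J}. \<Union>(p,p')\<in>B j \<times> B j. {n\<in>{1..N}. p * p' dvd n})"
    by auto
  have blk: "real (card (\<Union>(p,p')\<in>B j \<times> B j. {n\<in>{1..N}. p * p' dvd n})) \<le> x * Z ^ 2" for j
  proof -
    have finB: "finite (B j \<times> B j)" by (simp add: B_def)
    have "real (card (\<Union>(p,p')\<in>B j \<times> B j. {n\<in>{1..N}. p * p' dvd n}))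
        \<le> (\<Sum>z\<in>B j \<times> B j. real (card (case z of (p,p') \<Rightarrow> {n\<in>{1..N}. p * p' dvd n})))"
      by (rule real_card_UN_le[OF finB])
    also have "\<dots> \<le> (\<Sum>z\<in>B j \<times> B j. x / P j ^ 2)"
    proof (intro sum_mono)
      fix z assume "z \<in> B j \<times> B j"
      then obtain p p' where z: "z = (p, p')" "p \<in> B j" "p' \<in> B j" by auto
      have pp: "P j < real p" "P j < real p'" "p * p' > 0"
        using z prime_gt_0_nat by (auto simp: B_def prime_block_def)
      have "real (card {n\<in>{1..N}. p * p' dvd n}) \<le> x / real (p * p')"
        by (rule real_card_multiples_le[OF pp(3) N(2)])
      also have "\<dots> \<le> x / P j ^ 2"
      proof (rule divide_left_mono)
        show "P j ^ 2 \<le> real (p * p')" using pp P_pos[of j] by (simp add: power2_eq_square mult_mono less_imp_le)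
      qed (use x0 pp P_pos[of j] in auto)
      finally show "real (card (case z of (p,p') \<Rightarrow> {n\<in>{1..N}. p * p' dvd n})) \<le> x / P j ^ 2" by (simp add: z)
    qed
    also have "\<dots> = real (card (B j)) ^ 2 * (x / P j ^ 2)" by (simp add: card_cartesian_product power2_eq_square)
    also have "\<dots> \<le> (Z * P j) ^ 2 * (x / P j ^ 2)"
    proof (intro mult_right_mono power_mono)
      show "real (card (B j)) \<le> Z * P j" using card_block_le'[of j] by (simp add: B_def Z_def mult_ac)
    qed (use x0 in auto)
    also have "\<dots> = x * Z ^ 2" using P_pos[of j] by (simp add: power_mult_distrib)
    finally show ?thesis .
  qed
  have "real (card (\<Union>j\<in>{..<J}. \<Union>(p,p')\<in>B j \<times> B j. {n\<in>{1..N}. p * p' dvd n}))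
     \<le> (\<Sum>j\<in>{..<J}. real (card (\<Union>(p,p')\<in>B j \<times> B j. {n\<in>{1..N}. p * p' dvd n})))"
    by (rule real_card_UN_le) simp
  also have "\<dots> \<le> (\<Sum>j\<in>{..<J}. x * Z ^ 2)" by (intro sum_mono blk)
  also have "\<dots> = (real J * \<eta>) * (5760 ^ 2 * \<eta> * x / ln y ^ 2)"
    by (simp add: Z_def power2_eq_square)
  also have "\<dots> \<le> (3 * L) * (5760 ^ 2 * \<eta> * x / ln y ^ 2)"
    using J_le \<eta> x0 lny by (intro mult_right_mono) auto
  also have "\<dots> = 3 * 5760 ^ 2 * (L * \<eta> * x / ln y ^ 2)" by simp
  finally have "real (card (\<Union>j\<in>{..<J}. \<Union>(p,p')\<in>B j \<times> B j. {n\<in>{1..N}. p * p' dvd n}))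
     \<le> 3 * 5760 ^ 2 * (L * \<eta> * x / ln y ^ 2)" .
  thus ?thesis unfolding sub[symmetric] unfolding B_def .
qed

lemma I_le: "real I + 1 \<le> 3 * ln (real H)"
proof -
  have l2: "ln (2::real) \<ge> 1/2" using ln_le_minus_one[of "1/2::real"] by (simp add: ln_div)
  have lH: "ln (real H) = real I * ln 2" by (simp add: H(1) ln_realpow)
  have "real I * (1/2) \<le> real I * ln 2" using l2 by (intro mult_left_mono) auto
  hence 1: "real I \<le> 2 * ln (real H)" using lH by linarith
  have "exp (1::real) \<le> real H" using exp_le H(2) by linarith
  hence "ln (real H) \<ge> 1" using H(2) by (subst ln_ge_iff) auto
  thus ?thesis using 1 by linarith
qed

text \<open>In the block at \<open>P j\<close> there are at most \<open>2 \<eta> x / P j + I + 1\<close> values of \<open>m\<close> near the hyperbola.  The first part has an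
  extra factor \<open>\<eta>\<close>.  The second one, of order \<open>ln H\<close>, matters for the largest primes only and yields
  \<open>ln H / H \<le> sqrt (ln H / H)\<close>.\<close>

lemma card_hyperbola_edge_le:
  "real (card {n\<in>{1..N}. \<exists>j<J. \<exists>p\<in>prime_block P j. \<exists>m\<ge>1. n = m * p \<and>
        real (dyadic_scale H m) * P j < x \<and> x < real (dyadic_scale H m) * P (Suc j)})
     \<le> 700000 * (x / L) * sqrt (ln (real H) / real H) + 34560 * (L * \<eta> * x / ln y)"
proof -
  have x0: "x > 0" using x_gt_1 by simp
  have L0: "L > 0" using L by linarith
  have lny: "ln y > 0" using ln_y_ge by linarith
  define B where "B = prime_block P"
  define E where "E = (\<lambda>j. {m. m \<ge> 1 \<and> x / P (Suc j) < real (dyadic_scale (2 ^ I) m) \<and> real (dyadic_scale (2 ^ I) m) < x / P j})"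
  define S where "S = {j. j < J \<and> P j \<le> x / real H}"
  define u where "u = (\<lambda>j. (P j / (x / real H)) powr (1/8))"
  have finS: "finite S" by (simp add: S_def)
  have u0: "u j \<ge> 0" for j by (simp add: u_def)
  have Euv: "0 \<le> x / P (Suc j)" "x / P (Suc j) \<le> x / P j" for j
    using x0 P_pos[of j] P_pos[of "Suc j"] incseqD[OF incseq_P, of j "Suc j"]
    by (auto intro!: divide_left_mono)
  have cE: "finite (E j)" "real (card (E j)) \<le> 2 * (x / P j - x / P (Suc j)) + real I + 1" for j
    using card_dyadic_scale_interval_le[OF Euv, of j I] unfolding E_def by blast+
  have cardE: "real (card (E j)) \<le> 2 * (\<eta> * x / P j) + 3 * ln (real H)" for j
  proof -
    have "x / P j - x / P (Suc j) = x / P j * (1 - 1 / (1 + \<eta>))" unfolding P_Suc by (simp add: right_diff_distrib mult.commute)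
    also have "\<dots> \<le> x / P j * \<eta>"
    proof (rule mult_left_mono)
      show "1 - 1 / (1 + \<eta>) \<le> \<eta>" using \<eta> by (simp add: field_simps)
    qed (use x0 P_pos[of j] in auto)
    finally have "x / P j - x / P (Suc j) \<le> x / P j * \<eta>" .
    hence d: "x / P j - x / P (Suc j) \<le> \<eta> * x / P j" by (simp add: mult.commute)
    have "c \<le> 2 * g + 3 * l" if "d \<le> g" "c \<le> 2 * d + i + 1" "i + 1 \<le> 3 * l" for c d g i l :: real
      using that by linarith
    from this[OF d cE(2) I_le] show ?thesis .
  qed
  have sub: "{n\<in>{1..N}. \<exists>j<J. \<exists>p\<in>B j. \<exists>m\<ge>1. n = m * p \<and>
        real (dyadic_scale H m) * P j < x \<and> x < real (dyadic_scale H m) * P (Suc j)}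
      \<subseteq> (\<Union>j\<in>S. (\<lambda>(m,p). m * p) ` (E j \<times> B j))"
  proof
    fix n assume "n \<in> {n\<in>{1..N}. \<exists>j<J. \<exists>p\<in>B j. \<exists>m\<ge>1. n = m * p \<and>
        real (dyadic_scale H m) * P j < x \<and> x < real (dyadic_scale H m) * P (Suc j)}"
    then obtain j p m where n: "j < J" "p \<in> B j" "m \<ge> 1" "n = m * p"
        "real (dyadic_scale H m) * P j < x" "x < real (dyadic_scale H m) * P (Suc j)" by blast
    have "m \<in> E j" using n P_pos[of j] P_pos[of "Suc j"]
      by (simp add: E_def H(1) pos_divide_less_eq pos_less_divide_eq)
    moreover have "real H * P j \<le> x"
    proof -
      have "real H * P j \<le> real (dyadic_scale H m) * P j"
        using le_dyadic_scale[OF n(3), of H] P_pos[of j] by (intro mult_right_mono) auto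
      thus ?thesis using n(5) by linarith
    qed
    hence "j \<in> S" using n(1) by (simp add: S_def H_P_iff)
    ultimately show "n \<in> (\<Union>j\<in>S. (\<lambda>(m,p). m * p) ` (E j \<times> B j))" using n(2,4) by blast
  qed
  have finE: "finite (E j \<times> B j)" for j using cE(1)[of j] by (simp add: B_def)
  have blk: "real (card ((\<lambda>(m,p). m * p) ` (E j \<times> B j))) \<le> 11520 * (\<eta> * (\<eta> * x / ln y)) + 34560 * (x / L) * (ln (real H) / real H) * (\<eta> * u j)"
    if j: "j \<in> S" for j
  proof -
    have lnP: "ln (P j) > 0" using ln_P_ge[of j] lny by linarith
    have HP: "real H * P j \<le> x" using j by (simp add: S_def H_P_iff)
    have lnH: "ln (real H) \<ge> 0" using H(2) by simp
    have "card ((\<lambda>(m,p). m * p) ` (E j \<times> B j)) \<le> card (E j) * card (B j)"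
      using card_image_le[OF finE] by (simp add: card_cartesian_product)
    hence "real (card ((\<lambda>(m,p). m * p) ` (E j \<times> B j))) \<le> real (card (E j)) * real (card (B j))"
      by (metis of_nat_le_iff of_nat_mult)
    also have "\<dots> \<le> (2 * (\<eta> * x / P j) + 3 * ln (real H)) * (5760 * (\<eta> * P j) / ln (P j))"
      using cardE card_block_le[of j] lnH \<eta> x0 P_pos[of j] lnP unfolding B_def by (intro mult_mono) auto
    also have "\<dots> = 11520 * (\<eta> * (\<eta> * x / ln (P j))) + 17280 * (ln (real H) * \<eta> * (P j / ln (P j)))"
      using P_pos[of j] lnP by (simp add: field_simps)
    also have "\<dots> \<le> 11520 * (\<eta> * (\<eta> * x / ln y)) + 17280 * (ln (real H) * \<eta> * ((x / real H) * u j * (2 / L)))"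
    proof (intro add_mono mult_left_mono)
      show "\<eta> * x / ln (P j) \<le> \<eta> * x / ln y" using ln_P_ge[of j] lny \<eta> x0 by (intro frac_le) auto
      define v where "v = P j / (x / real H)"
      have v: "0 < v" "v \<le> 1" using HP x0 H(2) P_pos[of j] by (auto simp: v_def mult.commute)
      have "v = v powr 1" using v by simp
      also have "\<dots> \<le> v powr (1/4)" using v by (intro powr_mono') auto
      also have "v powr (1/4) = u j * u j" by (simp add: u_def v_def flip: powr_add)
      finally have vu: "v \<le> u j * u j" .
      have "P j = (x / real H) * v" using x0 H(2) by (simp add: v_def)
      hence "P j / ln (P j) = (x / real H) * v / ln (P j)" by simp
      also have "\<dots> \<le> (x / real H) * (u j * u j) / ln (P j)" using vu x0 lnP by (intro divide_right_mono mult_left_mono) auto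
      also have "\<dots> = (x / real H) * u j * (u j / ln (P j))" by simp
      also have "\<dots> \<le> (x / real H) * u j * (2 / L)"
        using absorb_log[OF HP] x0 u0 by (intro mult_left_mono) (auto simp: u_def)
      finally show "P j / ln (P j) \<le> (x / real H) * u j * (2 / L)" .
    qed (use \<eta> lnH in auto)
    finally show ?thesis by (simp add: mult_ac)
  qed
  define h where "h = ln (real H) / real H"
  have h: "0 \<le> h" "h \<le> sqrt h"
  proof -
    show "0 \<le> h" using H(2) by (simp add: h_def)
    have "ln (real H) \<le> real H" using H(2) ln_le_minus_one[of "real H"] by simp
    hence h1: "h \<le> 1" using H(2) by (simp add: h_def)
    have "h ^ 2 \<le> h" using \<open>0 \<le> h\<close> h1 mult_left_mono[of h 1 h] by (simp add: power2_eq_square)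
    thus "h \<le> sqrt h" by (rule real_le_rsqrt)
  qed
  have cardS: "real (card S) \<le> real J"
    using card_mono[of "{..<J}" S] by (auto simp: S_def)
  have "real (card {n\<in>{1..N}. \<exists>j<J. \<exists>p\<in>B j. \<exists>m\<ge>1. n = m * p \<and>
        real (dyadic_scale H m) * P j < x \<and> x < real (dyadic_scale H m) * P (Suc j)})
     \<le> real (card (\<Union>j\<in>S. (\<lambda>(m,p). m * p) ` (E j \<times> B j)))"
    by (intro of_nat_mono card_mono[OF _ sub]) (use finS finE in auto)
  also have "\<dots> \<le> (\<Sum>j\<in>S. real (card ((\<lambda>(m,p). m * p) ` (E j \<times> B j))))" by (rule real_card_UN_le[OF finS])
  also have "\<dots> \<le> (\<Sum>j\<in>S. 11520 * (\<eta> * (\<eta> * x / ln y)) + 34560 * (x / L) * h * (\<eta> * u j))"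
    unfolding h_def by (intro sum_mono blk)
  also have "\<dots> = real (card S) * (11520 * (\<eta> * (\<eta> * x / ln y))) + 34560 * (x / L) * h * (\<Sum>j\<in>S. \<eta> * u j)"
    by (simp add: sum.distrib sum_distrib_left)
  also have "\<dots> \<le> real J * (11520 * (\<eta> * (\<eta> * x / ln y))) + 34560 * (x / L) * h * 20"
  proof (intro add_mono mult_left_mono mult_right_mono)
    show "(\<Sum>j\<in>S. \<eta> * u j) \<le> 20" using sum_blocks_le unfolding S_def u_def .
  qed (use cardS x0 h L0 \<eta> lny in auto)
  also have "real J * (11520 * (\<eta> * (\<eta> * x / ln y))) = 11520 * (real J * \<eta>) * (\<eta> * x / ln y)" by simp
  also have "11520 * (real J * \<eta>) * (\<eta> * x / ln y) + 34560 * (x / L) * h * 20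
     \<le> 11520 * (3 * L) * (\<eta> * x / ln y) + 700000 * (x / L) * sqrt h"
  proof (rule add_mono)
    show "11520 * (real J * \<eta>) * (\<eta> * x / ln y) \<le> 11520 * (3 * L) * (\<eta> * x / ln y)"
      using J_le \<eta> x0 lny by (intro mult_right_mono mult_left_mono) auto
    have xL: "x / L \<ge> 0" using x0 L0 by simp
    have "34560 * (x / L) * h * 20 = 691200 * (x / L) * h" by simp
    also have "\<dots> \<le> 700000 * (x / L) * sqrt h" using h xL by (intro mult_mono) auto
    finally show "34560 * (x / L) * h * 20 \<le> 700000 * (x / L) * sqrt h" .
  qed
  finally show ?thesis unfolding B_def h_def by (simp add: mult_ac)
qed

lemma exp_sum_le_large_primes:
  fixes \<alpha> :: real and a q :: int and f :: "nat \<Rightarrow> complex"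
  assumes aq: "coprime a q" "L powr (2 + \<epsilon>) \<le> real_of_int q" "real_of_int q \<le> x / L powr (3 + \<epsilon>)"
       "\<bar>\<alpha> - real_of_int a / real_of_int q\<bar> \<le> 1 / (real_of_int q * x)"
    and f: "multiplicative_fun f" "unit_disc_valued f"
  shows "cmod (exp_sum f \<alpha> x) \<le>
     (\<Sum>m\<in>{1..<H}. cmod (twisted_sum {p. prime p \<and> x < real (dyadic_scale H m) * real p \<and> real m * real p \<le> x} f (real m * \<alpha>)))
   + 10000000 * (x / L) * sqrt (ln (real H) / real H)
   + 300000 * (L * x * L powr (-1 - 3 * \<epsilon> / 16) / ln y) + 34560 * (L * \<eta> * x / ln y)
   + 3 * 5760 ^ 2 * (L * \<eta> * x / ln y ^ 2)
   + real (card {n\<in>{1..N}. \<forall>p. prime p \<longrightarrow> p dvd n \<longrightarrow> real p \<le> y})"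
proof -
  have "y \<ge> 1" using y(1) by (smt (verit) one_le_power)
  hence P1: "P 0 \<ge> 1" by (simp add: P_def)
  have P0: "P 0 = y" by (simp add: P_def)
  have h: "(x / L) * sqrt (ln (real H) / real H) \<ge> 0" using x_gt_1 L H(2) by simp
  have "cmod (exp_sum f \<alpha> x) \<le>
     (\<Sum>m\<in>{1..<H}. cmod (twisted_sum {p. prime p \<and> x < real (dyadic_scale H m) * real p \<and> real m * real p \<le> x} f (real m * \<alpha>)))
   + (\<Sum>j | j < J \<and> real H * P (Suc j) \<le> x. \<Sum>m\<in>{1..nat \<lfloor>x / P (Suc j)\<rfloor>}.
        cmod (twisted_sum (prime_block P j) f (real m * \<alpha>)))
   + real (card {n\<in>{1..N}. \<forall>p. prime p \<longrightarrow> p dvd n \<longrightarrow> real p \<le> P 0})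
   + real (card {n\<in>{1..N}. \<exists>j<J. \<exists>p\<in>prime_block P j. \<exists>p'\<in>prime_block P j. p * p' dvd n})
   + real (card {n\<in>{1..N}. \<exists>j<J. \<exists>p\<in>prime_block P j. \<exists>m\<ge>1. n = m * p \<and>
        real (dyadic_scale H m) * P j < x \<and> x < real (dyadic_scale H m) * P (Suc j)})"
    (is "_ \<le> ?T + ?B + ?n0 + ?n1 + ?n3")
    by (rule exp_sum_decomposition[OF f incseq_P P1 x_le_P_J _ H(3)])
      (use H(2) in \<open>simp_all add: le_dyadic_scale self_le_dyadic_scale dyadic_scale_eq_self dyadic_scale_less\<close>)
  moreover have "S \<le> T + 10000000 * g + c1 + c2 + c3 + n0"
    if "S \<le> T + B + n0 + n1 + n3" "B \<le> 8000000 * g + c1" "n1 \<le> c3"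
      "n3 \<le> 700000 * g + c2" "0 \<le> g" for S T B n0 n1 n3 c1 c2 c3 g :: real
    using that by linarith
  ultimately show ?thesis
    using bilinear_total_le[OF aq f(2)] card_two_primes_in_block_le card_hyperbola_edge_le h
    unfolding P0 mult.assoc by blast
qed

end

section \<open>Asymptotics of the error terms\<close>

text \<open>The choice \<open>X = x / L\<^sup>2\<close>, \<open>V\<close> about \<open>5 ln L\<close> and \<open>B = X powr (1/V)\<close> in the bound for smooth numbers.\<close>

lemma card_smooth_exp_le:
  fixes x y L :: real and N :: nat
  assumes N: "N > 0" "real N \<le> x" and L: "L = ln x" "L \<ge> 8" "2 * ln L \<le> L" and y: "y \<ge> 0"
  shows "real (card {n\<in>{1..N}. \<forall>p. prime p \<longrightarrow> p dvd n \<longrightarrow> real p \<le> y})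
     \<le> x * (1 / L ^ 2 + (L + 1) / L powr (5/2) + y / exp ((L - 2 * ln L) / (5 * ln L + 1)))"
proof -
  define V where "V = nat \<lceil>5 * ln L\<rceil>"
  define X where "X = x / L ^ 2"
  define B where "B = exp ((L - 2 * ln L) / V)"
  have lnL: "ln L > 0" using L by simp
  have V: "5 * ln L \<le> real V" "real V \<le> 5 * ln L + 1" using lnL unfolding V_def by linarith+
  have V0: "real V > 0" using V lnL by linarith
  have x0: "x > 0" using N by linarith
  have BV: "B ^ V = X"
  proof -
    have "B ^ V = exp (L - 2 * ln L)" unfolding B_def using V0 by (simp flip: exp_of_nat_mult)
    also have "\<dots> = exp L / exp (ln L) ^ 2" by (simp add: exp_diff exp_double)
    also have "exp L = x" using L(1) x0 by simp
    also have "exp (ln L) = L" using L(2) by simp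
    finally show ?thesis by (simp add: X_def)
  qed
  have B1: "B \<ge> 1" unfolding B_def using L V0 by simp
  have "real (card {n\<in>{1..N}. \<forall>p. prime p \<longrightarrow> p dvd n \<longrightarrow> real p \<le> y}) \<le> X + x * (ln x + 1) / 2 ^ V + y * x / B"
    by (rule card_smooth_le[OF N B1 _ y]) (simp add: BV)
  also have "\<dots> \<le> x * (1 / L ^ 2) + x * ((L + 1) / L powr (5/2)) + x * (y / exp ((L - 2 * ln L) / (5 * ln L + 1)))"
  proof (intro add_mono)
    show "X \<le> x * (1 / L ^ 2)" by (simp add: X_def)
    have l2: "ln (2::real) \<ge> 1/2" using ln_le_minus_one[of "1/2::real"] by (simp add: ln_div)
    have "5/2 * ln L = 5 * ln L * (1/2)" by simp
    also have "\<dots> \<le> real V * ln 2" using V l2 lnL by (intro mult_mono) auto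
    finally have "exp (5/2 * ln L) \<le> exp (real V * ln 2)" by simp
    hence "L powr (5/2) \<le> 2 ^ V" using L by (simp add: powr_def exp_of_nat_mult)
    moreover have "L powr (5/2) > 0" using L by simp
    ultimately have "(L + 1) / 2 ^ V \<le> (L + 1) / L powr (5/2)" using L by (intro frac_le) auto
    from mult_left_mono[OF this, of x] show "x * (ln x + 1) / 2 ^ V \<le> x * ((L + 1) / L powr (5/2))"
      using x0 L by simp
    have "exp ((L - 2 * ln L) / (5 * ln L + 1)) \<le> B"
      unfolding B_def using V V0 L by (simp add: divide_left_mono)
    hence "y / B \<le> y / exp ((L - 2 * ln L) / (5 * ln L + 1))" using y by (intro divide_left_mono) (auto simp: B_def)
    from mult_left_mono[OF this, of x] show "y * x / B \<le> x * (y / exp ((L - 2 * ln L) / (5 * ln L + 1)))"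
      using x0 by (simp add: mult.commute)
  qed
  finally show ?thesis by (simp add: distrib_left)
qed

text \<open>All error terms are \<open>x\<close> times a function of \<open>L = ln x\<close> that is \<open>o(1/L)\<close>; the predicate \<open>good\<close> collects what is needed
  of \<open>L\<close>.  There are six error terms of size at most \<open>d x / L\<close>, hence \<open>d = \<delta> / 6\<close>.\<close>

lemma large_primes_carry_exp_sum:
  fixes \<epsilon> \<delta> :: real and H I :: nat
  assumes \<epsilon>: "0 < \<epsilon>" "\<epsilon> < 1/10" and H: "H = 2 ^ I" "8 \<le> H" and \<delta>: "\<delta> > 0"
  shows "\<forall>\<^sub>F x :: real in at_top. \<forall>(\<alpha> :: real) (a :: int) (q :: int) (f :: nat \<Rightarrow> complex).
      coprime a q \<longrightarrow> ln x powr (2 + \<epsilon>) \<le> real_of_int q \<longrightarrow> real_of_int q \<le> x / ln x powr (3 + \<epsilon>) \<longrightarrow>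
      \<bar>\<alpha> - real_of_int a / real_of_int q\<bar> \<le> 1 / (real_of_int q * x) \<longrightarrow>
      multiplicative_fun f \<longrightarrow> unit_disc_valued f \<longrightarrow>
      cmod (exp_sum f \<alpha> x) \<le>
       (\<Sum>m\<in>{1..<H}. cmod (twisted_sum {p. prime p \<and> x < real (dyadic_scale H m) * real p \<and> real m * real p \<le> x} f (real m * \<alpha>)))
       + 10000000 * (x / ln x) * sqrt (ln (real H) / real H) + \<delta> * (x / ln x)"
proof -
  define d where "d = \<delta> / 6"
  have d: "d > 0" using \<delta> by (simp add: d_def)
  have h: "real H > 0" using H by simp
  define good where "good = (\<lambda>L::real. L \<ge> 8 \<and> 2 ^ 40 \<le> exp (L powr (1 - \<epsilon> / 16)) \<and> exp (L powr (1 - \<epsilon> / 16)) \<le> exp L \<and>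
     1 \<le> L powr (-1 - \<epsilon> / 4) * exp (L powr (1 - \<epsilon> / 16)) powr (1/2) \<and>
     2 * real H ^ 2 \<le> exp L \<and> (real H / sqrt (exp L)) powr (1/8) \<le> 2 / L \<and>
     15 * ln L / L ^ 5 + 15 * ln L / L powr (2 + \<epsilon> / 2) + exp (L powr (1 - \<epsilon> / 16)) powr (-1/4) \<le> (L powr (-1 - 3 * \<epsilon> / 16))\<^sup>2 \<and>
     L powr (2 + \<epsilon> / 2) \<le> L powr (2 + 3 * \<epsilon> / 4) / 8 \<and>
     2 * ln L \<le> L \<and>
     300000 * (L * L powr (-1 - 3 * \<epsilon> / 16) / L powr (1 - \<epsilon> / 16)) \<le> d / L \<and>
     34560 * (L * L powr (-1 - \<epsilon> / 4) / L powr (1 - \<epsilon> / 16)) \<le> d / L \<and>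
     3 * 5760 ^ 2 * (L * L powr (-1 - \<epsilon> / 4) / (L powr (1 - \<epsilon> / 16)) ^ 2) \<le> d / L \<and>
     1 / L ^ 2 \<le> d / L \<and> (L + 1) / L powr (5/2) \<le> d / L \<and>
     exp (L powr (1 - \<epsilon> / 16)) / exp ((L - 2 * ln L) / (5 * ln L + 1)) \<le> d / L)"
  have "eventually good at_top"
    unfolding good_def
  by (intro eventually_conj; use \<epsilon> d h in real_asymp)
  hence "\<forall>\<^sub>F x::real in at_top. good (ln x)" using ln_at_top by (rule eventually_compose_filterlim)
  moreover have "\<forall>\<^sub>F x::real in at_top. x > 1" by (rule eventually_gt_at_top)
  ultimately show ?thesis
  proof eventually_elim
    case (elim x)
    define L where "L = ln x"
    define y where "y = exp (L powr (1 - \<epsilon> / 16))"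
    define \<eta> where "\<eta> = L powr (-1 - \<epsilon> / 4)"
    have xL: "x = exp L" using elim(2) by (simp add: L_def)
    have G: "good L" using elim(1) by (simp add: L_def)
    note G = G[unfolded good_def]
    have L8: "L \<ge> 8" using G by blast
    have x0: "x > 0" using elim(2) by simp
    interpret dissection x \<epsilon> \<eta> y L H I
      by unfold_locales (use G \<epsilon> H in \<open>simp_all only: L_def[symmetric] \<eta>_def y_def xL[symmetric] simp_thms\<close>)
    have lny: "ln y = L powr (1 - \<epsilon> / 16)" by (simp add: y_def)
    have err: "300000 * (L * x * L powr (-1 - 3 * \<epsilon> / 16) / ln y) \<le> x * (d / L)"
      "34560 * (L * \<eta> * x / ln y) \<le> x * (d / L)"
      "3 * 5760 ^ 2 * (L * \<eta> * x / ln y ^ 2) \<le> x * (d / L)"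
    proof -
      have G': "300000 * (L * L powr (-1 - 3 * \<epsilon> / 16) / L powr (1 - \<epsilon> / 16)) \<le> d / L"
        "34560 * (L * L powr (-1 - \<epsilon> / 4) / L powr (1 - \<epsilon> / 16)) \<le> d / L"
        "3 * 5760 ^ 2 * (L * L powr (-1 - \<epsilon> / 4) / (L powr (1 - \<epsilon> / 16)) ^ 2) \<le> d / L" using G by blast+
      show "300000 * (L * x * L powr (-1 - 3 * \<epsilon> / 16) / ln y) \<le> x * (d / L)"
        using mult_left_mono[OF G'(1), of x] x0 unfolding lny by (simp add: mult_ac)
      show "34560 * (L * \<eta> * x / ln y) \<le> x * (d / L)"
        using mult_left_mono[OF G'(2), of x] x0 unfolding lny \<eta>_def by (simp add: mult_ac)
      show "3 * 5760 ^ 2 * (L * \<eta> * x / ln y ^ 2) \<le> x * (d / L)"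
        using mult_left_mono[OF G'(3), of x] x0 unfolding lny \<eta>_def by (simp add: mult_ac)
    qed
    have smooth: "real (card {n\<in>{1..nat \<lfloor>x\<rfloor>}. \<forall>p. prime p \<longrightarrow> p dvd n \<longrightarrow> real p \<le> y}) \<le> 3 * (x * (d / L))"
    proof -
      have g: "2 * ln L \<le> L" "1 / L ^ 2 \<le> d / L" "(L + 1) / L powr (5/2) \<le> d / L"
        "exp (L powr (1 - \<epsilon> / 16)) / exp ((L - 2 * ln L) / (5 * ln L + 1)) \<le> d / L" using G by blast+
      have "real (card {n\<in>{1..nat \<lfloor>x\<rfloor>}. \<forall>p. prime p \<longrightarrow> p dvd n \<longrightarrow> real p \<le> y})
         \<le> x * (1 / L ^ 2 + (L + 1) / L powr (5/2) + y / exp ((L - 2 * ln L) / (5 * ln L + 1)))"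
        by (rule card_smooth_exp_le[OF N L_def L8 g(1)]) (simp add: y_def)
      also have "\<dots> \<le> x * (d / L + d / L + d / L)"
        using g x0 unfolding y_def by (intro mult_left_mono add_mono) auto
      finally show ?thesis by (simp add: mult_ac)
    qed
    show ?case
    proof (intro allI impI)
      fix \<alpha> :: real and a q :: int and f :: "nat \<Rightarrow> complex"
      assume as: "coprime a q" "ln x powr (2 + \<epsilon>) \<le> real_of_int q" "real_of_int q \<le> x / ln x powr (3 + \<epsilon>)"
        "\<bar>\<alpha> - real_of_int a / real_of_int q\<bar> \<le> 1 / (real_of_int q * x)" "multiplicative_fun f" "unit_disc_valued f"
      have six: "x * (d / L) + x * (d / L) + x * (d / L) + 3 * (x * (d / L)) = \<delta> * (x / ln x)"
        by (simp add: d_def L_def)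
      show "cmod (exp_sum f \<alpha> x) \<le>
       (\<Sum>m\<in>{1..<H}. cmod (twisted_sum {p. prime p \<and> x < real (dyadic_scale H m) * real p \<and> real m * real p \<le> x} f (real m * \<alpha>)))
       + 10000000 * (x / ln x) * sqrt (ln (real H) / real H) + \<delta> * (x / ln x)"
        using exp_sum_le_large_primes[OF as[folded L_def]] err smooth six unfolding L_def[symmetric] by linarith
    qed
  qed
qed

section \<open>A large dyadic prime sum\<close>

text \<open>Multiplying the boundary \<open>m 2 ^ e\<close> by \<open>2\<close> adds exactly one dyadic interval below the previous ones.\<close>

lemma sum_primes_dyadic:
  fixes x :: real and m :: nat and g :: "nat \<Rightarrow> complex"
  assumes m: "m \<ge> 1" and x: "x > 0"
  shows "(\<Sum>p | prime p \<and> x < real (m * 2 ^ e) * real p \<and> real m * real p \<le> x. g p)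
     = (\<Sum>i<e. \<Sum>p | prime p \<and> x / (real m * 2 ^ Suc i) < real p \<and> real p \<le> 2 * (x / (real m * 2 ^ Suc i)). g p)"
proof (induction e)
  case 0
  have empty: "{p. prime p \<and> x < real (m * 2 ^ 0) * real p \<and> real m * real p \<le> x} = {}" by auto
  show ?case unfolding empty by simp
next
  case (Suc e)
  define A where "A = (\<lambda>e. {p. prime p \<and> x < real (m * 2 ^ e) * real p \<and> real m * real p \<le> x})"
  define D where "D = {p. prime p \<and> x / (real m * 2 ^ Suc e) < real p \<and> real p \<le> 2 * (x / (real m * 2 ^ Suc e))}"
  have m0: "real m > 0" using m by simp
  have finA: "finite (A e)" for e
  proof (rule finite_subset)
    show "A e \<subseteq> {..nat \<lfloor>x\<rfloor>}"
    proof
      fix p assume p: "p \<in> A e"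
      have "1 * real p \<le> real m * real p" using m by (intro mult_right_mono) auto
      thus "p \<in> {..nat \<lfloor>x\<rfloor>}" using p by (simp add: A_def le_nat_floor)
    qed
  qed simp
  have D: "p \<in> D \<longleftrightarrow> prime p \<and> x < real (m * 2 ^ Suc e) * real p \<and> real (m * 2 ^ e) * real p \<le> x" for p
    unfolding D_def using m0 by (simp add: pos_divide_less_eq pos_le_divide_eq mult_ac)
  have mono: "real m * real p \<le> real (m * 2 ^ e) * real p" "real (m * 2 ^ e) * real p \<le> real (m * 2 ^ Suc e) * real p" for p
  proof -
    have "m \<le> m * 2 ^ e" "m * 2 ^ e \<le> m * 2 ^ Suc e" by simp_all
    thus "real m * real p \<le> real (m * 2 ^ e) * real p" "real (m * 2 ^ e) * real p \<le> real (m * 2 ^ Suc e) * real p"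
      using of_nat_le_iff by (blast intro: mult_right_mono of_nat_0_le_iff)+
  qed
  have AS: "A (Suc e) = A e \<union> D"
  proof (intro equalityI subsetI)
    fix p assume p: "p \<in> A (Suc e)"
    show "p \<in> A e \<union> D"
    proof (cases "x < real (m * 2 ^ e) * real p")
      case True
      thus ?thesis using p by (simp add: A_def)
    next
      case False
      hence "p \<in> D" using p unfolding D A_def by simp
      thus ?thesis by simp
    qed
  next
    fix p assume "p \<in> A e \<union> D"
    thus "p \<in> A (Suc e)"
    proof
      assume p: "p \<in> A e"
      hence "x < real (m * 2 ^ Suc e) * real p" using mono(2)[of p] by (simp only: A_def mem_Collect_eq) linarith
      thus ?thesis using p by (simp add: A_def)
    next
      assume p: "p \<in> D"
      hence "real m * real p \<le> x" using mono(1)[of p] unfolding D by linarith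
      thus ?thesis using p unfolding D by (simp add: A_def)
    qed
  qed
  have disj: "A e \<inter> D = {}" unfolding D_def[symmetric] using D by (auto simp: A_def)
  have finD: "finite D" using finA[of "Suc e"] AS by simp
  have "(\<Sum>p\<in>A (Suc e). g p) = (\<Sum>p\<in>A e. g p) + (\<Sum>p\<in>D. g p)"
    unfolding AS by (rule sum.union_disjoint[OF finA finD disj])
  thus ?case using Suc unfolding A_def D_def by simp
qed

lemma sum_half_powers_le: "(\<Sum>i<n. 1 / 2 ^ Suc i :: real) \<le> 1"
proof -
  have "(\<Sum>i<n. 1 / 2 ^ Suc i :: real) = 1 - 1 / 2 ^ n" by (induction n) (auto simp: field_simps)
  thus ?thesis by simp
qed

lemma exists_power_of_two_between:
  fixes t :: real
  assumes "t \<ge> 1"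
  obtains I :: nat where "t \<le> 2 ^ I" "2 ^ I \<le> 2 * t"
proof -
  define I where "I = nat \<lceil>log 2 t\<rceil>"
  have l: "log 2 t \<ge> 0" using assms by simp
  have "log 2 t \<le> real I" "real I \<le> log 2 t + 1" using l unfolding I_def by linarith+
  hence "2 powr (log 2 t) \<le> 2 powr (real I)" "2 powr (real I) \<le> 2 powr (log 2 t + 1)" by simp_all
  hence "t \<le> 2 ^ I" "2 ^ I \<le> 2 * t" using assms by (simp_all add: powr_realpow powr_add)
  thus ?thesis by (rule that)
qed

(* The implied constants C1, C2, C3 depend on c0 only, not on epsilon, c, x, alpha, a, q, f.  They are
   uniform for c in (0, c0], where c0 < 1 is arbitrary: as ln (1/c) tends to 0 when c tends to 1,
   no bound h <= C1 * (1/c)^2 * ln (1/c) with h >= 1 can be uniform on all of (0, 1). *)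
theorem corollary1p1:
  fixes c0 :: real
  assumes "0 < c0" "c0 < 1"
  shows "\<exists>C1>0. \<exists>C2>0. \<exists>C3>0. \<forall>\<epsilon>\<in>{0<..<1/10}. \<forall>c\<in>{0<..c0}.
    \<forall>\<^sub>F x :: real in at_top. \<forall>(\<alpha> :: real) (a :: int) (q :: int) (f :: nat \<Rightarrow> complex).
      coprime a q \<longrightarrow>
      ln x powr (2 + \<epsilon>) \<le> real_of_int q \<longrightarrow>
      real_of_int q \<le> x / ln x powr (3 + \<epsilon>) \<longrightarrow>
      \<bar>\<alpha> - real_of_int a / real_of_int q\<bar> \<le> 1 / (real_of_int q * x) \<longrightarrow>
      multiplicative_fun f \<longrightarrow> unit_disc_valued f \<longrightarrow>
      cmod (exp_sum f \<alpha> x) \<ge> c * x / ln x \<longrightarrow>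
      (\<exists>(h :: nat) (z :: real).
         h \<ge> 1 \<and> real h \<le> C1 * ((1 / c)\<^sup>2 * ln (1 / c)) \<and>
         C2 * (c\<^sup>2 * x / ln (1 / c)) \<le> z \<and> z \<le> x / (2 * real h) \<and>
         cmod (dyadic_prime_exp_sum f (real h * \<alpha>) z)
           \<ge> C3 * (c ^ 3 / ln (1 / c) * (z / ln z)))"
proof -
  define l0 where "l0 = ln (1 / c0)"
  have l0: "l0 > 0" using assms by (simp add: l0_def)
  \<comment> \<open>With \<open>H\<close> about \<open>A (1/c)\<^sup>2 ln (1/c)\<close>, the third condition gives \<open>10 ^ 7 * sqrt (ln H / H) \<le> c / 4\<close>, since \<open>(4 * 10 ^ 7)\<^sup>2 = 16 * 10 ^ 14\<close>.\<close>
  \<comment> \<open>It uses \<open>ln (1/c) \<ge> l0\<close>, and this is where \<open>c \<le> c0 < 1\<close> enters.\<close>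
  have "\<forall>\<^sub>F A::real in at_top. 1 \<le> A \<and> 8 \<le> A * l0 \<and> 1600000000000000 * (ln A / l0 + 3) \<le> A"
  proof (intro eventually_conj)
    show "\<forall>\<^sub>F A::real in at_top. 1 \<le> A" by (rule eventually_ge_at_top)
    show "\<forall>\<^sub>F A::real in at_top. 8 \<le> A * l0" using l0 by real_asymp
    show "\<forall>\<^sub>F A::real in at_top. 1600000000000000 * (ln A / l0 + 3) \<le> A" using l0 by real_asymp
  qed
  then obtain A where A: "1 \<le> A" "8 \<le> A * l0" "1600000000000000 * (ln A / l0 + 3) \<le> A"
    by (auto simp: eventually_at_top_linorder)
  have key: "\<forall>\<^sub>F x :: real in at_top. \<forall>(\<alpha> :: real) (a :: int) (q :: int) (f :: nat \<Rightarrow> complex).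
      coprime a q \<longrightarrow>
      ln x powr (2 + \<epsilon>) \<le> real_of_int q \<longrightarrow>
      real_of_int q \<le> x / ln x powr (3 + \<epsilon>) \<longrightarrow>
      \<bar>\<alpha> - real_of_int a / real_of_int q\<bar> \<le> 1 / (real_of_int q * x) \<longrightarrow>
      multiplicative_fun f \<longrightarrow> unit_disc_valued f \<longrightarrow>
      cmod (exp_sum f \<alpha> x) \<ge> c * x / ln x \<longrightarrow>
      (\<exists>(h :: nat) (z :: real).
         h \<ge> 1 \<and> real h \<le> 2 * A * ((1 / c)\<^sup>2 * ln (1 / c)) \<and>
         1 / (4 * A) * (c\<^sup>2 * x / ln (1 / c)) \<le> z \<and> z \<le> x / (2 * real h) \<and>
         cmod (dyadic_prime_exp_sum f (real h * \<alpha>) z)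
           \<ge> 1 / (16 * A) * (c ^ 3 / ln (1 / c) * (z / ln z)))"
    if \<epsilon>: "\<epsilon> \<in> {0<..<1/10}" and c: "c \<in> {0<..c0}" for \<epsilon> c :: real
  proof -
    define l where "l = ln (1 / c)"
    define t where "t = A * l / c ^ 2"
    have c0: "0 < c" "c \<le> c0" "c < 1" using c assms by auto
    have ll0: "l0 \<le> l" unfolding l0_def l_def using c0 assms by (simp add: frac_le)
    have l: "l > 0" using ll0 l0 by linarith
    have t8: "8 \<le> t"
    proof -
      have "8 \<le> A * l" using A(1,2) ll0 mult_left_mono[OF ll0, of A] by linarith
      also have "A * l \<le> t"
        using c0 A l unfolding t_def by (simp add: le_divide_eq mult_left_le power_le_one)
      finally show ?thesis .
    qed
    obtain I :: nat where I: "t \<le> 2 ^ I" "2 ^ I \<le> 2 * t" using exists_power_of_two_between[of t] t8 by auto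
    define H :: nat where "H = 2 ^ I"
    have Ht: "t \<le> real H" "real H \<le> 2 * t" using I by (simp_all add: H_def)
    have H8: "8 \<le> H" using Ht t8 by linarith
    have sq: "10000000 * sqrt (ln (real H) / real H) \<le> c / 4"
    proof -
      have "exp (1::real) \<le> t" using exp_le t8 by linarith
      hence "ln (real H) / real H \<le> ln t / t" using Ht by (intro ln_div_self_antimono)
      also have "ln t = ln A + ln l + 2 * l"
      proof -
        have "ln t = ln (A * l) - ln (c ^ 2)" unfolding t_def using A l c0 by (subst ln_div) auto
        also have "ln (A * l) = ln A + ln l" using A l by (subst ln_mult) auto
        also have "ln (c ^ 2) = - (2 * l)" using c0 by (simp add: l_def ln_div ln_realpow)
        finally show ?thesis by simp
      qed
      also have "(ln A + ln l + 2 * l) / t \<le> (ln A + 3 * l) / t"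
      proof (rule divide_right_mono)
        show "ln A + ln l + 2 * l \<le> ln A + 3 * l" using ln_le_minus_one[OF l] by linarith
      qed (use t8 in simp)
      also have "\<dots> = c ^ 2 * (ln A / l + 3) / A" using A l c0 by (simp add: t_def field_simps)
      also have "\<dots> \<le> c ^ 2 * (ln A / l0 + 3) / A"
        using A l l0 ll0 by (intro divide_right_mono mult_left_mono add_right_mono divide_left_mono) auto
      also have "\<dots> \<le> c ^ 2 * (A / 1600000000000000) / A"
      proof -
        have "u \<le> v / 1600000000000000" if "1600000000000000 * u \<le> v" for u v :: real using that by simp
        from this[OF A(3)] have "ln A / l0 + 3 \<le> A / 1600000000000000" .
        thus ?thesis using A(1) by (intro divide_right_mono mult_left_mono) simp_all
      qed
      also have "\<dots> = (c / 40000000) ^ 2" using A by (simp add: power_divide)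
      finally have "sqrt (ln (real H) / real H) \<le> c / 40000000" using c0 by (intro real_le_lsqrt) auto
      thus ?thesis by simp
    qed
    have \<epsilon>': "0 < \<epsilon>" "\<epsilon> < 1/10" using \<epsilon> by auto
    have c4: "c / 4 > 0" using c0 by simp
    have "\<forall>\<^sub>F x::real in at_top. 4 * real H ^ 2 \<le> x" by (rule eventually_ge_at_top)
    moreover have "\<forall>\<^sub>F x::real in at_top. x > 1" by (rule eventually_gt_at_top)
    ultimately show ?thesis
      using large_primes_carry_exp_sum[OF \<epsilon>' H_def H8 c4]
    proof eventually_elim
      case (elim x)
      define L where "L = ln x"
      have L: "L > 0" using elim(2) by (simp add: L_def)
      have x0: "x > 0" using elim(2) by simp
      show ?case
      proof (intro allI impI, rule ccontr)
        fix \<alpha> :: real and a q :: int and f :: "nat \<Rightarrow> complex"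
        assume as: "coprime a q" "ln x powr (2 + \<epsilon>) \<le> real_of_int q" "real_of_int q \<le> x / ln x powr (3 + \<epsilon>)"
          "\<bar>\<alpha> - real_of_int a / real_of_int q\<bar> \<le> 1 / (real_of_int q * x)" "multiplicative_fun f" "unit_disc_valued f"
          and big: "c * x / ln x \<le> cmod (exp_sum f \<alpha> x)"
          and no: "\<not> (\<exists>(h :: nat) (z :: real).
             h \<ge> 1 \<and> real h \<le> 2 * A * ((1 / c)\<^sup>2 * ln (1 / c)) \<and>
             1 / (4 * A) * (c\<^sup>2 * x / ln (1 / c)) \<le> z \<and> z \<le> x / (2 * real h) \<and>
             cmod (dyadic_prime_exp_sum f (real h * \<alpha>) z)
               \<ge> 1 / (16 * A) * (c ^ 3 / ln (1 / c) * (z / ln z)))"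
        define T where "T = (\<lambda>m. cmod (twisted_sum {p. prime p \<and> x < real (dyadic_scale H m) * real p \<and> real m * real p \<le> x} f (real m * \<alpha>)))"
        define b where "b = 1 / (16 * A) * (c ^ 3 / l)"
        have b0: "b > 0" using A c0 l by (simp add: b_def)
        \<comment> \<open>Under the negated conclusion the bounds for the dyadic pieces \<open>z = x / (m 2 ^ (i + 1))\<close> form a geometric series.\<close>
        have Tm: "T m \<le> b * (2 * x / L)" if m: "m \<in> {1..<H}" for m
        proof -
          define e where "e = dyadic_exponent H m"
          define z where "z = (\<lambda>i::nat. x / (real m * 2 ^ Suc i))"
          have m1: "1 \<le> m" "m < H" using m by auto
          have ke: "dyadic_scale H m = m * 2 ^ e" by (simp add: dyadic_scale_def e_def)
          have ds: "cmod (dyadic_prime_exp_sum f (real m * \<alpha>) (z i)) \<le> b * (2 * z i / L)" if i: "i < e" for i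
          proof -
            have z0: "z i > 0" using x0 m1 by (simp add: z_def)
            have "real m * 2 ^ Suc i \<le> real m * 2 ^ e" using i by (intro mult_left_mono power_increasing) auto
            also have "\<dots> = real (dyadic_scale H m)" by (simp add: ke)
            also have "\<dots> \<le> 2 * real H" using dyadic_scale_less[OF m1] by simp
            finally have mi: "real m * 2 ^ Suc i \<le> 2 * real H" .
            have mpos: "real m * 2 ^ Suc i > 0" using m1 by simp
            have zge: "x / (2 * real H) \<le> z i"
              unfolding z_def using mi mpos x0 by (intro divide_left_mono) auto
            have z1: "1 / (4 * A) * (c\<^sup>2 * x / l) \<le> z i"
            proof -
              have "1 / (4 * A) * (c\<^sup>2 * x / l) = x / (4 * t)" using c0 l A(1) by (simp add: t_def mult_ac)
              also have "\<dots> \<le> x / (2 * real H)" using Ht H8 x0 t8 by (intro divide_left_mono) auto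
              finally show ?thesis using zge by linarith
            qed
            have z2: "z i \<le> x / (2 * real m)"
            proof -
              have "real m * 2 ^ 1 \<le> real m * 2 ^ Suc i" by (intro mult_left_mono power_increasing) auto
              hence "z i \<le> x / (real m * 2 ^ 1)" unfolding z_def using m1 x0 by (intro divide_left_mono) auto
              thus ?thesis by (simp add: mult.commute)
            qed
            have h1: "real m \<le> 2 * A * ((1 / c)\<^sup>2 * l)"
            proof -
              have "real m \<le> 2 * t" using m1 Ht by linarith
              thus ?thesis by (simp add: t_def power_divide)
            qed
            have lt: "cmod (dyadic_prime_exp_sum f (real m * \<alpha>) (z i)) < b * (z i / ln (z i))"
              using no m1(1) h1 z1 z2 unfolding l_def[symmetric] b_def
              by (metis (no_types, lifting) mult.assoc not_le)
            have lnz: "L / 2 \<le> ln (z i)"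
            proof -
              have "sqrt x \<le> x / (2 * real H)"
              proof -
                have "2 * real H \<le> sqrt x" using elim(1) by (intro real_le_rsqrt) (simp add: power_mult_distrib)
                hence "sqrt x * (2 * real H) \<le> sqrt x * sqrt x" using x0 by (intro mult_left_mono) auto
                thus ?thesis using x0 H8 by (simp add: pos_le_divide_eq)
              qed
              hence "sqrt x \<le> z i" using zge by linarith
              hence "ln (sqrt x) \<le> ln (z i)" using x0 z0 by (subst ln_le_cancel_iff) auto
              thus ?thesis using x0 by (simp add: ln_sqrt L_def)
            qed
            have "z i / ln (z i) \<le> z i / (L / 2)" using lnz L z0 by (intro frac_le) auto
            hence "b * (z i / ln (z i)) \<le> b * (z i / (L / 2))" using b0 by (intro mult_left_mono) auto
            also have "z i / (L / 2) = 2 * z i / L" by simp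
            finally show ?thesis using lt by linarith
          qed
          have "T m = cmod (\<Sum>i<e. dyadic_prime_exp_sum f (real m * \<alpha>) (z i))"
            unfolding T_def ke sum_primes_dyadic[OF m1(1) x0] dyadic_prime_exp_sum_def z_def ..
          also have "\<dots> \<le> (\<Sum>i<e. b * (2 * z i / L))"
            by (rule order_trans[OF norm_sum]) (intro sum_mono ds, simp)
          also have "\<dots> = b * (2 / L) * (x / real m) * (\<Sum>i<e. 1 / 2 ^ Suc i)"
            by (simp add: z_def sum_distrib_left mult_ac)
          also have "\<dots> \<le> b * (2 / L) * x * 1"
          proof (rule mult_mono)
            show "(\<Sum>i<e. 1 / 2 ^ Suc i :: real) \<le> 1" by (rule sum_half_powers_le)
            show "b * (2 / L) * (x / real m) \<le> b * (2 / L) * x"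
            proof (rule mult_left_mono)
              have "x / real m \<le> x / 1" using m1 x0 by (intro divide_left_mono) auto
              thus "x / real m \<le> x" by simp
            qed (use b0 L in simp)
          qed (use b0 L x0 in \<open>auto intro: sum_nonneg\<close>)
          finally show ?thesis by (simp add: mult_ac)
        qed
        have "(\<Sum>m\<in>{1..<H}. T m) \<le> (\<Sum>m\<in>{1..<H}. b * (2 * x / L))" by (intro sum_mono Tm)
        also have "\<dots> = real (H - 1) * (b * (2 * x / L))" by simp
        also have "\<dots> \<le> (2 * t) * (b * (2 * x / L))" using Ht b0 x0 L by (intro mult_right_mono) auto
        also have "\<dots> = c / 4 * (x / L)" using A l c0 by (simp add: t_def b_def power2_eq_square power3_eq_cube)
        finally have T: "(\<Sum>m\<in>{1..<H}. T m) \<le> c / 4 * (x / L)" .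
        have "cmod (exp_sum f \<alpha> x) \<le> (\<Sum>m\<in>{1..<H}. T m) + 10000000 * (x / L) * sqrt (ln (real H) / real H) + c / 4 * (x / L)"
          using elim(3) as unfolding T_def L_def by blast
        moreover have "10000000 * (x / L) * sqrt (ln (real H) / real H) \<le> c / 4 * (x / L)"
        proof -
          have "x / L \<ge> 0" using x0 L by simp
          from mult_right_mono[OF sq this] show ?thesis by (simp add: mult_ac)
        qed
        moreover have "c * x / ln x = 4 * (c / 4 * (x / L))" by (simp add: L_def)
        moreover have "c / 4 * (x / L) > 0" using c0 x0 L by simp
        ultimately show False using T big by linarith
      qed
    qed
  qed
  have A0: "A > 0" using A by linarith
  show ?thesis
  proof (intro exI conjI ballI)
    show "2 * A > 0" "1 / (4 * A) > 0" "1 / (16 * A) > 0" using A0 by simp_all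
  qed (rule key)
qed

end
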